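(* Let $d\ge1$, $0<p,q\le\infty$ and $t\in\mathbb{R}$ be fixed. If $0<p_0,q_0\le\infty$ and $t_0\in\mathbb{R}$ are such that $B^{td}_{p,q}(\mathbb{R}^d)\hookrightarrow S^{t_0}_{p_0,q_0}B(\mathbb{R}^d)$, then $S^t_{p,q}B(\mathbb{R}^d)\hookrightarrow S^{t_0}_{p_0,q_0}B(\mathbb{R}^d)$. (That is, within all spaces $S^{t_0}_{p_0,q_0}B(\mathbb{R}^d)$ into which $B^{td}_{p,q}(\mathbb{R}^d)$ embeds continuously, the class $S^t_{p,q}B(\mathbb{R}^d)$ is the smallest one.)
   Context: Isotropic Besov spaces: let $\psi_0\in C_0^\infty(\mathbb{R}^d)$ with $\psi_0(x)=1$ if $\max_i|x_i|\le1$ and $\psi_0(x)=0$ if $\max_i|x_i|\ge 3/2$, and $\psi_j(x)=\psi_0(2^{-j}x)-\psi_0(2^{-j+1}x)$, $j\in\mathbb{N}$. For $s\in\mathbb{R}$, $0<p,q\le\infty$, $B^s_{p,q}(\mathbb{R}^d)$ is the set of tempered distributions $f$ with $\big(\sum_{j\ge0}2^{jsq}\|\mathcal{F}^{-1}[\psi_j\mathcal{F}f]\|_{L_p}^q\big)^{1/q}<\infty$ (modification if $q=\infty$), $\mathcal{F}$ the Fourier transform. Dominating mixed spaces: let $\varphi_0\in C_0^\infty(\mathbb{R})$ with $\varphi_0=1$ on $[-1,1]$, $\operatorname{supp}\varphi_0\subset[-3/2,3/2]$, $\varphi_j(s)=\varphi_0(2^{-j}s)-\varphi_0(2^{-j+1}s)$,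 and $\varphi_{\bar k}(x)=\prod_{i=1}^d\varphi_{k_i}(x_i)$, $|\bar k|=k_1+\dots+k_d$. $S^t_{p,q}B(\mathbb{R}^d)$ is the set of tempered distributions $f$ with $\big(\sum_{\bar k\in\mathbb{N}_0^d}2^{|\bar k|tq}\|\mathcal{F}^{-1}[\varphi_{\bar k}\mathcal{F}f]\|_{L_p}^q\big)^{1/q}<\infty$. $\hookrightarrow$ is a continuous embedding. *)

theory Defs
  imports "HOL-Analysis.Analysis"
begin

definition partial_deriv :: "'a::euclidean_space \<Rightarrow> ('a \<Rightarrow> 'b::real_normed_vector) \<Rightarrow> 'a \<Rightarrow> 'b" where
  "partial_deriv b f x = vector_derivative (\<lambda>t::real. f (x + t *\<^sub>R b)) (at 0)"

fun iter_partial :: "'a::euclidean_space list \<Rightarrow> ('a \<Rightarrow> 'b::real_normed_vector) \<Rightarrow> 'a \<Rightarrow> 'b" where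
  "iter_partial [] f = f"
| "iter_partial (b # bs) f = partial_deriv b (iter_partial bs f)"

definition smooth :: "('a::euclidean_space \<Rightarrow> 'b::real_normed_vector) \<Rightarrow> bool" where
  "smooth f \<longleftrightarrow> (\<forall>bs. set bs \<subseteq> Basis \<longrightarrow>
      continuous_on UNIV (iter_partial bs f) \<and>
      (\<forall>b\<in>Basis. \<forall>x. (\<lambda>t::real. iter_partial bs f (x + t *\<^sub>R b)) differentiable (at 0)))"

definition schwartz_seminorm :: "nat \<Rightarrow> 'a::euclidean_space list \<Rightarrow> ('a \<Rightarrow> complex) \<Rightarrow> real" where
  "schwartz_seminorm N bs \<phi> = (SUP x. (1 + norm x) ^ N * norm (iter_partial bs \<phi> x))"

definition schwartz :: "('a::euclidean_space \<Rightarrow> complex) set" where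
  "schwartz = {\<phi>. smooth \<phi> \<and>
      (\<forall>N bs. set bs \<subseteq> Basis \<longrightarrow> bounded (range (\<lambda>x. (1 + norm x) ^ N * norm (iter_partial bs \<phi> x))))}"

definition tempered :: "(('a::euclidean_space \<Rightarrow> complex) \<Rightarrow> complex) \<Rightarrow> bool" where
  "tempered T \<longleftrightarrow>
     (\<forall>\<phi>\<in>schwartz. \<forall>\<theta>\<in>schwartz. T (\<lambda>x. \<phi> x + \<theta> x) = T \<phi> + T \<theta>) \<and>
     (\<forall>\<phi>\<in>schwartz. \<forall>c. T (\<lambda>x. c * \<phi> x) = c * T \<phi>) \<and>
     (\<exists>C N M. \<forall>\<phi>\<in>schwartz. norm (T \<phi>) \<le>
        C * (\<Sum>bs\<in>{bs. set bs \<subseteq> Basis \<and> length bs \<le> M}. schwartz_seminorm N bs \<phi>))"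

text \<open>Kernel of the Fourier multiplier with symbol m: the inverse Fourier transform of m,
  K(y) = (2 pi)^(-d) * integral of exp(i y.xi) m(xi) d xi.  Then
  F^(-1)[m F T](x) = T(y |-> K(x - y)) for a tempered distribution T (convention-free).\<close>
definition mult_kernel :: "('a::euclidean_space \<Rightarrow> real) \<Rightarrow> 'a \<Rightarrow> complex" where
  "mult_kernel m y = complex_of_real ((2 * pi) powr (- real DIM('a))) *
      integral\<^sup>L lborel (\<lambda>\<xi>. cis (y \<bullet> \<xi>) * complex_of_real (m \<xi>))"

definition fourier_mult :: "('a::euclidean_space \<Rightarrow> real) \<Rightarrow> (('a \<Rightarrow> complex) \<Rightarrow> complex) \<Rightarrow> 'a \<Rightarrow> complex" where
  "fourier_mult m T x = T (\<lambda>y. mult_kernel m (x - y))"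

definition ennpow :: "ennreal \<Rightarrow> real \<Rightarrow> ennreal" where
  "ennpow x r = (if x = \<infinity> then \<infinity> else ennreal (enn2real x powr r))"

definition Lp_norm :: "ennreal \<Rightarrow> ('a::euclidean_space \<Rightarrow> complex) \<Rightarrow> ennreal" where
  "Lp_norm p g = (if p = \<infinity> then Inf {c. AE x in lborel. ennreal (norm (g x)) \<le> c}
     else ennpow (\<integral>\<^sup>+ x. ennreal (norm (g x) powr enn2real p) \<partial>lborel) (1 / enn2real p))"

definition lq_norm :: "ennreal \<Rightarrow> ('i \<Rightarrow> ennreal) \<Rightarrow> ennreal" where
  "lq_norm q a = (if q = \<infinity> then (SUP i. a i)
     else ennpow (\<integral>\<^sup>+ i. ennpow (a i) (enn2real q) \<partial>count_space UNIV) (1 / enn2real q))"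

definition admissible_iso :: "(real^'n \<Rightarrow> real) \<Rightarrow> bool" where
  "admissible_iso \<psi>0 \<longleftrightarrow> smooth \<psi>0 \<and>
     (\<forall>x. (\<forall>i. \<bar>x $ i\<bar> \<le> 1) \<longrightarrow> \<psi>0 x = 1) \<and>
     (\<forall>x. (\<exists>i. \<bar>x $ i\<bar> \<ge> 3/2) \<longrightarrow> \<psi>0 x = 0)"

definition psi_j :: "(real^'n \<Rightarrow> real) \<Rightarrow> nat \<Rightarrow> real^'n \<Rightarrow> real" where
  "psi_j \<psi>0 j x = (if j = 0 then \<psi>0 x
      else \<psi>0 ((2 powr (- real j)) *\<^sub>R x) - \<psi>0 ((2 powr (- real j + 1)) *\<^sub>R x))"

definition besov_norm :: "(real^'n \<Rightarrow> real) \<Rightarrow> real \<Rightarrow> ennreal \<Rightarrow> ennreal \<Rightarrow>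
    ((real^'n \<Rightarrow> complex) \<Rightarrow> complex) \<Rightarrow> ennreal" where
  "besov_norm \<psi>0 s p q f =
     lq_norm q (\<lambda>j::nat. ennreal (2 powr (real j * s)) * Lp_norm p (fourier_mult (psi_j \<psi>0 j) f))"

definition besov :: "(real^'n \<Rightarrow> real) \<Rightarrow> real \<Rightarrow> ennreal \<Rightarrow> ennreal \<Rightarrow>
    ((real^'n \<Rightarrow> complex) \<Rightarrow> complex) set" where
  "besov \<psi>0 s p q = {f. tempered f \<and> besov_norm \<psi>0 s p q f < \<infinity>}"

definition admissible_1d :: "(real \<Rightarrow> real) \<Rightarrow> bool" where
  "admissible_1d \<phi>0 \<longleftrightarrow> smooth \<phi>0 \<and>
     (\<forall>s. \<bar>s\<bar> \<le> 1 \<longrightarrow> \<phi>0 s = 1) \<and> (\<forall>s. \<bar>s\<bar> > 3/2 \<longrightarrow> \<phi>0 s = 0)"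

definition phi_j :: "(real \<Rightarrow> real) \<Rightarrow> nat \<Rightarrow> real \<Rightarrow> real" where
  "phi_j \<phi>0 j s = (if j = 0 then \<phi>0 s
      else \<phi>0 (2 powr (- real j) * s) - \<phi>0 (2 powr (- real j + 1) * s))"

definition phi_multi :: "(real \<Rightarrow> real) \<Rightarrow> ('n::finite \<Rightarrow> nat) \<Rightarrow> real^'n \<Rightarrow> real" where
  "phi_multi \<phi>0 k x = (\<Prod>i\<in>UNIV. phi_j \<phi>0 (k i) (x $ i))"

definition mixed_norm :: "(real \<Rightarrow> real) \<Rightarrow> real \<Rightarrow> ennreal \<Rightarrow> ennreal \<Rightarrow>
    ((real^'n::finite \<Rightarrow> complex) \<Rightarrow> complex) \<Rightarrow> ennreal" where
  "mixed_norm \<phi>0 t p q f =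
     lq_norm q (\<lambda>k::'n \<Rightarrow> nat. ennreal (2 powr (real (\<Sum>i\<in>UNIV. k i) * t)) *
        Lp_norm p (fourier_mult (phi_multi \<phi>0 k) f))"

definition mixed_besov :: "(real \<Rightarrow> real) \<Rightarrow> real \<Rightarrow> ennreal \<Rightarrow> ennreal \<Rightarrow>
    ((real^'n::finite \<Rightarrow> complex) \<Rightarrow> complex) set" where
  "mixed_besov \<phi>0 t p q = {f. tempered f \<and> mixed_norm \<phi>0 t p q f < \<infinity>}"

definition embeds :: "'x set \<Rightarrow> ('x \<Rightarrow> ennreal) \<Rightarrow> 'x set \<Rightarrow> ('x \<Rightarrow> ennreal) \<Rightarrow> bool" where
  "embeds X nX Y nY \<longleftrightarrow> X \<subseteq> Y \<and> (\<exists>C::real. \<forall>f\<in>X. nY f \<le> ennreal C * nX f)"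

end

theory Submission
  imports Defs "HOL-Probability.Probability"
begin

text \<open>
  Test the hypothesis with the inverse Fourier transforms of smooth bumps whose dyadic dilates live
  where every element of either resolution of unity is identically 0 or 1, so that both norms are
  explicit. Low-frequency dilates force \<open>p \<le> p0\<close>. Single high-frequency dilates force
  \<open>\<delta> \<ge> 0\<close> for \<open>\<delta> = (t - 1/p) - (t0 - 1/p0)\<close>, and sums of N of them with coefficients that
  equalise the terms of the Besov norm force \<open>q \<le> q0\<close> if \<open>\<delta> = 0\<close>, by letting N tend to infinity.

  Conversely, Nikolskii's inequality bounds the \<open>p0\<close>-norm of the k-th dyadic block of a distribution
  by \<open>2 powr (|k| (1/p - 1/p0))\<close> times its p-norm. The blocks thus lose a factor
  \<open>2 powr (- \<delta> |k|)\<close>, and the embedding follows by summing a geometric series if \<open>\<delta> > 0\<close>, and from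
  the inclusion of the sequence spaces if \<open>\<delta> = 0\<close> and \<open>q \<le> q0\<close>. Nikolskii's inequality itself comes
  from the reproducing formula F = F * K for a block F, where K is the kernel of a cutoff that
  equals 1 on the spectrum of F.

  The index type of the conclusion of the theorem is not tied to the index type 'n of its
  hypothesis. The argument covers this because the necessary conditions do not involve the dimension.
\<close>

text \<open>The smoothness td is matched to t on the diagonal: a bump whose n coordinates all have
  size 2^m meets only the isotropic block m, with weight 2^(m t n), and only the mixed block
  (m,...,m), of order m n, with weight 2^(m n t). On such functions the norms of the two source
  spaces agree, which is why the isotropic hypothesis yields conditions strong enough for the mixed
  source. Low frequencies isolate the integrability exponents: a spectrum in the unit cube meets
  only block zero, and both norms become plain Lebesgue quasi-norms. Two obstacles shape the rest. A
  block of a tempered distribution is a priori only of polynomial growth, and for p < 1 Hoelder's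
  and Young's inequalities fail, so the reproducing formula is used as a self-improving estimate of
  a weighted supremum. The formula itself requires a tempered distribution to pass under a
  convolution integral, which is done by finite sums of translates with control of every seminorm.
  Reciprocals of exponents go through \<open>enn2real\<close>, which sends infinity to 0, so 1 /
  infinity reads as 0 throughout.\<close>

section \<open>Derivatives and continuity of parameter integrals\<close>

text \<open>Dominated convergence needs limits of difference quotients along sequences rather than a
  bound on the remainder.\<close>

lemma has_vector_derivative_iff_quotient:
  "(f has_vector_derivative D) (at s) \<longleftrightarrow> ((\<lambda>t. (f t - f s) /\<^sub>R (t - s)) \<longlongrightarrow> D) (at s)"
proof -
  have eq: "norm (f y - f s - (y - s) *\<^sub>R D) / norm (y - s) = norm ((f y - f s) /\<^sub>R (y - s) - D)"
    if "y \<noteq> s" for y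
  proof -
    have "(f y - f s) /\<^sub>R (y - s) - D = (f y - f s - (y - s) *\<^sub>R D) /\<^sub>R (y - s)"
      using that by (simp add: scaleR_diff_right)
    then show ?thesis by (simp add: divide_inverse mult.commute)
  qed
  have "(f has_vector_derivative D) (at s) \<longleftrightarrow>
      ((\<lambda>y. norm (f y - f s - (y - s) *\<^sub>R D) / norm (y - s)) \<longlongrightarrow> 0) (at s)"
    unfolding has_vector_derivative_def has_derivative_iff_norm
    by (simp add: bounded_linear_scaleR_left)
  also have "\<dots> \<longleftrightarrow> ((\<lambda>y. norm ((f y - f s) /\<^sub>R (y - s) - D)) \<longlongrightarrow> 0) (at s)"
    by (rule filterlim_cong) (auto simp: eventually_at_filter eq[simplified] intro!: always_eventually)
  finally show ?thesis
    by (simp add: tendsto_norm_zero_iff LIM_zero_iff)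
qed

lemma has_vector_derivative_bound:
  fixes f :: "real \<Rightarrow> 'b::real_normed_vector"
  assumes "convex S" and "\<And>t. t \<in> S \<Longrightarrow> (f has_vector_derivative f' t) (at t)"
    and "\<And>t. t \<in> S \<Longrightarrow> norm (f' t) \<le> B" and "s \<in> S" "t \<in> S"
  shows "norm (f t - f s) \<le> B * \<bar>t - s\<bar>"
proof -
  have "onorm (\<lambda>x. x *\<^sub>R f' u) \<le> B" if "u \<in> S" for u
    using assms(3)[OF that] by (intro onorm_le) (simp add: mult.commute[of B] mult_left_mono)
  then show ?thesis
    using differentiable_bound[of S f "\<lambda>u x. x *\<^sub>R f' u" B t s] assms
    by (auto simp: has_vector_derivative_def intro: has_derivative_at_withinI)
qed

text \<open>Along a sequence tending to s the difference quotients converge pointwise and, by the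
  mean value inequality, stay below w. The majorant is only asked for when |t - s| < 1: for
  translates of a compactly supported function no integrable majorant works for all t at
  once.\<close>

lemma has_vector_derivative_lebesgue_integral:
  fixes F :: "real \<Rightarrow> 'a \<Rightarrow> 'b::{banach, second_countable_topology}"
  assumes int: "\<And>t. integrable M (F t)"
    and deriv: "\<And>t x. ((\<lambda>t. F t x) has_vector_derivative F' t x) (at t)"
    and bound: "\<And>t x. \<bar>t - s\<bar> < 1 \<Longrightarrow> norm (F' t x) \<le> w x"
    and w: "integrable M w" and meas: "F' s \<in> borel_measurable M"
  shows "((\<lambda>t. \<integral>x. F t x \<partial>M) has_vector_derivative (\<integral>x. F' s x \<partial>M)) (at s)"
proof -
  define S where "S = {s - 1<..<s + 1}"
  have S: "at s = at s within S" "convex S" "s \<in> S"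
    by (auto simp: S_def intro!: at_within_open[symmetric])
  have bound': "norm (F' t x) \<le> w x" if "t \<in> S" for t x
    using that bound[of t x] by (auto simp: S_def abs_less_iff)
  show ?thesis
    unfolding has_vector_derivative_iff_quotient unfolding S(1) unfolding tendsto_at_iff_sequentially
  proof (intro allI impI)
    fix X :: "nat \<Rightarrow> real" assume X: "\<forall>i. X i \<in> S - {s}" "X \<longlonglongrightarrow> s"
    have "(\<lambda>i. \<integral>x. (F (X i) x - F s x) /\<^sub>R (X i - s) \<partial>M) \<longlonglongrightarrow> (\<integral>x. F' s x \<partial>M)"
    proof (rule integral_dominated_convergence[where w = w])
      show "AE x in M. (\<lambda>i. (F (X i) x - F s x) /\<^sub>R (X i - s)) \<longlonglongrightarrow> F' s x"
      proof (rule AE_I2)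
        fix x
        show "(\<lambda>i. (F (X i) x - F s x) /\<^sub>R (X i - s)) \<longlonglongrightarrow> F' s x"
          using deriv[of x s, unfolded has_vector_derivative_iff_quotient tendsto_at_iff_sequentially]
            X by (auto simp: o_def)
      qed
      show "AE x in M. norm ((F (X i) x - F s x) /\<^sub>R (X i - s)) \<le> w x" for i
      proof (rule AE_I2)
        fix x
        have "norm (F (X i) x - F s x) \<le> w x * \<bar>X i - s\<bar>"
          using has_vector_derivative_bound[OF S(2) deriv bound' S(3), of "X i" x] X by auto
        moreover have "X i \<noteq> s" using X by auto
        ultimately show "norm ((F (X i) x - F s x) /\<^sub>R (X i - s)) \<le> w x"
          by (simp add: divide_inverse[symmetric] pos_divide_le_eq mult.commute[of "inverse _"])
      qed
      show "(\<lambda>x. (F (X i) x - F s x) /\<^sub>R (X i - s)) \<in> borel_measurable M" for i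
        using int[of "X i"] int[of s] by measurable
    qed (use w meas in auto)
    then show "((\<lambda>t. ((\<integral>x. F t x \<partial>M) - (\<integral>x. F s x \<partial>M)) /\<^sub>R (t - s)) \<circ> X) \<longlonglongrightarrow> (\<integral>x. F' s x \<partial>M)"
      by (simp add: o_def int)
  qed
qed

lemma continuous_on_lebesgue_integral:
  fixes F :: "'c::metric_space \<Rightarrow> 'a \<Rightarrow> 'b::{banach, second_countable_topology}"
  assumes "\<And>t. F t \<in> borel_measurable M" and "\<And>x. continuous_on UNIV (\<lambda>t. F t x)"
    and "\<And>t x. norm (F t x) \<le> w x" and "integrable M w"
  shows "continuous_on UNIV (\<lambda>t. \<integral>x. F t x \<partial>M)"
proof (rule continuous_at_imp_continuous_on, intro ballI)
  fix t
  have "continuous (at t) (\<lambda>t. F t x)" for x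
    using assms(2)[of x] by (simp add: continuous_on_eq_continuous_at)
  then show "continuous (at t) (\<lambda>t. \<integral>x. F t x \<partial>M)"
    unfolding continuous_within tendsto_at_iff_sequentially
    by (intro allI impI, unfold o_def, intro integral_dominated_convergence[where w = w])
       (use assms in \<open>auto simp: o_def\<close>)
qed

section \<open>Smooth functions\<close>

lemma partial_derivI:
  "((\<lambda>t::real. f (x + t *\<^sub>R b)) has_vector_derivative D) (at 0) \<Longrightarrow> partial_deriv b f x = D"
  unfolding partial_deriv_def by (rule vector_derivative_at)

lemma iter_partial_append: "iter_partial (bs @ cs) f = iter_partial bs (iter_partial cs f)"
  by (induction bs) auto

lemma iter_partial_closed:
  assumes "f \<in> S" and "\<And>g b. g \<in> S \<Longrightarrow> b \<in> Basis \<Longrightarrow> partial_deriv b g \<in> S" and "set bs \<subseteq> Basis"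
  shows "iter_partial bs f \<in> S"
  using assms(3) by (induction bs) (auto simp: assms)

text \<open>\<open>smooth\<close> quantifies over arbitrary lists of directions. Instead of formulas
  for higher derivatives, a set of continuous functions closed under each coordinate derivative is
  exhibited; all iterated derivatives then stay inside it. Products, compositions, Fourier
  transforms and convolutions only differ in the choice of this set.\<close>

lemma smooth_coinduct:
  assumes "f \<in> S" and "\<And>g. g \<in> S \<Longrightarrow> continuous_on UNIV g"
    and step: "\<And>g b. g \<in> S \<Longrightarrow> b \<in> Basis \<Longrightarrow>
      \<exists>g'\<in>S. \<forall>x. ((\<lambda>t::real. g (x + t *\<^sub>R b)) has_vector_derivative g' x) (at 0)"
  shows "smooth f"
proof -
  have "partial_deriv b g \<in> S" if "g \<in> S" "b \<in> Basis" for g b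
  proof -
    obtain g' where g': "g' \<in> S" "\<forall>x. ((\<lambda>t::real. g (x + t *\<^sub>R b)) has_vector_derivative g' x) (at 0)"
      using step \<open>g \<in> S\<close> \<open>b \<in> Basis\<close> by blast
    then have "partial_deriv b g = g'" by (intro ext partial_derivI) auto
    with g' show ?thesis by simp
  qed
  then have "iter_partial bs f \<in> S" if "set bs \<subseteq> Basis" for bs
    using iter_partial_closed[OF assms(1) _ that] by blast
  with assms(2) step show ?thesis
    unfolding smooth_def by (meson differentiableI_vector)
qed

lemma smooth_partial_deriv: "smooth f \<Longrightarrow> b \<in> Basis \<Longrightarrow> smooth (partial_deriv b f)"
  unfolding smooth_def
proof (intro allI impI)
  fix bs :: "'a list" assume f: "\<forall>bs. set bs \<subseteq> Basis \<longrightarrow> continuous_on UNIV (iter_partial bs f) \<and>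
      (\<forall>b\<in>Basis. \<forall>x. (\<lambda>t::real. iter_partial bs f (x + t *\<^sub>R b)) differentiable (at 0))"
    and "b \<in> Basis" "set bs \<subseteq> Basis"
  then show "continuous_on UNIV (iter_partial bs (partial_deriv b f)) \<and>
      (\<forall>b'\<in>Basis. \<forall>x. (\<lambda>t::real. iter_partial bs (partial_deriv b f) (x + t *\<^sub>R b')) differentiable (at 0))"
    using f[rule_format, of "bs @ [b]"] by (simp add: iter_partial_append)
qed

lemma smooth_iter_partial: "smooth f \<Longrightarrow> set bs \<subseteq> Basis \<Longrightarrow> smooth (iter_partial bs f)"
  using iter_partial_closed[of f "Collect smooth" bs] by (auto simp: smooth_partial_deriv)

lemma smooth_imp_continuous_on: "smooth f \<Longrightarrow> continuous_on UNIV f"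
  unfolding smooth_def by (drule spec[of _ "[]"]) simp

text \<open>\<open>smooth\<close> speaks of differentiability only at parameter 0 of each line.
  Restarting the line at \<open>x + s *\<^sub>R b\<close> gives the derivative at every s, as the
  mean value inequality demands.\<close>

lemma smooth_has_vector_derivative:
  assumes "smooth f" "b \<in> Basis"
  shows "((\<lambda>t::real. f (x + t *\<^sub>R b)) has_vector_derivative partial_deriv b f (x + s *\<^sub>R b)) (at s)"
proof -
  have "(\<lambda>t::real. f (x + s *\<^sub>R b + t *\<^sub>R b)) differentiable (at 0)"
    using assms(1)[unfolded smooth_def, rule_format, of "[]"] assms(2) by simp
  then have "((\<lambda>t::real. f (x + s *\<^sub>R b + t *\<^sub>R b)) has_vector_derivative partial_deriv b f (x + s *\<^sub>R b)) (at 0)"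
    unfolding partial_deriv_def vector_derivative_works .
  then have "((\<lambda>t. (\<lambda>t::real. f (x + s *\<^sub>R b + t *\<^sub>R b)) (t - s)) has_vector_derivative
      (1 :: real) *\<^sub>R partial_deriv b f (x + s *\<^sub>R b)) (at s)"
    by (intro vector_diff_chain_at[unfolded o_def]) (auto intro!: derivative_eq_intros)
  then show ?thesis by (simp add: algebra_simps)
qed

lemmas smooth_has_vector_derivative_0 = smooth_has_vector_derivative[where s = 0, simplified]

lemma smooth_const: "smooth (\<lambda>x. c)"
  by (rule smooth_coinduct[where S = "range (\<lambda>c x. c)"]) (auto intro: exI[of _ 0])

lemma smooth_bounded_linear:
  assumes "bounded_linear L"
  shows "smooth L"
proof -
  interpret bounded_linear L by fact
  show ?thesis
  proof (rule smooth_coinduct[where S = "insert L (range (\<lambda>c x. c))"])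
    fix g and b :: 'a assume "g \<in> insert L (range (\<lambda>c x. c))"
    then consider "g = L" | "g \<in> range (\<lambda>c x. c)" by blast
    then show "\<exists>g'\<in>insert L (range (\<lambda>c x. c)). \<forall>x. ((\<lambda>t. g (x + t *\<^sub>R b)) has_vector_derivative g' x) (at 0)"
    proof cases
      case 1
      have "((\<lambda>t. g (x + t *\<^sub>R b)) has_vector_derivative L b) (at 0)" for x
        unfolding 1 add scale by (auto intro!: derivative_eq_intros)
      then show ?thesis by (intro bexI[of _ "\<lambda>x. L b"]) auto
    next
      case 2
      then show ?thesis by (auto intro: exI[of _ 0])
    qed
  qed (auto intro: continuous_on continuous_on_id)
qed

lemma smooth_compose_bounded_linear:
  fixes f :: "'a::euclidean_space \<Rightarrow> 'b::real_normed_vector" and L :: "'b \<Rightarrow> 'c::real_normed_vector"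
  assumes "bounded_linear L" and "smooth f"
  shows "smooth (\<lambda>x. L (f x))"
proof (rule smooth_coinduct[where S = "{\<lambda>x. L (g x) |g. smooth g}"])
  interpret bounded_linear L by fact
  show "(\<lambda>x. L (f x)) \<in> {\<lambda>x. L (g x) |g. smooth g}"
    using assms by blast
  show "continuous_on UNIV h" if "h \<in> {\<lambda>x. L (g x) |g. smooth g}" for h :: "'a \<Rightarrow> 'c"
    using that by (auto intro!: continuous_on dest: smooth_imp_continuous_on)
  fix h :: "'a \<Rightarrow> 'c" and b :: 'a assume "h \<in> {\<lambda>x. L (g x) |g. smooth g}" and b: "b \<in> Basis"
  then obtain g where g: "h = (\<lambda>x. L (g x))" "smooth g" by blast
  have "\<forall>x::'a. ((\<lambda>t. h (x + t *\<^sub>R b)) has_vector_derivative L (partial_deriv b g x)) (at 0)"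
    unfolding g by (intro allI has_vector_derivative smooth_has_vector_derivative_0 g b)
  then show "\<exists>g'\<in>{\<lambda>x. L (g x) |g. smooth g}. \<forall>x. ((\<lambda>t. h (x + t *\<^sub>R b)) has_vector_derivative g' x) (at 0)"
    using smooth_partial_deriv[OF g(2) b] by (intro bexI[where x = "\<lambda>x. L (partial_deriv b g x)"]) auto
qed

text \<open>A single product is not stable under differentiation, but finite sums of products are,
  by the Leibniz rule; this is the invariant set for \<open>smooth_coinduct\<close>. It also yields
  sums of smooth functions, with one factor equal to 1.\<close>

inductive_set sums_of_products :: "('a::euclidean_space \<Rightarrow> 'b::real_normed_algebra) set" where
  product: "smooth f \<Longrightarrow> smooth g \<Longrightarrow> (\<lambda>x. f x * g x) \<in> sums_of_products"
| sum: "u \<in> sums_of_products \<Longrightarrow> v \<in> sums_of_products \<Longrightarrow> (\<lambda>x. u x + v x) \<in> sums_of_products"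

lemma sums_of_products_derivative:
  assumes "u \<in> sums_of_products" "b \<in> Basis"
  shows "\<exists>u'\<in>sums_of_products. \<forall>x. ((\<lambda>t::real. u (x + t *\<^sub>R b)) has_vector_derivative u' x) (at 0)"
  using assms(1)
proof induction
  case (product f g)
  have "(\<lambda>x. f x * partial_deriv b g x + partial_deriv b f x * g x) \<in> sums_of_products"
    using product assms(2) by (intro sums_of_products.intros smooth_partial_deriv)
  moreover have "((\<lambda>t. f (x + t *\<^sub>R b) * g (x + t *\<^sub>R b)) has_vector_derivative
      f x * partial_deriv b g x + partial_deriv b f x * g x) (at 0)" for x
    using has_vector_derivative_mult[OF smooth_has_vector_derivative_0[OF product(1) assms(2)]
        smooth_has_vector_derivative_0[OF product(2) assms(2)], of x x] by simp
  ultimately show ?case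
    by (intro bexI[of _ "\<lambda>x. f x * partial_deriv b g x + partial_deriv b f x * g x"]) auto
next
  case (sum u v)
  then obtain u' v' where "u' \<in> sums_of_products" "v' \<in> sums_of_products"
    "\<forall>x. ((\<lambda>t. u (x + t *\<^sub>R b)) has_vector_derivative u' x) (at 0)"
    "\<forall>x. ((\<lambda>t. v (x + t *\<^sub>R b)) has_vector_derivative v' x) (at 0)"
    by blast
  then show ?case
    by (intro bexI[of _ "\<lambda>x. u' x + v' x"] allI has_vector_derivative_add sums_of_products.sum) auto
qed

lemma sums_of_products_smooth:
  assumes "u \<in> sums_of_products" shows "smooth u"
proof (rule smooth_coinduct[OF assms])
  show "continuous_on UNIV g" if "g \<in> sums_of_products" for g :: "'a \<Rightarrow> 'b"
    using that by induction (auto intro!: continuous_intros dest: smooth_imp_continuous_on)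
qed (rule sums_of_products_derivative)

lemma smooth_mult:
  fixes f g :: "'a::euclidean_space \<Rightarrow> 'b::real_normed_algebra"
  shows "smooth f \<Longrightarrow> smooth g \<Longrightarrow> smooth (\<lambda>x. f x * g x)"
  by (rule sums_of_products_smooth[OF sums_of_products.product])

lemma smooth_add:
  fixes f g :: "'a::euclidean_space \<Rightarrow> 'b::real_normed_algebra_1"
  assumes "smooth f" "smooth g"
  shows "smooth (\<lambda>x. f x + g x)"
  using sums_of_products_smooth[OF sums_of_products.sum[OF sums_of_products.product[OF assms(1) smooth_const[of 1]]
        sums_of_products.product[OF assms(2) smooth_const[of 1]]]] by simp

lemma smooth_diff:
  fixes f g :: "'a::euclidean_space \<Rightarrow> 'b::real_normed_algebra_1"
  assumes "smooth f" "smooth g"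
  shows "smooth (\<lambda>x. f x - g x)"
  using smooth_add[OF assms(1) smooth_mult[OF smooth_const[of "-1"] assms(2)]] by simp

lemma smooth_prod:
  fixes f :: "'i \<Rightarrow> 'a::euclidean_space \<Rightarrow> 'b::{real_normed_algebra_1, comm_monoid_mult}"
  assumes "\<And>i. i \<in> I \<Longrightarrow> smooth (f i)"
  shows "smooth (\<lambda>x. \<Prod>i\<in>I. f i x)"
  using assms by (induction I rule: infinite_finite_induct) (auto intro: smooth_const smooth_mult)

section \<open>Diagonal dilations and affine maps that respect the axes\<close>

text \<open>The factor may differ from axis to axis because the dyadic block of index k lives in a
  box with sides of order 2^(k i).\<close>

definition dilation :: "('a::euclidean_space \<Rightarrow> real) \<Rightarrow> 'a \<Rightarrow> 'a" where
  "dilation d x = (\<Sum>b\<in>Basis. (d b * (x \<bullet> b)) *\<^sub>R b)"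

lemma dilation_inner_Basis: "b \<in> Basis \<Longrightarrow> dilation d x \<bullet> b = d b * (x \<bullet> b)"
  by (simp add: dilation_def inner_sum_left inner_Basis if_distrib sum.delta cong: if_cong)

lemma dilation_const: "dilation (\<lambda>_. c) x = c *\<^sub>R x"
  by (rule euclidean_eqI) (simp add: dilation_inner_Basis)

lemma dilation_inverse:
  "(\<And>b. b \<in> Basis \<Longrightarrow> d b \<noteq> 0) \<Longrightarrow> dilation (\<lambda>b. 1 / d b) (dilation d x) = x"
  "(\<And>b. b \<in> Basis \<Longrightarrow> d b \<noteq> 0) \<Longrightarrow> dilation d (dilation (\<lambda>b. 1 / d b) x) = x"
  by (rule euclidean_eqI, simp add: dilation_inner_Basis)+

lemma dilation_adjoint: "dilation d x \<bullet> y = x \<bullet> dilation d y"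
  unfolding euclidean_inner[of "dilation d x" y] euclidean_inner[of x "dilation d y"]
  by (simp add: dilation_inner_Basis mult_ac)

lemma continuous_on_dilation [continuous_intros]:
  "continuous_on S f \<Longrightarrow> continuous_on S (\<lambda>x. dilation d (f x))"
  unfolding dilation_def by (intro continuous_intros)

lemma borel_measurable_dilation [measurable]: "dilation d \<in> borel \<rightarrow>\<^sub>M borel"
  by (intro borel_measurable_continuous_onI continuous_intros)

text \<open>If L sends each axis to a multiple of an axis, a coordinate derivative of the composite
  is again a multiple of a composite with one coordinate derivative. Derivatives along axes
  therefore suffice, and multiples of such composites form the invariant set.\<close>

lemma smooth_compose_affine:
  fixes f :: "'c::euclidean_space \<Rightarrow> 'b::real_normed_vector" and L :: "'a::euclidean_space \<Rightarrow> 'c"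
  assumes "smooth f" and L: "bounded_linear L"
    and axes: "\<And>b. b \<in> Basis \<Longrightarrow> \<exists>c. \<exists>b'\<in>Basis. L b = c *\<^sub>R b'"
  shows "smooth (\<lambda>x. f (a + L x))"
proof (rule smooth_coinduct[where S = "{\<lambda>x. k *\<^sub>R g (a + L x) |k g. smooth g}"])
  interpret bounded_linear L by (rule L)
  show "(\<lambda>x. f (a + L x)) \<in> {\<lambda>x. k *\<^sub>R g (a + L x) |k g. smooth g}"
    using assms by (auto intro!: exI[of _ 1])
  show "continuous_on UNIV h" if "h \<in> {\<lambda>x. k *\<^sub>R g (a + L x) |k g. smooth g}" for h :: "'a \<Rightarrow> 'b"
    using that by (auto intro!: continuous_intros continuous_on continuous_on_compose2[OF smooth_imp_continuous_on])
  fix h :: "'a \<Rightarrow> 'b" and b :: 'a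
  assume "h \<in> {\<lambda>x. k *\<^sub>R g (a + L x) |k g. smooth g}" and "b \<in> Basis"
  then obtain k g c b' where g: "h = (\<lambda>x. k *\<^sub>R g (a + L x))" "smooth g" and b': "b' \<in> Basis" "L b = c *\<^sub>R b'"
    using axes by blast
  let ?g' = "\<lambda>x. (k * c) *\<^sub>R partial_deriv b' g (a + L x)"
  have "((\<lambda>t. h (x + t *\<^sub>R b)) has_vector_derivative ?g' x) (at 0)" for x
  proof -
    have "((\<lambda>t. (\<lambda>t. g (a + L x + t *\<^sub>R b')) (t * c)) has_vector_derivative c *\<^sub>R partial_deriv b' g (a + L x)) (at 0)"
      by (rule vector_diff_chain_at[unfolded o_def])
         (use smooth_has_vector_derivative_0[OF g(2) b'(1)] in \<open>auto intro!: derivative_eq_intros\<close>)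
    from has_vector_derivative_scaleR[OF DERIV_const[of k] this]
    show ?thesis unfolding g add scale b'(2) by (simp add: add_ac)
  qed
  moreover have "?g' \<in> {\<lambda>x. k *\<^sub>R g (a + L x) |k g. smooth g}"
    using smooth_partial_deriv[OF g(2) b'(1)] by blast
  ultimately show "\<exists>g'\<in>{\<lambda>x. k *\<^sub>R g (a + L x) |k g. smooth g}. \<forall>x. ((\<lambda>t. h (x + t *\<^sub>R b)) has_vector_derivative g' x) (at 0)"
    by (intro bexI[where x = ?g']) auto
qed

lemma smooth_scale: "smooth f \<Longrightarrow> smooth (\<lambda>x. f (c *\<^sub>R x))"
  using smooth_compose_affine[of f "\<lambda>x. c *\<^sub>R x" 0] by (auto simp: bounded_linear_scaleR_right)

lemma smooth_compose_inner: "smooth u \<Longrightarrow> smooth (\<lambda>x. u (a + v \<bullet> x))"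
  by (rule smooth_compose_affine[OF _ bounded_linear_inner_right]) auto

section \<open>Lebesgue measure under diagonal affine maps\<close>

lemma lborel_dilation:
  assumes "\<And>b. b \<in> Basis \<Longrightarrow> d b \<noteq> 0"
  shows "lborel = density (distr lborel borel (\<lambda>x. t + dilation d x)) (\<lambda>_. ennreal (\<Prod>b\<in>Basis. \<bar>d b\<bar>))"
  using lborel_affine_euclidean[of d t] assms by (simp add: dilation_def)

lemma
  fixes f :: "'a::euclidean_space \<Rightarrow> 'b::{banach, second_countable_topology}" and d :: "'a \<Rightarrow> real" and t :: 'a
  assumes d: "\<And>b. b \<in> Basis \<Longrightarrow> d b \<noteq> 0" and f[measurable]: "f \<in> borel_measurable borel"
  shows integrable_dilation_iff: "integrable lborel (\<lambda>x. f (t + dilation d x)) \<longleftrightarrow> integrable lborel f"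
    and integral_dilation: "(\<integral>x. f x \<partial>lborel) = (\<Prod>b\<in>Basis. \<bar>d b\<bar>) *\<^sub>R (\<integral>x. f (t + dilation d x) \<partial>lborel)"
proof -
  define P where "P = (\<Prod>b\<in>Basis. \<bar>d b\<bar>)"
  have P: "0 < P" unfolding P_def using d by (intro prod_pos) auto
  have eq: "lborel = density (distr lborel borel (\<lambda>x. t + dilation d x)) (\<lambda>_. ennreal P)"
    unfolding P_def by (rule lborel_dilation[OF d])
  have "integrable lborel f \<longleftrightarrow> integrable (density (distr lborel borel (\<lambda>x. t + dilation d x)) (\<lambda>_. ennreal P)) f"
    using eq by simp
  also have "\<dots> \<longleftrightarrow> integrable lborel (\<lambda>x. P *\<^sub>R f (t + dilation d x))"
    using P by (simp add: integrable_density integrable_distr_eq less_imp_le)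
  also have "\<dots> \<longleftrightarrow> integrable lborel (\<lambda>x. f (t + dilation d x))"
  proof
    assume "integrable lborel (\<lambda>x. P *\<^sub>R f (t + dilation d x))"
    from integrable_scaleR_right[OF this, of "inverse P"] P
    show "integrable lborel (\<lambda>x. f (t + dilation d x))" by simp
  qed auto
  finally show "integrable lborel (\<lambda>x. f (t + dilation d x)) \<longleftrightarrow> integrable lborel f" by simp
  show "(\<integral>x. f x \<partial>lborel) = (\<Prod>b\<in>Basis. \<bar>d b\<bar>) *\<^sub>R (\<integral>x. f (t + dilation d x) \<partial>lborel)"
    unfolding P_def[symmetric]
    by (subst eq) (use P in \<open>simp add: integral_density integral_distr less_imp_le\<close>)
qed

lemma
  fixes f :: "'a::euclidean_space \<Rightarrow> 'b::{banach, second_countable_topology}"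
  assumes "c \<noteq> 0" and "f \<in> borel_measurable borel"
  shows integrable_affine_iff: "integrable lborel (\<lambda>x. f (t + c *\<^sub>R x)) \<longleftrightarrow> integrable lborel f"
    and integral_affine: "(\<integral>x. f x \<partial>lborel) = \<bar>c\<bar> ^ DIM('a) *\<^sub>R (\<integral>x. f (t + c *\<^sub>R x) \<partial>lborel)"
  using integrable_dilation_iff[of "\<lambda>_. c" f t] integral_dilation[of "\<lambda>_. c" f t] assms
  by (simp_all add: dilation_const)

lemma
  fixes f :: "'a::euclidean_space \<Rightarrow> real \<Rightarrow> 'b::{real_normed_field, banach, second_countable_topology}"
  assumes "\<And>b. b \<in> Basis \<Longrightarrow> integrable lborel (f b)"
  shows integrable_lborel_prod: "integrable lborel (\<lambda>x::'a. \<Prod>b\<in>Basis. f b (x \<bullet> b))"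
    and integral_lborel_prod: "(\<integral>x. (\<Prod>b\<in>Basis. f b (x \<bullet> b)) \<partial>(lborel :: 'a measure)) = (\<Prod>b\<in>Basis. \<integral>x. f b x \<partial>lborel)"
proof -
  interpret product_sigma_finite "\<lambda>_::'a. lborel :: real measure" by standard
  have [measurable]: "f b \<in> borel_measurable borel" if "b \<in> Basis" for b
    using borel_measurable_integrable[OF assms[OF that]] by simp
  have inner: "(\<Sum>b\<in>Basis. g b *\<^sub>R b) \<bullet> b' = g b'" if "b' \<in> Basis" for g :: "'a \<Rightarrow> real" and b' :: 'a
    using that by (simp add: inner_sum_left inner_Basis if_distrib sum.delta cong: if_cong)
  show "integrable lborel (\<lambda>x::'a. \<Prod>b\<in>Basis. f b (x \<bullet> b))"
    by (subst lborel_eq, subst integrable_distr_eq) (auto simp: inner cong: prod.cong intro!: product_integrable_prod assms)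
  show "(\<integral>x. (\<Prod>b\<in>Basis. f b (x \<bullet> b)) \<partial>(lborel :: 'a measure)) = (\<Prod>b\<in>Basis. \<integral>x. f b x \<partial>lborel)"
    by (subst lborel_eq, subst integral_distr) (auto simp: inner cong: prod.cong intro!: product_integral_prod assms)
qed

text \<open>Each coordinate satisfies 1 + (x . b)^2 <= (1 + |x|)^2, so 2 d powers of the weight
  dominate the product of the d one-dimensional factors, whose reciprocals are integrable.\<close>

lemma integrable_inverse_norm_power:
  assumes "2 * DIM('a) \<le> N"
  shows "integrable lborel (\<lambda>x::'a::euclidean_space. 1 / (1 + norm x) ^ N)"
proof (rule Bochner_Integration.integrable_bound)
  have "integrable lborel (\<lambda>x::real. inverse (1 + x\<^sup>2))"
    using integrable_inverse_1_plus_square by (simp add: set_integrable_def einterval_def)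
  then show "integrable lborel (\<lambda>x::'a. \<Prod>b\<in>Basis. inverse (1 + (x \<bullet> b)\<^sup>2))"
    by (intro integrable_lborel_prod)
  have "1 / (1 + norm x) ^ N \<le> (\<Prod>b\<in>Basis. inverse (1 + (x \<bullet> b)\<^sup>2))" for x :: 'a
  proof -
    have "1 + (x \<bullet> b)\<^sup>2 \<le> (1 + norm x)\<^sup>2" if "b \<in> Basis" for b
    proof -
      have "(x \<bullet> b)\<^sup>2 \<le> (norm x)\<^sup>2" using Basis_le_norm[OF that, of x] by (simp add: abs_le_square_iff[symmetric])
      then show ?thesis by (simp add: power2_sum add_increasing2)
    qed
    then have "(\<Prod>b\<in>Basis. 1 + (x \<bullet> b)\<^sup>2) \<le> (\<Prod>b\<in>(Basis::'a set). (1 + norm x)\<^sup>2)"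
      by (intro prod_mono) auto
    also have "\<dots> = (1 + norm x) ^ (2 * DIM('a))" by (simp add: power_mult)
    also have "\<dots> \<le> (1 + norm x) ^ N" using assms by (intro power_increasing) auto
    finally have "1 / (1 + norm x) ^ N \<le> 1 / (\<Prod>b\<in>Basis. 1 + (x \<bullet> b)\<^sup>2)"
      by (intro divide_left_mono mult_pos_pos prod_pos) (auto intro!: add_pos_nonneg zero_less_power)
    then show ?thesis by (simp add: inverse_eq_divide prod_dividef)
  qed
  then show "AE x in lborel. norm (1 / (1 + norm x) ^ N) \<le> norm (\<Prod>b\<in>Basis. inverse (1 + ((x::'a) \<bullet> b)\<^sup>2))"
    by (auto intro!: AE_I2 order_trans[OF _ abs_ge_self])
qed simp

section \<open>Schwartz functions\<close>

lemma schwartzI: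
  assumes "smooth f" and "\<And>N bs. set bs \<subseteq> Basis \<Longrightarrow> \<exists>B. \<forall>x. (1 + norm x) ^ N * norm (iter_partial bs f x) \<le> B"
  shows "f \<in> schwartz"
proof -
  have "bounded (range (\<lambda>x. (1 + norm x) ^ N * norm (iter_partial bs f x)))" if bs: "set bs \<subseteq> Basis" for N bs
  proof -
    obtain B where "\<forall>x. (1 + norm x) ^ N * norm (iter_partial bs f x) \<le> B" using assms(2)[OF bs] by blast
    then show ?thesis by (auto simp: bounded_iff abs_mult intro!: exI[of _ B])
  qed
  with assms(1) show ?thesis by (auto simp: schwartz_def)
qed

lemma schwartz_imp_smooth: "f \<in> schwartz \<Longrightarrow> smooth f"
  by (simp add: schwartz_def)

lemma schwartz_bound:
  assumes "f \<in> schwartz" "set bs \<subseteq> Basis"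
  shows "(1 + norm x) ^ N * norm (iter_partial bs f x) \<le> schwartz_seminorm N bs f"
  unfolding schwartz_seminorm_def
  using assms by (intro cSUP_upper bounded_imp_bdd_above) (auto simp: schwartz_def)

lemma schwartz_seminorm_nonneg: "f \<in> schwartz \<Longrightarrow> set bs \<subseteq> Basis \<Longrightarrow> 0 \<le> schwartz_seminorm N bs f"
  by (rule order_trans[OF _ schwartz_bound[where x = 0]]) auto

lemma schwartz_seminorm_le:
  assumes "\<And>x. (1 + norm x) ^ N * norm (iter_partial bs f x) \<le> B"
  shows "schwartz_seminorm N bs f \<le> B"
  unfolding schwartz_seminorm_def using assms by (intro cSUP_least) auto

lemma schwartz_partial_deriv: "f \<in> schwartz \<Longrightarrow> b \<in> Basis \<Longrightarrow> partial_deriv b f \<in> schwartz"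
proof (rule schwartzI)
  fix N and bs :: "'a list" assume f: "f \<in> schwartz" "b \<in> Basis" "set bs \<subseteq> Basis"
  then show "\<exists>B. \<forall>x. (1 + norm x) ^ N * norm (iter_partial bs (partial_deriv b f) x) \<le> B"
    using schwartz_bound[of f "bs @ [b]" _ N] by (auto simp: iter_partial_append)
qed (auto intro: smooth_partial_deriv schwartz_imp_smooth)

lemma schwartz_zero: "(\<lambda>x. 0) \<in> schwartz"
proof (rule schwartzI)
  fix N and bs :: "'a list" assume bs: "set bs \<subseteq> Basis"
  have "iter_partial bs (\<lambda>x. 0) \<in> {\<lambda>x. 0::complex}"
    by (rule iter_partial_closed[OF _ _ bs]) (auto intro!: partial_derivI)
  then show "\<exists>B. \<forall>x. (1 + norm x) ^ N * norm (iter_partial bs (\<lambda>x. 0::complex) x) \<le> B"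
    by auto
qed (rule smooth_const)

lemma borel_measurable_schwartz [measurable_dest]: "f \<in> schwartz \<Longrightarrow> f \<in> borel_measurable borel"
  by (intro borel_measurable_continuous_onI smooth_imp_continuous_on schwartz_imp_smooth)

text \<open>The additional \<open>2 * DIM('a)\<close> powers of the weight in the seminorm pay for
  integrability.\<close>

lemma integrable_schwartz_weight:
  fixes f :: "'a::euclidean_space \<Rightarrow> complex"
  assumes f: "f \<in> schwartz"
  shows "integrable lborel (\<lambda>x. (1 + norm x) ^ N * norm (f x))"
    and "(\<integral>x. (1 + norm x) ^ N * norm (f x) \<partial>lborel) \<le>
      schwartz_seminorm (N + 2 * DIM('a)) [] f * (\<integral>x. 1 / (1 + norm x) ^ (2 * DIM('a)) \<partial>(lborel :: 'a measure))"
proof -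
  let ?w = "\<lambda>x::'a. schwartz_seminorm (N + 2 * DIM('a)) [] f * (1 / (1 + norm x) ^ (2 * DIM('a)))"
  have le: "(1 + norm x) ^ N * norm (f x) \<le> ?w x" for x
    using schwartz_bound[OF f, of "[]" x "N + 2 * DIM('a)"]
    by (simp add: field_simps power_add add_pos_nonneg)
  have w: "integrable lborel ?w"
    by (intro integrable_mult_right integrable_inverse_norm_power) auto
  have [measurable]: "f \<in> borel_measurable borel" using f by measurable
  show i: "integrable lborel (\<lambda>x. (1 + norm x) ^ N * norm (f x))"
    by (rule Bochner_Integration.integrable_bound[OF w])
       (auto intro!: AE_I2 order_trans[OF le] simp: schwartz_seminorm_nonneg[OF f])
  have "(\<integral>x. (1 + norm x) ^ N * norm (f x) \<partial>lborel) \<le> (\<integral>x. ?w x \<partial>lborel)"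
    by (intro integral_mono i w le)
  then show "(\<integral>x. (1 + norm x) ^ N * norm (f x) \<partial>lborel) \<le>
      schwartz_seminorm (N + 2 * DIM('a)) [] f * (\<integral>x. 1 / (1 + norm x) ^ (2 * DIM('a)) \<partial>(lborel :: 'a measure))"
    by (simp only: integral_mult_right_zero)
qed

lemma integrable_schwartz: "f \<in> schwartz \<Longrightarrow> integrable lborel f"
  using integrable_schwartz_weight(1)[of f 0] integrable_norm_iff[of f lborel] by (auto dest: borel_measurable_schwartz)

section \<open>Fourier transforms of test functions\<close>

definition test_functions :: "('a::euclidean_space \<Rightarrow> complex) set" where
  "test_functions = {g. smooth g \<and> (\<exists>R. \<forall>x. R < norm x \<longrightarrow> g x = 0)}"

text \<open>Left unnormalised: the factor (2 pi)^(-d) is carried by \<open>mult_kernel\<close>, the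
  inverse transform.\<close>

definition fourier_transform :: "('a::euclidean_space \<Rightarrow> complex) \<Rightarrow> 'a \<Rightarrow> complex" where
  "fourier_transform g y = (\<integral>\<xi>. cis (- (y \<bullet> \<xi>)) * g \<xi> \<partial>lborel)"

lemma test_functionsI: "smooth g \<Longrightarrow> (\<And>x. R < norm x \<Longrightarrow> g x = 0) \<Longrightarrow> g \<in> test_functions"
  by (auto simp: test_functions_def)

lemma test_functions_smooth: "g \<in> test_functions \<Longrightarrow> smooth g"
  by (auto simp: test_functions_def)

lemma test_functions_mult: "smooth f \<Longrightarrow> g \<in> test_functions \<Longrightarrow> (\<lambda>x. f x * g x) \<in> test_functions"
  by (auto simp: test_functions_def intro: smooth_mult)

lemma partial_deriv_eq_0:
  assumes "open S" "x \<in> S" "\<And>y. y \<in> S \<Longrightarrow> g y = 0"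
  shows "partial_deriv b g x = 0"
proof (rule partial_derivI)
  have op: "open ((\<lambda>t::real. x + t *\<^sub>R b) -` S)"
    by (rule open_vimage[OF assms(1)]) (intro continuous_intros)
  show "((\<lambda>t. g (x + t *\<^sub>R b)) has_vector_derivative 0) (at 0)"
    by (rule has_vector_derivative_transform_within_open[OF has_vector_derivative_const[of 0] op])
       (simp_all add: assms(2,3))
qed

lemma test_functions_partial_deriv:
  assumes "g \<in> test_functions" "b \<in> Basis"
  shows "partial_deriv b g \<in> test_functions"
proof -
  obtain R where R: "\<And>x. R < norm x \<Longrightarrow> g x = 0" using assms by (auto simp: test_functions_def)
  have op: "open {x::'a. R < norm x}" by (intro open_Collect_less continuous_intros)
  have "partial_deriv b g x = 0" if "R < norm x" for x
    using that by (intro partial_deriv_eq_0[OF op]) (simp_all add: R)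
  then show ?thesis
    by (rule test_functionsI[OF smooth_partial_deriv[OF test_functions_smooth[OF assms(1)] assms(2)]])
qed

lemma borel_measurable_test_functions [measurable_dest]: "g \<in> test_functions \<Longrightarrow> g \<in> borel_measurable borel"
  by (intro borel_measurable_continuous_onI smooth_imp_continuous_on test_functions_smooth)

lemma integrable_test_functions:
  assumes "g \<in> test_functions" shows "integrable lborel g"
proof -
  obtain R where R: "\<And>x. R < norm x \<Longrightarrow> g x = 0" using assms by (auto simp: test_functions_def)
  have "integrable lborel (\<lambda>x. indicator (cball 0 R) x *\<^sub>R g x)"
    using assms by (intro borel_integrable_compact)
      (auto intro: continuous_on_subset[OF smooth_imp_continuous_on[OF test_functions_smooth]])
  moreover have "(\<lambda>x. indicator (cball 0 R) x *\<^sub>R g x) = g"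
    using R by (auto simp: indicator_def fun_eq_iff)
  ultimately show ?thesis by simp
qed

lemma test_functions_bounded:
  assumes "g \<in> test_functions" obtains B where "0 \<le> B" "\<And>x. norm (g x) \<le> B"
proof -
  obtain R where R: "\<And>x. R < norm x \<Longrightarrow> g x = 0" using assms by (auto simp: test_functions_def)
  have "compact (g ` cball 0 R)"
    using assms by (intro compact_continuous_image)
      (auto intro: continuous_on_subset[OF smooth_imp_continuous_on[OF test_functions_smooth]])
  then obtain B where "\<forall>z\<in>g ` cball 0 R. norm z \<le> B"
    using compact_imp_bounded bounded_iff by metis
  then have B: "norm (g x) \<le> B" if "norm x \<le> R" for x
    using that by auto
  show ?thesis
  proof (rule that)
    show "norm (g x) \<le> max 0 B" for x
      using B[of x] R[of x] by (cases "R < norm x") auto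
  qed simp
qed

lemma integrable_cis_mult:
  "integrable M f \<Longrightarrow> u \<in> borel_measurable M \<Longrightarrow> integrable M (\<lambda>x. cis (u x) * f x)"
  by (rule Bochner_Integration.integrable_bound[of M f]) (auto simp: norm_mult cis_conv_exp)

lemma norm_fourier_transform_le: "norm (fourier_transform g y) \<le> (\<integral>\<xi>. norm (g \<xi>) \<partial>lborel)"
  unfolding fourier_transform_def by (rule order_trans[OF integral_norm_bound]) (simp add: norm_mult)

lemma continuous_on_fourier_transform:
  assumes "g \<in> test_functions" shows "continuous_on UNIV (fourier_transform g)"
  unfolding fourier_transform_def[abs_def]
proof (rule continuous_on_lebesgue_integral[where w = "\<lambda>\<xi>. norm (g \<xi>)"])
  show "(\<lambda>\<xi>. cis (- (y \<bullet> \<xi>)) * g \<xi>) \<in> borel_measurable lborel" for y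
    using assms by (intro borel_measurable_integrable[OF integrable_cis_mult] integrable_test_functions) auto
qed (use assms in \<open>auto simp: norm_mult intro!: continuous_intros integrable_norm integrable_test_functions\<close>)

lemma has_vector_derivative_cis:
  assumes "(f has_real_derivative D) (at t)"
  shows "((\<lambda>t. cis (f t)) has_vector_derivative \<i> * of_real D * cis (f t)) (at t)"
proof -
  have "((\<lambda>t. cis (f t)) has_derivative (\<lambda>h. (h * D) *\<^sub>R (\<i> * cis (f t)))) (at t)"
    by (rule has_derivative_cis) (use assms in \<open>simp add: has_field_derivative_def mult_commute_abs\<close>)
  then show ?thesis
    by (simp add: has_vector_derivative_def scaleR_conv_of_real algebra_simps)
qed

lemma smooth_coordinate: "smooth (\<lambda>\<xi>. - \<i> * complex_of_real (b \<bullet> \<xi>))"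
  by (intro smooth_mult smooth_const smooth_bounded_linear
      bounded_linear_compose[OF bounded_linear_of_real bounded_linear_inner_right])

lemma fourier_transform_derivative:
  fixes g :: "'a::euclidean_space \<Rightarrow> complex"
  assumes g: "g \<in> test_functions"
  shows "((\<lambda>t. fourier_transform g (y + t *\<^sub>R b)) has_vector_derivative
    fourier_transform (\<lambda>\<xi>. - \<i> * of_real (b \<bullet> \<xi>) * g \<xi>) y) (at 0)"
proof -
  have h: "(\<lambda>\<xi>. - \<i> * of_real (b \<bullet> \<xi>) * g \<xi>) \<in> test_functions"
    by (rule test_functions_mult[OF smooth_coordinate g])
  have "((\<lambda>t. \<integral>\<xi>. cis (- ((y + t *\<^sub>R b) \<bullet> \<xi>)) * g \<xi> \<partial>lborel) has_vector_derivative
      (\<integral>\<xi>. cis (- ((y + 0 *\<^sub>R b) \<bullet> \<xi>)) * (- \<i> * of_real (b \<bullet> \<xi>) * g \<xi>) \<partial>lborel)) (at 0)"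
  proof (rule has_vector_derivative_lebesgue_integral[where w = "\<lambda>\<xi>. norm (- \<i> * of_real (b \<bullet> \<xi>) * g \<xi>)"])
    fix t \<xi>
    have "((\<lambda>t. cis (- ((y + t *\<^sub>R b) \<bullet> \<xi>)) * g \<xi>) has_vector_derivative
       \<i> * of_real (- (b \<bullet> \<xi>)) * cis (- ((y + t *\<^sub>R b) \<bullet> \<xi>)) * g \<xi>) (at t)"
      by (intro has_vector_derivative_mult_left has_vector_derivative_cis)
         (auto intro!: derivative_eq_intros simp: inner_add_left)
    then show "((\<lambda>t. cis (- ((y + t *\<^sub>R b) \<bullet> \<xi>)) * g \<xi>) has_vector_derivative
       cis (- ((y + t *\<^sub>R b) \<bullet> \<xi>)) * (- \<i> * of_real (b \<bullet> \<xi>) * g \<xi>)) (at t)"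
      by (simp add: algebra_simps)
  next
    show "(\<lambda>\<xi>. cis (- ((y + 0 *\<^sub>R b) \<bullet> \<xi>)) * (- \<i> * of_real (b \<bullet> \<xi>) * g \<xi>)) \<in> borel_measurable lborel"
      using h by (intro borel_measurable_integrable[OF integrable_cis_mult] integrable_test_functions) auto
    show "integrable lborel (\<lambda>\<xi>. cis (- ((y + t *\<^sub>R b) \<bullet> \<xi>)) * g \<xi>)" for t
      using integrable_test_functions[OF g] by (rule integrable_cis_mult) simp
    show "integrable lborel (\<lambda>\<xi>. norm (- \<i> * of_real (b \<bullet> \<xi>) * g \<xi>))"
      by (rule integrable_norm[OF integrable_test_functions[OF h]])
  qed (simp add: norm_mult)
  then show ?thesis by (simp add: fourier_transform_def)
qed

text \<open>Translating g by t along b multiplies its transform by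
  \<open>cis (t * (y \<bullet> b))\<close>. Both sides of this identity are differentiated at t = 0,
  in place of an integration by parts.\<close>

lemma fourier_transform_partial_deriv:
  fixes g :: "'a::euclidean_space \<Rightarrow> complex"
  assumes g: "g \<in> test_functions" and b: "b \<in> Basis"
  shows "fourier_transform (partial_deriv b g) y = \<i> * of_real (y \<bullet> b) * fourier_transform g y"
proof -
  obtain R where R: "\<And>x. R < norm x \<Longrightarrow> partial_deriv b g x = 0"
    using test_functions_partial_deriv[OF g b] by (auto simp: test_functions_def)
  obtain B where B: "0 \<le> B" "\<And>x. norm (partial_deriv b g x) \<le> B"
    using test_functions_bounded[OF test_functions_partial_deriv[OF g b]] by blast
  have [measurable]: "g \<in> borel_measurable borel" using g by measurable
  have shift: "(\<integral>\<xi>. cis (- (y \<bullet> \<xi>)) * g (\<xi> + t *\<^sub>R b) \<partial>lborel) = cis (t * (y \<bullet> b)) * fourier_transform g y" for t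
  proof -
    have "(\<lambda>\<xi>. cis (- (y \<bullet> \<xi>)) * g \<xi>) \<in> borel_measurable borel"
      using borel_measurable_integrable[OF integrable_cis_mult[OF integrable_test_functions[OF g]], of "\<lambda>\<xi>. - (y \<bullet> \<xi>)"] by simp
    then have "fourier_transform g y = (\<integral>\<xi>. cis (- (y \<bullet> (t *\<^sub>R b + 1 *\<^sub>R \<xi>))) * g (t *\<^sub>R b + 1 *\<^sub>R \<xi>) \<partial>lborel)"
      unfolding fourier_transform_def by (subst integral_affine[of 1 _ "t *\<^sub>R b"]) auto
    also have "\<dots> = (\<integral>\<xi>. cis (- (t * (y \<bullet> b))) * (cis (- (y \<bullet> \<xi>)) * g (\<xi> + t *\<^sub>R b)) \<partial>lborel)"
      by (simp add: mult.assoc[symmetric] cis_mult inner_add_right add.commute)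
    also have "\<dots> = cis (- (t * (y \<bullet> b))) * (\<integral>\<xi>. cis (- (y \<bullet> \<xi>)) * g (\<xi> + t *\<^sub>R b) \<partial>lborel)"
      by (rule integral_mult_right_zero)
    finally show ?thesis
      by (simp only: mult.assoc[symmetric] cis_mult) simp
  qed
  have "((\<lambda>t. \<integral>\<xi>. cis (- (y \<bullet> \<xi>)) * g (\<xi> + t *\<^sub>R b) \<partial>lborel) has_vector_derivative
      (\<integral>\<xi>. cis (- (y \<bullet> \<xi>)) * partial_deriv b g (\<xi> + 0 *\<^sub>R b) \<partial>lborel)) (at 0)"
  \<comment> \<open>For |t| < 1 a translate of a function that vanishes beyond radius R vanishes
    beyond R + 1, so a constant on the larger ball is a majorant.\<close>
  proof (rule has_vector_derivative_lebesgue_integral[where w = "\<lambda>\<xi>. indicator (cball 0 (R + 1)) \<xi> *\<^sub>R B"])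
    show "integrable lborel (\<lambda>\<xi>. cis (- (y \<bullet> \<xi>)) * g (\<xi> + t *\<^sub>R b))" for t
      using integrable_affine_iff[of 1 g "t *\<^sub>R b"] integrable_test_functions[OF g]
      by (intro integrable_cis_mult) (auto simp: add.commute)
    show "((\<lambda>t. cis (- (y \<bullet> \<xi>)) * g (\<xi> + t *\<^sub>R b)) has_vector_derivative
        cis (- (y \<bullet> \<xi>)) * partial_deriv b g (\<xi> + t *\<^sub>R b)) (at t)" for t \<xi>
      by (intro has_vector_derivative_mult_right smooth_has_vector_derivative test_functions_smooth g b)
    show "norm (cis (- (y \<bullet> \<xi>)) * partial_deriv b g (\<xi> + t *\<^sub>R b)) \<le> indicator (cball 0 (R + 1)) \<xi> *\<^sub>R B"
      if "\<bar>t - 0\<bar> < 1" for t \<xi>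
    proof (cases "norm \<xi> \<le> R + 1")
      case False
      have "norm \<xi> \<le> norm (\<xi> + t *\<^sub>R b) + norm (t *\<^sub>R b)"
        using norm_triangle_ineq4[of "\<xi> + t *\<^sub>R b" "t *\<^sub>R b"] by simp
      moreover have "norm (t *\<^sub>R b) < 1" using that b by simp
      ultimately show ?thesis using R[of "\<xi> + t *\<^sub>R b"] False by (simp add: norm_mult B)
    qed (use B in \<open>simp add: norm_mult\<close>)
    show "integrable lborel (\<lambda>\<xi>::'a. indicator (cball 0 (R + 1)) \<xi> *\<^sub>R B)"
      by (rule borel_integrable_compact) auto
    show "(\<lambda>\<xi>. cis (- (y \<bullet> \<xi>)) * partial_deriv b g (\<xi> + 0 *\<^sub>R b)) \<in> borel_measurable lborel"
      using test_functions_partial_deriv[OF g b]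
      by (intro borel_measurable_integrable[OF integrable_cis_mult]) (auto intro: integrable_test_functions)
  qed
  then have "((\<lambda>t. cis (t * (y \<bullet> b)) * fourier_transform g y) has_vector_derivative
      fourier_transform (partial_deriv b g) y) (at 0)"
    unfolding shift by (simp add: fourier_transform_def)
  moreover have "((\<lambda>t. cis (t * (y \<bullet> b)) * fourier_transform g y) has_vector_derivative
      \<i> * of_real (y \<bullet> b) * cis (0 * (y \<bullet> b)) * fourier_transform g y) (at 0)"
    by (intro has_vector_derivative_mult_left has_vector_derivative_cis) (auto intro!: derivative_eq_intros)
  ultimately show ?thesis by (auto dest: vector_derivative_unique_at)
qed

text \<open>Induction over all g at once: a further factor 1 + |y| costs at most 1 plus the sum of
  the |y . b|, and multiplication by y . b is, up to a unimodular constant, the transform of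
  \<open>partial_deriv b g\<close>, again a test function.\<close>

lemma fourier_transform_decay:
  assumes "g \<in> test_functions"
  shows "\<exists>B. \<forall>y. (1 + norm y) ^ N * norm (fourier_transform g y) \<le> B"
  using assms
proof (induction N arbitrary: g)
  case 0
  then show ?case using norm_fourier_transform_le[of g] by auto
next
  case (Suc N)
  obtain B0 where B0: "\<And>y. (1 + norm y) ^ N * norm (fourier_transform g y) \<le> B0"
    using Suc by blast
  have "\<forall>b\<in>Basis. \<exists>B. \<forall>y. (1 + norm y) ^ N * norm (fourier_transform (partial_deriv b g) y) \<le> B"
    using Suc test_functions_partial_deriv by blast
  then obtain B where B: "\<And>b y. b \<in> Basis \<Longrightarrow>
      (1 + norm y) ^ N * norm (fourier_transform (partial_deriv b g) y) \<le> B b"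
    by metis
  have "(1 + norm y) ^ Suc N * norm (fourier_transform g y) \<le> B0 + (\<Sum>b\<in>Basis. B b)" for y
  proof -
    have "(1 + norm y) ^ Suc N * norm (fourier_transform g y) =
        (1 + norm y) ^ N * norm (fourier_transform g y) + norm y * ((1 + norm y) ^ N * norm (fourier_transform g y))"
      by (simp add: algebra_simps)
    also have "\<dots> \<le> (1 + norm y) ^ N * norm (fourier_transform g y) +
        (\<Sum>b\<in>Basis. \<bar>y \<bullet> b\<bar>) * ((1 + norm y) ^ N * norm (fourier_transform g y))"
      by (intro add_left_mono mult_right_mono norm_le_l1) auto
    also have "\<dots> = (1 + norm y) ^ N * norm (fourier_transform g y) +
        (\<Sum>b\<in>Basis. (1 + norm y) ^ N * norm (fourier_transform (partial_deriv b g) y))"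
      unfolding sum_distrib_right using Suc.prems
      by (intro arg_cong2[where f = "(+)"] sum.cong refl)
         (simp add: fourier_transform_partial_deriv norm_mult)
    also have "\<dots> \<le> B0 + (\<Sum>b\<in>Basis. B b)"
      by (intro add_mono sum_mono B B0)
    finally show ?thesis .
  qed
  then show ?case by blast
qed

text \<open>Differentiating a transform multiplies g by a linear function, which keeps the support
  compact. The transforms of test functions are thus closed under derivatives, and their decay alone
  bounds every seminorm.\<close>

lemma fourier_transform_schwartz:
  assumes "g \<in> test_functions" shows "fourier_transform g \<in> schwartz"
proof -
  let ?S = "fourier_transform ` test_functions :: ('a \<Rightarrow> complex) set"
  have step: "\<exists>h'\<in>?S. \<forall>x. ((\<lambda>t. h (x + t *\<^sub>R b)) has_vector_derivative h' x) (at 0)"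
    if h: "h \<in> ?S" for h and b :: 'a
  proof -
    obtain g where g: "g \<in> test_functions" "h = fourier_transform g" using h by blast
    have "(\<lambda>\<xi>. - \<i> * of_real (b \<bullet> \<xi>) * g \<xi>) \<in> test_functions"
      by (rule test_functions_mult[OF smooth_coordinate g(1)])
    then show ?thesis
      unfolding g(2) using fourier_transform_derivative[OF g(1)] by (intro bexI) auto
  qed
  show ?thesis
  proof (rule schwartzI)
    show "smooth (fourier_transform g)"
      by (rule smooth_coinduct[where S = ?S])
         (use assms step in \<open>auto intro: continuous_on_fourier_transform\<close>)
    fix N and bs :: "'a list" assume bs: "set bs \<subseteq> Basis"
    have "iter_partial bs (fourier_transform g) \<in> ?S"
    proof (rule iter_partial_closed[OF _ _ bs])
      show "partial_deriv b h \<in> ?S" if "h \<in> ?S" for h b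
        using step[OF that, of b] by (auto intro!: rev_image_eqI ext partial_derivI)
    qed (use assms in auto)
    then show "\<exists>B. \<forall>x. (1 + norm x) ^ N * norm (iter_partial bs (fourier_transform g) x) \<le> B"
      using fourier_transform_decay by auto
  qed
qed

section \<open>Fourier inversion\<close>

text \<open>The characteristic function of the standard normal law, freed from its normalising
  factor.\<close>

lemma
  shows integrable_cis_gaussian_real: "integrable lborel (\<lambda>x::real. cis (t * x) * of_real (exp (- x\<^sup>2 / 2)))"
    and integral_cis_gaussian_real:
      "(\<integral>x. cis (t * x) * of_real (exp (- x\<^sup>2 / 2)) \<partial>lborel) = of_real (sqrt (2 * pi) * exp (- t\<^sup>2 / 2))"
proof -
  have "integrable lborel (\<lambda>x. std_normal_density x)"
    using integrable_std_normal_moment[of 0] by simp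
  then have "integrable lborel (\<lambda>x. sqrt (2 * pi) * std_normal_density x)"
    by (intro integrable_mult_right)
  then have *: "integrable lborel (\<lambda>x::real. complex_of_real (exp (- x\<^sup>2 / 2)))"
    by (subst (asm) std_normal_density_def) (simp add: integrable_of_real)
  show "integrable lborel (\<lambda>x. cis (t * x) * of_real (exp (- x\<^sup>2 / 2)))"
    using * by (rule integrable_cis_mult) simp
  have "of_real (exp (- t\<^sup>2 / 2)) = char std_normal_distribution t"
    by (simp add: char_std_normal_distribution)
  also have "\<dots> = (\<integral>x. std_normal_density x *\<^sub>R cis (t * x) \<partial>lborel)"
    unfolding char_def by (subst integral_density) (auto simp: cis_conv_exp)
  also have "\<dots> = (\<integral>x. of_real (1 / sqrt (2 * pi)) * (cis (t * x) * of_real (exp (- x\<^sup>2 / 2))) \<partial>lborel)"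
    by (intro Bochner_Integration.integral_cong refl)
       (simp add: std_normal_density_def scaleR_conv_of_real mult_ac)
  also have "\<dots> = of_real (1 / sqrt (2 * pi)) * (\<integral>x. cis (t * x) * of_real (exp (- x\<^sup>2 / 2)) \<partial>lborel)"
    by (rule integral_mult_right_zero)
  finally have "(\<integral>x. cis (t * x) * of_real (exp (- x\<^sup>2 / 2)) \<partial>lborel) =
      of_real (sqrt (2 * pi)) * complex_of_real (exp (- t\<^sup>2 / 2))"
    by (simp add: field_simps)
  then show "(\<integral>x. cis (t * x) * of_real (exp (- x\<^sup>2 / 2)) \<partial>lborel) = of_real (sqrt (2 * pi) * exp (- t\<^sup>2 / 2))"
    by simp
qed

lemma gaussian_eq_prod: "exp (- (norm x)\<^sup>2 / 2) = (\<Prod>b\<in>Basis. exp (- (x \<bullet> b)\<^sup>2 / 2))"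
proof -
  have "(norm x)\<^sup>2 = (\<Sum>b\<in>Basis. (x \<bullet> b)\<^sup>2)"
    unfolding power2_norm_eq_inner euclidean_inner[of x x] by (simp add: power2_eq_square)
  then show ?thesis
    by (simp only: exp_sum[OF finite_Basis, symmetric] sum_divide_distrib[symmetric] sum_negf)
qed

lemma cis_sum: "finite A \<Longrightarrow> cis (\<Sum>i\<in>A. f i) = (\<Prod>i\<in>A. cis (f i))"
  by (induction A rule: finite_induct) (auto simp: cis_mult[symmetric])

lemma
  fixes v :: "'a::euclidean_space"
  shows integrable_cis_gaussian: "integrable lborel (\<lambda>x::'a. cis (v \<bullet> x) * of_real (exp (- (norm x)\<^sup>2 / 2)))"
    and integral_cis_gaussian: "(\<integral>x. cis (v \<bullet> x) * of_real (exp (- (norm x)\<^sup>2 / 2)) \<partial>lborel) =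
      of_real (sqrt (2 * pi) ^ DIM('a) * exp (- (norm v)\<^sup>2 / 2))"
proof -
  have eq: "cis (v \<bullet> x) * of_real (exp (- (norm x)\<^sup>2 / 2)) =
      (\<Prod>b\<in>Basis. cis (v \<bullet> b * (x \<bullet> b)) * of_real (exp (- (x \<bullet> b)\<^sup>2 / 2)))" for x :: 'a
    by (simp only: euclidean_inner[of v x] cis_sum[OF finite_Basis] gaussian_eq_prod of_real_prod prod.distrib)
  show "integrable lborel (\<lambda>x. cis (v \<bullet> x) * of_real (exp (- (norm x)\<^sup>2 / 2)))"
    unfolding eq by (rule integrable_lborel_prod[OF integrable_cis_gaussian_real])
  show "(\<integral>x. cis (v \<bullet> x) * of_real (exp (- (norm x)\<^sup>2 / 2)) \<partial>lborel) =
      of_real (sqrt (2 * pi) ^ DIM('a) * exp (- (norm v)\<^sup>2 / 2))"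
    unfolding eq integral_lborel_prod[OF integrable_cis_gaussian_real] integral_cis_gaussian_real
    by (simp only: of_real_prod[symmetric] prod.distrib prod_constant gaussian_eq_prod[of v])
qed

text \<open>The oscillating factor has modulus 1, so absolute integrability reduces to that of f(x)
  g(y).\<close>

lemma Fubini_cis:
  fixes f :: "'a::euclidean_space \<Rightarrow> complex" and g :: "'b::euclidean_space \<Rightarrow> complex"
  assumes f: "integrable lborel f" and g: "integrable lborel g"
    and u[measurable]: "case_prod u \<in> borel_measurable (borel \<Otimes>\<^sub>M borel)"
  shows "(\<integral>x. f x * (\<integral>y. cis (u x y) * g y \<partial>lborel) \<partial>lborel) = (\<integral>y. (\<integral>x. cis (u x y) * f x \<partial>lborel) * g y \<partial>lborel)"
proof -
  have [measurable]: "f \<in> borel_measurable borel" "g \<in> borel_measurable borel"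
    using f g by (auto dest: borel_measurable_integrable)
  have "integrable (lborel \<Otimes>\<^sub>M lborel) (\<lambda>(x, y). f x * (cis (u x y) * g y))"
  proof (rule lborel_pair.Fubini_integrable)
    show "(\<lambda>(x, y). f x * (cis (u x y) * g y)) \<in> borel_measurable (lborel \<Otimes>\<^sub>M lborel)"
      unfolding cis_conv_exp by measurable
    show "integrable lborel (\<lambda>x. \<integral>y. norm (case (x, y) of (x, y) \<Rightarrow> f x * (cis (u x y) * g y)) \<partial>lborel)"
      using f by (simp add: norm_mult)
    show "AE x in lborel. integrable lborel (\<lambda>y. case (x, y) of (x, y) \<Rightarrow> f x * (cis (u x y) * g y))"
      using g by (auto intro!: AE_I2 integrable_mult_right integrable_cis_mult)
  qed
  from lborel_pair.Fubini_integral[OF this]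
  have "(\<integral>y. (\<integral>x. f x * (cis (u x y) * g y) \<partial>lborel) \<partial>lborel) = (\<integral>x. (\<integral>y. f x * (cis (u x y) * g y) \<partial>lborel) \<partial>lborel)" .
  then show ?thesis
    by (simp add: mult_ac integral_mult_left_zero[symmetric] integral_mult_right_zero[symmetric]
        del: integral_mult_left_zero integral_mult_right_zero)
qed

text \<open>The Gaussian factor makes the double integral absolutely convergent. After the exchange
  the inner integral is the transform of a Gaussian, and what remains is an average of m around
  \<xi> at scale e.\<close>

lemma integral_gaussian_average:
  fixes m :: "'a::euclidean_space \<Rightarrow> complex"
  assumes m: "m \<in> test_functions" and e: "0 < e"
  shows "(\<integral>y. cis (\<xi> \<bullet> y) * fourier_transform m y * of_real (exp (- (norm (e *\<^sub>R y))\<^sup>2 / 2)) \<partial>lborel) =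
    of_real (sqrt (2 * pi) ^ DIM('a)) * (\<integral>w. m (\<xi> + e *\<^sub>R w) * of_real (exp (- (norm w)\<^sup>2 / 2)) \<partial>lborel)"
proof -
  let ?\<gamma> = "\<lambda>y::'a. complex_of_real (exp (- (norm y)\<^sup>2 / 2))"
  let ?G = "complex_of_real (sqrt (2 * pi) ^ DIM('a))"
  have [measurable]: "m \<in> borel_measurable borel" using m by measurable
  have \<gamma>: "integrable lborel ?\<gamma>" using integrable_cis_gaussian[of 0] by simp
  have \<gamma>e: "integrable lborel (\<lambda>y. ?\<gamma> (e *\<^sub>R y))"
    using integrable_affine_iff[of e ?\<gamma> 0] \<gamma> e by simp
  have inner: "(\<integral>y. cis (v \<bullet> y) * ?\<gamma> (e *\<^sub>R y) \<partial>lborel) = of_real (inverse (e ^ DIM('a))) * (?G * ?\<gamma> (v /\<^sub>R e))" for v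
  proof -
    have "(\<integral>y. cis ((v /\<^sub>R e) \<bullet> y) * ?\<gamma> y \<partial>lborel) =
        e ^ DIM('a) *\<^sub>R (\<integral>y. cis ((v /\<^sub>R e) \<bullet> (0 + e *\<^sub>R y)) * ?\<gamma> (0 + e *\<^sub>R y) \<partial>lborel)"
      using e by (subst integral_affine[of e _ 0]) (auto simp: cis_conv_exp)
    then show ?thesis
      using e unfolding integral_cis_gaussian by (simp add: scaleR_conv_of_real field_simps)
  qed
  have "(\<integral>y. cis (\<xi> \<bullet> y) * fourier_transform m y * ?\<gamma> (e *\<^sub>R y) \<partial>lborel) =
      (\<integral>y. (cis (\<xi> \<bullet> y) * ?\<gamma> (e *\<^sub>R y)) * (\<integral>\<eta>. cis (- (y \<bullet> \<eta>)) * m \<eta> \<partial>lborel) \<partial>lborel)"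
    unfolding fourier_transform_def by (simp add: mult_ac)
  also have "\<dots> = (\<integral>\<eta>. (\<integral>y. cis (- (y \<bullet> \<eta>)) * (cis (\<xi> \<bullet> y) * ?\<gamma> (e *\<^sub>R y)) \<partial>lborel) * m \<eta> \<partial>lborel)"
    by (rule Fubini_cis[OF integrable_cis_mult[OF \<gamma>e] integrable_test_functions[OF m]]) auto
  also have "\<dots> = (\<integral>\<eta>. (\<integral>y. cis ((\<xi> - \<eta>) \<bullet> y) * ?\<gamma> (e *\<^sub>R y) \<partial>lborel) * m \<eta> \<partial>lborel)"
    by (simp add: mult.assoc[symmetric] cis_mult inner_diff_left inner_diff_right inner_commute)
  also have "\<dots> = (\<integral>\<eta>. of_real (inverse (e ^ DIM('a))) * ?G * (?\<gamma> ((\<xi> - \<eta>) /\<^sub>R e) * m \<eta>) \<partial>lborel)"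
    unfolding inner by (simp add: mult_ac)
  also have "\<dots> = of_real (inverse (e ^ DIM('a))) * ?G * (\<integral>\<eta>. ?\<gamma> ((\<xi> - \<eta>) /\<^sub>R e) * m \<eta> \<partial>lborel)"
    by (rule integral_mult_right_zero)
  \<comment> \<open>The substitution \<eta> = \<xi> + e w produces the factor e^d that cancels the
    normalisation of the rescaled Gaussian.\<close>
  also have "(\<integral>\<eta>. ?\<gamma> ((\<xi> - \<eta>) /\<^sub>R e) * m \<eta> \<partial>lborel) =
      e ^ DIM('a) *\<^sub>R (\<integral>w. ?\<gamma> ((\<xi> - (\<xi> + e *\<^sub>R w)) /\<^sub>R e) * m (\<xi> + e *\<^sub>R w) \<partial>lborel)"
    using e by (subst integral_affine[of e _ \<xi>]) auto
  also have "(\<integral>w. ?\<gamma> ((\<xi> - (\<xi> + e *\<^sub>R w)) /\<^sub>R e) * m (\<xi> + e *\<^sub>R w) \<partial>lborel) = (\<integral>w. m (\<xi> + e *\<^sub>R w) * ?\<gamma> w \<partial>lborel)"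
    using e by (simp add: mult_ac)
  finally show ?thesis using e by (simp add: scaleR_conv_of_real)
qed

text \<open>Gaussian summation: as the scale tends to 0, the left side of
  \<open>integral_gaussian_average\<close> tends to the inversion integral because the transform is
  integrable, and the averages on the right tend to m(\<xi>) times the mass of the Gaussian because
  m is continuous and bounded.\<close>

theorem fourier_inversion:
  fixes m :: "'a::euclidean_space \<Rightarrow> complex"
  assumes m: "m \<in> test_functions"
  shows "of_real ((2 * pi) powr - real DIM('a)) * (\<integral>y. cis (\<xi> \<bullet> y) * fourier_transform m y \<partial>lborel) = m \<xi>"
proof -
  let ?\<gamma> = "\<lambda>y::'a. complex_of_real (exp (- (norm y)\<^sup>2 / 2))"
  let ?G = "complex_of_real (sqrt (2 * pi) ^ DIM('a))"
  define e where "e n = 1 / real (Suc n)" for n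
  have e: "0 < e n" "e \<longlonglongrightarrow> 0" for n
    unfolding e_def using LIMSEQ_inverse_real_of_nat by (auto simp: inverse_eq_divide)
  have cont: "isCont m x" for x
    using smooth_imp_continuous_on[OF test_functions_smooth[OF m]] by (simp add: continuous_on_eq_continuous_at)
  have [measurable]: "m \<in> borel_measurable borel" using m by measurable
  obtain B where B: "0 \<le> B" "\<And>x. norm (m x) \<le> B" using test_functions_bounded[OF m] by blast
  have ft: "integrable lborel (\<lambda>y. cis (\<xi> \<bullet> y) * fourier_transform m y)"
    using integrable_schwartz[OF fourier_transform_schwartz[OF m]] by (rule integrable_cis_mult) simp
  note [measurable] = borel_measurable_integrable[OF ft, simplified]
  have \<gamma>: "integrable lborel ?\<gamma>" using integrable_cis_gaussian[of 0] by simp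
  have lim: "(\<lambda>n. \<integral>y. cis (\<xi> \<bullet> y) * fourier_transform m y * ?\<gamma> (e n *\<^sub>R y) \<partial>lborel)
      \<longlonglongrightarrow> (\<integral>y. cis (\<xi> \<bullet> y) * fourier_transform m y \<partial>lborel)"
  proof (rule integral_dominated_convergence[where w = "\<lambda>y. norm (cis (\<xi> \<bullet> y) * fourier_transform m y)"])
    show "AE y in lborel. (\<lambda>n. cis (\<xi> \<bullet> y) * fourier_transform m y * ?\<gamma> (e n *\<^sub>R y))
        \<longlonglongrightarrow> cis (\<xi> \<bullet> y) * fourier_transform m y"
    proof (rule AE_I2)
      fix y
      have "(\<lambda>n. cis (\<xi> \<bullet> y) * fourier_transform m y * ?\<gamma> (e n *\<^sub>R y))
          \<longlonglongrightarrow> cis (\<xi> \<bullet> y) * fourier_transform m y * ?\<gamma> (0 *\<^sub>R y)"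
        by (intro tendsto_intros e) simp
      then show "(\<lambda>n. cis (\<xi> \<bullet> y) * fourier_transform m y * ?\<gamma> (e n *\<^sub>R y))
          \<longlonglongrightarrow> cis (\<xi> \<bullet> y) * fourier_transform m y" by simp
    qed
    show "AE y in lborel. norm (cis (\<xi> \<bullet> y) * fourier_transform m y * ?\<gamma> (e n *\<^sub>R y)) \<le>
        norm (cis (\<xi> \<bullet> y) * fourier_transform m y)" for n
      by (rule AE_I2) (simp add: norm_mult mult_left_le)
  qed (use ft in \<open>simp_all add: integrable_norm\<close>)
  have lim': "(\<lambda>n. \<integral>w. m (\<xi> + e n *\<^sub>R w) * ?\<gamma> w \<partial>lborel) \<longlonglongrightarrow> (\<integral>w. m \<xi> * ?\<gamma> w \<partial>lborel)"
  proof (rule integral_dominated_convergence[where w = "\<lambda>w. B * norm (?\<gamma> w)"])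
    show "AE w in lborel. (\<lambda>n. m (\<xi> + e n *\<^sub>R w) * ?\<gamma> w) \<longlonglongrightarrow> m \<xi> * ?\<gamma> w"
    proof (rule AE_I2)
      fix w
      have "(\<lambda>n. \<xi> + e n *\<^sub>R w) \<longlonglongrightarrow> \<xi> + 0 *\<^sub>R w" by (intro tendsto_intros e)
      then have "(\<lambda>n. m (\<xi> + e n *\<^sub>R w)) \<longlonglongrightarrow> m \<xi>"
        using isCont_tendsto_compose[OF cont] by simp
      then show "(\<lambda>n. m (\<xi> + e n *\<^sub>R w) * ?\<gamma> w) \<longlonglongrightarrow> m \<xi> * ?\<gamma> w"
        by (intro tendsto_mult tendsto_const)
    qed
    show "AE w in lborel. norm (m (\<xi> + e n *\<^sub>R w) * ?\<gamma> w) \<le> B * norm (?\<gamma> w)" for n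
      by (rule AE_I2) (use B in \<open>simp add: norm_mult mult_right_mono\<close>)
    show "integrable lborel (\<lambda>w. B * norm (?\<gamma> w))"
      by (intro integrable_mult_right integrable_norm \<gamma>)
  qed measurable
  have "(\<integral>w. m \<xi> * ?\<gamma> w \<partial>lborel) = m \<xi> * ?G"
    using integral_cis_gaussian[of "0::'a"] by simp
  then have "(\<integral>y. cis (\<xi> \<bullet> y) * fourier_transform m y \<partial>lborel) = ?G * (m \<xi> * ?G)"
    using LIMSEQ_unique[OF lim[unfolded integral_gaussian_average[OF m e(1)]] tendsto_mult_left[OF lim']] by simp
  \<comment> \<open>One factor sqrt (2 pi)^d stems from transforming the Gaussian, the other is its
    total mass.\<close>
  moreover have "(2 * pi) powr - real DIM('a) * (sqrt (2 * pi) ^ DIM('a) * sqrt (2 * pi) ^ DIM('a)) = 1"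
    by (subst power_mult_distrib[symmetric]) (simp add: powr_minus powr_realpow field_simps)
  then have "complex_of_real ((2 * pi) powr - real DIM('a)) * (?G * ?G) = 1"
    unfolding of_real_mult[symmetric] by simp
  moreover have "complex_of_real ((2 * pi) powr - real DIM('a)) * (?G * (m \<xi> * ?G)) =
      complex_of_real ((2 * pi) powr - real DIM('a)) * (?G * ?G) * m \<xi>"
    by (simp only: mult_ac)
  ultimately show ?thesis by simp
qed

section \<open>Fourier multipliers\<close>

text \<open>Symbols of multipliers are real-valued while test functions are complex-valued; the
  coercion is hidden here.\<close>

abbreviation cutoff :: "('a::euclidean_space \<Rightarrow> real) \<Rightarrow> bool" where
  "cutoff m \<equiv> (\<lambda>\<xi>. complex_of_real (m \<xi>)) \<in> test_functions"

lemma cutoffI: "smooth m \<Longrightarrow> (\<And>x. R < norm x \<Longrightarrow> m x = 0) \<Longrightarrow> cutoff m"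
  by (rule test_functionsI[OF smooth_compose_bounded_linear[OF bounded_linear_of_real]]) auto

lemma mult_kernel_eq_fourier_transform:
  fixes m :: "'a::euclidean_space \<Rightarrow> real"
  shows "mult_kernel m u = of_real ((2 * pi) powr - real DIM('a)) * fourier_transform (\<lambda>\<xi>. of_real (m \<xi>)) (- u)"
  by (simp add: mult_kernel_def fourier_transform_def)

text \<open>\<open>fourier_mult\<close> tests T against y -> K(x - y), a translate of the reflected
  kernel u -> K(-u). The reflection turns the inverse transform into a forward one, to which
  \<open>fourier_transform_schwartz\<close> applies.\<close>

lemma mult_kernel_uminus_schwartz:
  fixes m :: "'a::euclidean_space \<Rightarrow> real"
  assumes "cutoff m" shows "(\<lambda>u. mult_kernel m (- u)) \<in> schwartz"
proof -
  let ?c = "complex_of_real ((2 * pi) powr - real DIM('a))"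
  have "fourier_transform (\<lambda>\<xi>. ?c * of_real (m \<xi>)) \<in> schwartz"
    by (intro fourier_transform_schwartz test_functions_mult[OF smooth_const assms])
  moreover have "fourier_transform (\<lambda>\<xi>. ?c * of_real (m \<xi>)) = (\<lambda>u. mult_kernel m (- u))"
    unfolding mult_kernel_eq_fourier_transform fourier_transform_def
    by (simp only: minus_minus integral_mult_right_zero[symmetric] mult_ac)
  ultimately show ?thesis by simp
qed

lemma integrable_mult_kernel:
  assumes "cutoff m" shows "integrable lborel (\<lambda>u. mult_kernel m u)"
  using integrable_schwartz[OF mult_kernel_uminus_schwartz[OF assms]]
    integrable_affine_iff[of "-1" "\<lambda>u. mult_kernel m (- u)" 0]
    borel_measurable_schwartz[OF mult_kernel_uminus_schwartz[OF assms]] by simp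

lemma borel_measurable_mult_kernel:
  "cutoff m \<Longrightarrow> mult_kernel m \<in> borel_measurable borel"
  using borel_measurable_integrable[OF integrable_mult_kernel] by simp

lemma mult_kernel_inversion:
  fixes m :: "'a::euclidean_space \<Rightarrow> real"
  assumes m: "cutoff m"
  shows "(\<integral>u. cis (- (u \<bullet> \<xi>)) * mult_kernel m u \<partial>lborel) = of_real (m \<xi>)"
proof -
  let ?c = "complex_of_real ((2 * pi) powr - real DIM('a))"
  have "(\<lambda>u. cis (- (u \<bullet> \<xi>)) * mult_kernel m u) \<in> borel_measurable borel"
    using borel_measurable_integrable[OF integrable_cis_mult[OF integrable_mult_kernel[OF m]], of "\<lambda>u. - (u \<bullet> \<xi>)"] by simp
  then have "(\<integral>u. cis (- (u \<bullet> \<xi>)) * mult_kernel m u \<partial>lborel) =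
      (\<integral>u. cis (u \<bullet> \<xi>) * mult_kernel m (- u) \<partial>lborel)"
    by (subst integral_affine[of "-1" _ 0]) auto
  also have "\<dots> = ?c * (\<integral>u. cis (\<xi> \<bullet> u) * fourier_transform (\<lambda>\<xi>. of_real (m \<xi>)) u \<partial>lborel)"
    unfolding mult_kernel_eq_fourier_transform
    by (simp only: minus_minus integral_mult_right_zero[symmetric] mult_ac inner_commute)
  finally show ?thesis using fourier_inversion[OF m, of \<xi>] by simp
qed

text \<open>Fubini puts the frequency integral of g outside; the inner integral transforms a
  translate of the kernel of m and, by inversion, equals m(\<xi>) times a phase.\<close>

lemma mult_kernel_convolution:
  fixes g m :: "'a::euclidean_space \<Rightarrow> real"
  assumes g: "cutoff g" and m: "cutoff m"
  shows "(\<integral>z. mult_kernel g (z - y) * mult_kernel m (x - z) \<partial>lborel) = mult_kernel (\<lambda>\<xi>. m \<xi> * g \<xi>) (x - y)"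
proof -
  let ?c = "complex_of_real ((2 * pi) powr - real DIM('a))"
  have [measurable]: "mult_kernel m \<in> borel_measurable borel" by (rule borel_measurable_mult_kernel[OF m])
  have K: "integrable lborel (\<lambda>z. mult_kernel m (x - z))"
    using integrable_affine_iff[of "-1" "mult_kernel m" x] integrable_mult_kernel[OF m] by simp
  have "(\<integral>z. cis ((z - y) \<bullet> \<xi>) * mult_kernel m (x - z) \<partial>lborel) = cis ((x - y) \<bullet> \<xi>) * of_real (m \<xi>)" for \<xi>
  proof -
    have "(\<integral>z. cis ((z - y) \<bullet> \<xi>) * mult_kernel m (x - z) \<partial>lborel) =
        (\<integral>u. cis ((x - u - y) \<bullet> \<xi>) * mult_kernel m u \<partial>lborel)"
      by (subst integral_affine[of "-1" _ x]) (auto simp: cis_conv_exp)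
    also have "\<dots> = (\<integral>u. cis ((x - y) \<bullet> \<xi>) * (cis (- (u \<bullet> \<xi>)) * mult_kernel m u) \<partial>lborel)"
    proof -
      have "(x - u - y) \<bullet> \<xi> = (x - y) \<bullet> \<xi> + - (u \<bullet> \<xi>)" for u by (simp add: inner_diff_left)
      then show ?thesis by (simp only: cis_mult[symmetric] mult.assoc)
    qed
    also have "\<dots> = cis ((x - y) \<bullet> \<xi>) * (\<integral>u. cis (- (u \<bullet> \<xi>)) * mult_kernel m u \<partial>lborel)"
      by (rule integral_mult_right_zero)
    finally show ?thesis by (simp add: mult_kernel_inversion[OF m])
  qed
  note inner = this
  have "(\<integral>z. mult_kernel g (z - y) * mult_kernel m (x - z) \<partial>lborel) =
      (\<integral>z. ?c * (mult_kernel m (x - z) * (\<integral>\<xi>. cis ((z - y) \<bullet> \<xi>) * of_real (g \<xi>) \<partial>lborel)) \<partial>lborel)"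
    unfolding mult_kernel_def[of g] by (simp only: mult_ac)
  also have "\<dots> = ?c * (\<integral>z. mult_kernel m (x - z) * (\<integral>\<xi>. cis ((z - y) \<bullet> \<xi>) * of_real (g \<xi>) \<partial>lborel) \<partial>lborel)"
    by (rule integral_mult_right_zero)
  also have "\<dots> = ?c * (\<integral>\<xi>. (\<integral>z. cis ((z - y) \<bullet> \<xi>) * mult_kernel m (x - z) \<partial>lborel) * of_real (g \<xi>) \<partial>lborel)"
    by (subst Fubini_cis[OF K integrable_test_functions[OF g]]) auto
  also have "\<dots> = mult_kernel (\<lambda>\<xi>. m \<xi> * g \<xi>) (x - y)"
    unfolding inner unfolding mult_kernel_def[of "\<lambda>\<xi>. m \<xi> * g \<xi>"] by (simp add: mult_ac)
  finally show ?thesis .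
qed

lemma mult_kernel_zero: "mult_kernel (\<lambda>\<xi>. 0) = (\<lambda>u. 0)"
  by (simp add: mult_kernel_def fun_eq_iff)

lemma mult_kernel_cmult: "mult_kernel (\<lambda>\<xi>. a * m \<xi>) u = of_real a * mult_kernel m u"
  by (simp add: mult_kernel_def mult.left_commute)

text \<open>The dilation of the kernel is the one that preserves its L1 norm; this is what later
  makes the constants uniform over all blocks.\<close>

lemma mult_kernel_dilation:
  fixes m :: "'a::euclidean_space \<Rightarrow> real"
  assumes d: "\<And>b. b \<in> Basis \<Longrightarrow> 0 < d b" and [measurable]: "m \<in> borel_measurable borel"
  shows "of_real (\<Prod>b\<in>Basis. d b) * mult_kernel m (dilation d u) = mult_kernel (\<lambda>\<xi>. m (dilation (\<lambda>b. 1 / d b) \<xi>)) u"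
proof -
  let ?e = "\<lambda>b. 1 / d b"
  have nz: "d b \<noteq> 0" if "b \<in> Basis" for b using d[OF that] by simp
  have abs: "(\<Prod>b\<in>Basis. \<bar>?e b\<bar>) = inverse (\<Prod>b\<in>Basis. d b)"
    using d by (simp add: prod_dividef inverse_eq_divide abs_of_pos)
  have pos: "0 < (\<Prod>b\<in>Basis. d b)" using d by (intro prod_pos) auto
  have [measurable]: "(\<lambda>\<xi>. cis (dilation d u \<bullet> \<xi>) * of_real (m \<xi>)) \<in> borel_measurable borel"
    unfolding cis_conv_exp by measurable
  have "(\<integral>\<xi>. cis (dilation d u \<bullet> \<xi>) * of_real (m \<xi>) \<partial>lborel) =
      (\<Prod>b\<in>Basis. \<bar>?e b\<bar>) *\<^sub>R (\<integral>\<xi>. cis (dilation d u \<bullet> (0 + dilation ?e \<xi>)) * of_real (m (0 + dilation ?e \<xi>)) \<partial>lborel)"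
    using nz by (intro integral_dilation) auto
  also have "\<dots> = of_real (inverse (\<Prod>b\<in>Basis. d b)) * (\<integral>\<xi>. cis (u \<bullet> \<xi>) * of_real (m (dilation ?e \<xi>)) \<partial>lborel)"
    unfolding abs by (simp add: dilation_adjoint dilation_inverse(2)[OF nz] scaleR_conv_of_real)
  finally show ?thesis
    unfolding mult_kernel_def
    by (simp add: mult.left_commute right_inverse[OF less_imp_neq[OF pos, symmetric]] del: of_real_prod of_real_inverse flip: of_real_mult)
qed

section \<open>Operations on tempered distributions\<close>

lemma tempered_zero: "tempered f \<Longrightarrow> f (\<lambda>x. 0) = 0"
proof -
  assume "tempered f"
  then have "\<forall>\<phi>\<in>schwartz. \<forall>c. f (\<lambda>x. c * \<phi> x) = c * f \<phi>" by (simp add: tempered_def)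
  from this[rule_format, OF schwartz_zero, of 0] show ?thesis by simp
qed

text \<open>Continuity in the form in which it is applied: pointwise bounds \<open>B bs\<close>
  replace suprema. The sign of the constant in \<open>tempered\<close> is not prescribed, hence the
  passage to its absolute value.\<close>

lemma tempered_bound:
  fixes T :: "('a::euclidean_space \<Rightarrow> complex) \<Rightarrow> complex"
  assumes "tempered T"
  shows "\<exists>C N L. 0 \<le> C \<and> finite L \<and> (\<forall>bs\<in>L. set bs \<subseteq> Basis) \<and>
    (\<forall>\<phi>\<in>schwartz. \<forall>B. (\<forall>bs\<in>L. \<forall>y. (1 + norm y) ^ N * norm (iter_partial bs \<phi> y) \<le> B bs) \<longrightarrow>
      norm (T \<phi>) \<le> C * (\<Sum>bs\<in>L. B bs))"
proof -
  obtain K N M where K: "\<And>\<phi>. \<phi> \<in> schwartz \<Longrightarrow> norm (T \<phi>) \<le>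
      K * (\<Sum>bs\<in>{bs. set bs \<subseteq> Basis \<and> length bs \<le> M}. schwartz_seminorm N bs \<phi>)"
    using assms unfolding tempered_def by blast
  let ?L = "{bs :: 'a list. set bs \<subseteq> Basis \<and> length bs \<le> M}"
  have "norm (T \<phi>) \<le> \<bar>K\<bar> * (\<Sum>bs\<in>?L. B bs)"
    if \<phi>: "\<phi> \<in> schwartz" and B: "\<forall>bs\<in>?L. \<forall>y. (1 + norm y) ^ N * norm (iter_partial bs \<phi> y) \<le> B bs" for \<phi> B
  proof -
    have "norm (T \<phi>) \<le> K * (\<Sum>bs\<in>?L. schwartz_seminorm N bs \<phi>)" by (rule K[OF \<phi>])
    also have "\<dots> \<le> \<bar>K\<bar> * (\<Sum>bs\<in>?L. schwartz_seminorm N bs \<phi>)"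
      by (intro mult_right_mono sum_nonneg schwartz_seminorm_nonneg[OF \<phi>]) auto
    also have "\<dots> \<le> \<bar>K\<bar> * (\<Sum>bs\<in>?L. B bs)"
      using B by (intro mult_left_mono sum_mono schwartz_seminorm_le) auto
    finally show ?thesis .
  qed
  moreover have "finite ?L" by (rule finite_lists_length_le) simp
  ultimately show ?thesis
    by (intro exI[of _ "\<bar>K\<bar>"] exI[of _ N] exI[of _ ?L]) auto
qed

text \<open>Peetre's inequality: polynomial weights at two points differ at most by the weight of
  their distance.\<close>

lemma weight_le: "(1 + norm y) ^ N \<le> (1 + norm (y - z)) ^ N * (1 + norm z) ^ N"
proof -
  have "1 + norm y \<le> 1 + norm (y - z) + norm z" using norm_triangle_ineq[of "y - z" z] by simp
  also have "\<dots> \<le> (1 + norm (y - z)) * (1 + norm z)" by (simp add: algebra_simps)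
  finally show ?thesis unfolding power_mult_distrib[symmetric] by (intro power_mono) auto
qed

section \<open>Convolution with a Schwartz kernel\<close>

definition convolve :: "('a::euclidean_space \<Rightarrow> complex) \<Rightarrow> ('a \<Rightarrow> complex) \<Rightarrow> 'a \<Rightarrow> complex" where
  "convolve k \<theta> y = (\<integral>z. k (y - z) * \<theta> z \<partial>lborel)"

context
  fixes \<theta> :: "'a::euclidean_space \<Rightarrow> complex"
  assumes \<theta>: "\<theta> \<in> schwartz"
begin

lemma convolve_dominated:
  assumes k: "k \<in> schwartz"
  shows "norm (k (y - z) * \<theta> z) \<le> schwartz_seminorm 0 [] k * norm (\<theta> z)"
    and "integrable lborel (\<lambda>z. schwartz_seminorm 0 [] k * norm (\<theta> z))"
    and "(\<lambda>z. k (y - z) * \<theta> z) \<in> borel_measurable lborel"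
    and "integrable lborel (\<lambda>z. k (y - z) * \<theta> z)"
proof -
  have [measurable]: "k \<in> borel_measurable borel" "\<theta> \<in> borel_measurable borel"
    using k \<theta> by (auto dest: borel_measurable_schwartz)
  show *: "norm (k (y - z) * \<theta> z) \<le> schwartz_seminorm 0 [] k * norm (\<theta> z)" for z
    using schwartz_bound[OF k, of "[]" "y - z" 0] by (simp add: norm_mult mult_right_mono)
  show **: "integrable lborel (\<lambda>z. schwartz_seminorm 0 [] k * norm (\<theta> z))"
    by (intro integrable_mult_right integrable_norm integrable_schwartz \<theta>)
  show ***: "(\<lambda>z. k (y - z) * \<theta> z) \<in> borel_measurable lborel" by simp
  show "integrable lborel (\<lambda>z. k (y - z) * \<theta> z)"
    by (rule Bochner_Integration.integrable_bound[OF ** ***]) (auto intro!: AE_I2 order_trans[OF *])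
qed

lemma convolve_derivative:
  assumes k: "k \<in> schwartz" and b: "b \<in> Basis"
  shows "((\<lambda>t. convolve k \<theta> (y + t *\<^sub>R b)) has_vector_derivative convolve (partial_deriv b k) \<theta> y) (at 0)"
proof -
  note k' = schwartz_partial_deriv[OF k b]
  have "((\<lambda>t. \<integral>z. k (y + t *\<^sub>R b - z) * \<theta> z \<partial>lborel) has_vector_derivative
      (\<integral>z. partial_deriv b k (y + 0 *\<^sub>R b - z) * \<theta> z \<partial>lborel)) (at 0)"
  proof (rule has_vector_derivative_lebesgue_integral[OF _ _ _ convolve_dominated(2)[OF k']])
    show "((\<lambda>t. k (y + t *\<^sub>R b - z) * \<theta> z) has_vector_derivative partial_deriv b k (y + t *\<^sub>R b - z) * \<theta> z) (at t)" for t z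
      using has_vector_derivative_mult_left[OF smooth_has_vector_derivative[OF schwartz_imp_smooth[OF k] b, of "y - z" t], of "\<theta> z"]
      by (simp add: algebra_simps)
  qed (use convolve_dominated[OF k'] convolve_dominated[OF k] in simp_all)
  then show ?thesis by (simp add: convolve_def)
qed

lemma iter_partial_convolve:
  assumes k: "k \<in> schwartz" and bs: "set bs \<subseteq> Basis"
  shows "iter_partial bs (convolve k \<theta>) = convolve (iter_partial bs k) \<theta> \<and> iter_partial bs k \<in> schwartz"
  using bs
  by (induction bs) (auto simp: k intro!: ext partial_derivI convolve_derivative schwartz_partial_deriv)

text \<open>\<open>weight_le\<close> distributes the weight over the two factors; k absorbs its
  share pointwise, \<theta> absorbs the other and supplies the integrability.\<close>

lemma convolve_bound:
  assumes k: "k \<in> schwartz"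
  shows "(1 + norm y) ^ N * norm (convolve k \<theta> y) \<le>
    schwartz_seminorm N [] k * (\<integral>x. 1 / (1 + norm x) ^ (2 * DIM('a)) \<partial>(lborel :: 'a measure)) * schwartz_seminorm (N + 2 * DIM('a)) [] \<theta>"
proof -
  have [measurable]: "k \<in> borel_measurable borel" "\<theta> \<in> borel_measurable borel"
    using k \<theta> by (auto dest: borel_measurable_schwartz)
  have "(1 + norm y) ^ N * norm (convolve k \<theta> y) \<le> (1 + norm y) ^ N * (\<integral>z. norm (k (y - z) * \<theta> z) \<partial>lborel)"
    unfolding convolve_def by (intro mult_left_mono integral_norm_bound) auto
  also have "\<dots> = (\<integral>z. (1 + norm y) ^ N * norm (k (y - z) * \<theta> z) \<partial>lborel)" by simp
  also have "\<dots> \<le> (\<integral>z. schwartz_seminorm N [] k * ((1 + norm z) ^ N * norm (\<theta> z)) \<partial>lborel)"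
  proof (rule integral_mono)
    show "integrable lborel (\<lambda>z. (1 + norm y) ^ N * norm (k (y - z) * \<theta> z))"
      by (intro integrable_mult_right integrable_norm convolve_dominated k)
    show "integrable lborel (\<lambda>z. schwartz_seminorm N [] k * ((1 + norm z) ^ N * norm (\<theta> z)))"
      by (intro integrable_mult_right integrable_schwartz_weight \<theta>)
    fix z
    have "(1 + norm y) ^ N * (norm (k (y - z)) * norm (\<theta> z)) \<le>
        (1 + norm (y - z)) ^ N * (1 + norm z) ^ N * (norm (k (y - z)) * norm (\<theta> z))"
      by (intro mult_right_mono weight_le) auto
    also have "\<dots> = ((1 + norm (y - z)) ^ N * norm (k (y - z))) * ((1 + norm z) ^ N * norm (\<theta> z))"
      by simp
    also have "\<dots> \<le> schwartz_seminorm N [] k * ((1 + norm z) ^ N * norm (\<theta> z))"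
      using schwartz_bound[OF k, of "[]" "y - z" N] by (intro mult_right_mono) auto
    finally show "(1 + norm y) ^ N * norm (k (y - z) * \<theta> z) \<le> schwartz_seminorm N [] k * ((1 + norm z) ^ N * norm (\<theta> z))"
      by (simp add: norm_mult)
  qed
  also have "\<dots> = schwartz_seminorm N [] k * (\<integral>z. (1 + norm z) ^ N * norm (\<theta> z) \<partial>lborel)"
    by (rule integral_mult_right_zero)
  also have "\<dots> \<le> schwartz_seminorm N [] k * (schwartz_seminorm (N + 2 * DIM('a)) [] \<theta> *
      (\<integral>x. 1 / (1 + norm x) ^ (2 * DIM('a)) \<partial>(lborel :: 'a measure)))"
    using k by (intro mult_left_mono integrable_schwartz_weight(2)[OF \<theta>] schwartz_seminorm_nonneg) auto
  finally show ?thesis by (simp only: mult_ac)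
qed

lemma convolve_schwartz:
  assumes k: "k \<in> schwartz" shows "convolve k \<theta> \<in> schwartz"
proof (rule schwartzI)
  show "smooth (convolve k \<theta>)"
  proof (rule smooth_coinduct[where S = "(\<lambda>k. convolve k \<theta>) ` schwartz"])
    show "continuous_on UNIV h" if h: "h \<in> (\<lambda>k. convolve k \<theta>) ` schwartz" for h
    proof -
      obtain k where k: "k \<in> schwartz" "h = convolve k \<theta>" using h by blast
      have "continuous_on UNIV (\<lambda>y. k (y - z) * \<theta> z)" for z
        by (intro continuous_intros continuous_on_compose2[OF smooth_imp_continuous_on[OF schwartz_imp_smooth[OF k(1)]]]) auto
      then show ?thesis
        unfolding k(2) convolve_def[abs_def]
        by (intro continuous_on_lebesgue_integral[OF _ _ convolve_dominated(1)[OF k(1)]] convolve_dominated[OF k(1)])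
    qed
    show "\<exists>g'\<in>(\<lambda>k. convolve k \<theta>) ` schwartz. \<forall>x. ((\<lambda>t. h (x + t *\<^sub>R b)) has_vector_derivative g' x) (at 0)"
      if "h \<in> (\<lambda>k. convolve k \<theta>) ` schwartz" "b \<in> Basis" for h b
      using that convolve_derivative schwartz_partial_deriv by blast
  qed (use k in auto)
  show "\<exists>B. \<forall>x. (1 + norm x) ^ N * norm (iter_partial bs (convolve k \<theta>) x) \<le> B" if "set bs \<subseteq> Basis" for N bs
    using iter_partial_convolve[OF k that] convolve_bound by auto
qed

end

text \<open>All derivatives of the convolution fall on k, so \<theta> enters only through its size.
  The continuity estimate therefore has order 0, and the empty list is the only one that occurs in
  it.\<close>

lemma tempered_convolve:
  fixes f :: "('a::euclidean_space \<Rightarrow> complex) \<Rightarrow> complex"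
  assumes f: "tempered f" and k: "k \<in> schwartz"
  shows "tempered (\<lambda>\<theta>. f (convolve k \<theta>))"
proof -
  let ?W = "\<integral>x. 1 / (1 + norm x) ^ (2 * DIM('a)) \<partial>(lborel :: 'a measure)"
  obtain C N L where C: "\<forall>bs\<in>L. set bs \<subseteq> Basis"
    "\<forall>\<phi>\<in>schwartz. \<forall>B. (\<forall>bs\<in>L. \<forall>y. (1 + norm y) ^ N * norm (iter_partial bs \<phi> y) \<le> B bs) \<longrightarrow>
      norm (f \<phi>) \<le> C * (\<Sum>bs\<in>L. B bs)"
    using tempered_bound[OF f] by (elim exE conjE) (rule that)
  have bound: "norm (f (convolve k \<theta>)) \<le> (C * (\<Sum>bs\<in>L. schwartz_seminorm N [] (iter_partial bs k) * ?W)) *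
      (\<Sum>bs\<in>{bs. set bs \<subseteq> Basis \<and> length bs \<le> 0}. schwartz_seminorm (N + 2 * DIM('a)) bs \<theta>)"
    if \<theta>: "\<theta> \<in> schwartz" for \<theta>
  proof -
    have "norm (f (convolve k \<theta>)) \<le>
        C * (\<Sum>bs\<in>L. schwartz_seminorm N [] (iter_partial bs k) * ?W * schwartz_seminorm (N + 2 * DIM('a)) [] \<theta>)"
    proof (rule C(2)[rule_format, OF convolve_schwartz[OF \<theta> k]])
      fix bs y assume "bs \<in> L"
      then have bs: "set bs \<subseteq> Basis" using C(1) by blast
      show "(1 + norm y) ^ N * norm (iter_partial bs (convolve k \<theta>) y) \<le>
          schwartz_seminorm N [] (iter_partial bs k) * ?W * schwartz_seminorm (N + 2 * DIM('a)) [] \<theta>"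
        using iter_partial_convolve[OF \<theta> k bs] convolve_bound[OF \<theta>] by simp
    qed
    moreover have "{bs :: 'a list. set bs \<subseteq> Basis \<and> length bs \<le> 0} = {[]}" by auto
    ultimately show ?thesis by (simp add: sum_distrib_right mult.assoc)
  qed
  have add: "convolve k (\<lambda>x. \<phi> x + \<theta> x) = (\<lambda>x. convolve k \<phi> x + convolve k \<theta> x)"
    if "\<phi> \<in> schwartz" "\<theta> \<in> schwartz" for \<phi> \<theta>
    using that k by (simp add: convolve_def fun_eq_iff distrib_left convolve_dominated)
  have scale: "convolve k (\<lambda>x. c * \<theta> x) = (\<lambda>x. c * convolve k \<theta> x)" for c \<theta>
    by (simp add: convolve_def fun_eq_iff mult.left_commute)
  have "\<exists>C N M. \<forall>\<theta>\<in>schwartz. norm (f (convolve k \<theta>)) \<le>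
      C * (\<Sum>bs\<in>{bs. set bs \<subseteq> Basis \<and> length bs \<le> M}. schwartz_seminorm N bs \<theta>)"
    using bound by blast
  then show ?thesis
    using f convolve_schwartz[OF _ k] unfolding tempered_def by (simp add: add scale)
qed

section \<open>Frequency localisation as a distribution\<close>

text \<open>The multiplier with symbol g by duality: convolution with the reflected kernel is its
  transpose. \<open>fourier_mult\<close> returns a function of x, whereas the norms take
  functionals.\<close>

definition band :: "('a::euclidean_space \<Rightarrow> real) \<Rightarrow> (('a \<Rightarrow> complex) \<Rightarrow> complex) \<Rightarrow> ('a \<Rightarrow> complex) \<Rightarrow> complex" where
  "band g f \<theta> = f (convolve (\<lambda>u. mult_kernel g (- u)) \<theta>)"

lemma tempered_band: "tempered f \<Longrightarrow> cutoff g \<Longrightarrow> tempered (band g f)"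
  unfolding band_def[abs_def] by (intro tempered_convolve mult_kernel_uminus_schwartz)

lemma fourier_mult_band:
  assumes "cutoff g" "cutoff m"
  shows "fourier_mult m (band g f) = fourier_mult (\<lambda>\<xi>. m \<xi> * g \<xi>) f"
proof
  fix x
  have "convolve (\<lambda>u. mult_kernel g (- u)) (\<lambda>y. mult_kernel m (x - y)) = (\<lambda>y. mult_kernel (\<lambda>\<xi>. m \<xi> * g \<xi>) (x - y))"
    by (simp add: convolve_def mult_kernel_convolution[OF assms] fun_eq_iff)
  then show "fourier_mult m (band g f) x = fourier_mult (\<lambda>\<xi>. m \<xi> * g \<xi>) f x"
    by (simp add: fourier_mult_def band_def)
qed

text \<open>Its Fourier transform is constant, so \<open>band g dirac\<close> is integration against
  \<open>mult_kernel g\<close>: a distribution with freely prescribed spectrum.\<close>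

definition dirac :: "('a::euclidean_space \<Rightarrow> complex) \<Rightarrow> complex" where
  "dirac \<theta> = \<theta> 0"

lemma tempered_dirac: "tempered (dirac :: ('a::euclidean_space \<Rightarrow> complex) \<Rightarrow> complex)"
proof -
  have "norm (\<phi> 0) \<le> 1 * (\<Sum>bs\<in>{bs. set bs \<subseteq> Basis \<and> length bs \<le> 0}. schwartz_seminorm 0 bs \<phi>)"
    if "\<phi> \<in> schwartz" for \<phi> :: "'a \<Rightarrow> complex"
  proof -
    have "{bs :: 'a list. set bs \<subseteq> Basis \<and> length bs \<le> 0} = {[]}" by auto
    then show ?thesis using schwartz_bound[OF that, of "[]" 0 0] by simp
  qed
  then show ?thesis unfolding tempered_def dirac_def by blast
qed

lemma fourier_mult_dirac: "fourier_mult m dirac = mult_kernel m"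
  by (simp add: fourier_mult_def dirac_def fun_eq_iff)

section \<open>The quasi-norms\<close>

lemma ennpow_zero [simp]: "ennpow 0 r = 0"
  by (simp add: ennpow_def)

lemma ennpow_top [simp]: "ennpow top r = top"
  by (simp add: ennpow_def)

lemma ennpow_ennreal: "0 \<le> x \<Longrightarrow> ennpow (ennreal x) r = ennreal (x powr r)"
  by (simp add: ennpow_def)

lemma ennpow_inverse:
  assumes "0 < r" shows "ennpow (ennpow x r) (1 / r) = x" "ennpow (ennpow x (1 / r)) r = x"
  using assms by (cases x; simp add: ennpow_ennreal powr_powr)+

lemma ennpow_mono: "0 \<le> r \<Longrightarrow> x \<le> y \<Longrightarrow> ennpow x r \<le> ennpow y r"
  by (cases x; cases y) (auto simp: ennpow_ennreal powr_mono2 ennreal_leI top_unique)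

lemma ennpow_cmult:
  assumes "0 \<le> a" "0 < r" shows "ennpow (ennreal a * y) r = ennreal (a powr r) * ennpow y r"
proof (cases y)
  case (real x)
  then show ?thesis using assms by (simp add: ennreal_mult[symmetric] ennpow_ennreal powr_mult)
next
  case top
  then show ?thesis using assms
    by (cases "a = 0") (auto simp: ennreal_mult_top ennpow_def)
qed

lemma ennpow_eq_0_iff: "ennpow x r = 0 \<longleftrightarrow> x = 0"
  by (cases x) (auto simp: ennpow_ennreal)

lemma ennpow_less_top_iff: "ennpow x r < top \<longleftrightarrow> x < top"
  by (auto simp: ennpow_def less_top)

lemma enn2real_pos: "0 < p \<Longrightarrow> p \<noteq> \<infinity> \<Longrightarrow> 0 < enn2real p"
  by (simp add: enn2real_positive_iff less_top)

lemma lq_norm_infinity: "lq_norm \<infinity> a = (SUP i. a i)"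
  by (simp add: lq_norm_def)

lemma lq_norm_finite:
  "q \<noteq> \<infinity> \<Longrightarrow> lq_norm q a = ennpow (\<integral>\<^sup>+ i. ennpow (a i) (enn2real q) \<partial>count_space UNIV) (1 / enn2real q)"
  by (simp add: lq_norm_def)

lemma Lp_norm_infinity: "Lp_norm \<infinity> g = Inf {c. AE x in lborel. ennreal (norm (g x)) \<le> c}"
  by (simp add: Lp_norm_def)

lemma Lp_norm_finite:
  "p \<noteq> \<infinity> \<Longrightarrow> Lp_norm p g = ennpow (\<integral>\<^sup>+ x. ennreal (norm (g x) powr enn2real p) \<partial>lborel) (1 / enn2real p)"
  by (simp add: Lp_norm_def)

lemma lq_norm_mono: "(\<And>i. a i \<le> b i) \<Longrightarrow> 0 < q \<Longrightarrow> lq_norm q a \<le> lq_norm q b"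
  unfolding lq_norm_def
  by (auto intro!: SUP_mono' ennpow_mono nn_integral_mono)

lemma lq_norm_cmult:
  assumes "0 \<le> c" "0 < q" shows "lq_norm q (\<lambda>i. ennreal c * a i) = ennreal c * lq_norm q a"
proof (cases "q = \<infinity>")
  case True
  then show ?thesis by (simp add: lq_norm_def SUP_mult_left_ennreal)
next
  case False
  then have q: "0 < enn2real q" using assms enn2real_pos by blast
  with assms show ?thesis
    by (simp add: lq_norm_finite[OF False] ennpow_cmult nn_integral_cmult powr_powr)
qed

lemma le_lq_norm:
  assumes "0 < q" shows "a i \<le> lq_norm q a"
proof (cases "q = \<infinity>")
  case True
  then show ?thesis by (simp add: lq_norm_def SUP_upper)
next
  case False
  then have q: "0 < enn2real q" using assms enn2real_pos by blast
  have "ennpow (a i) (enn2real q) = (\<integral>\<^sup>+j. ennpow (a i) (enn2real q) * indicator {i} j \<partial>count_space UNIV)"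
    by (simp add: nn_integral_cmult)
  also have "\<dots> \<le> (\<integral>\<^sup>+j. ennpow (a j) (enn2real q) \<partial>count_space UNIV)"
    by (intro nn_integral_mono) (auto simp: indicator_def)
  finally have "ennpow (ennpow (a i) (enn2real q)) (1 / enn2real q) \<le> lq_norm q a"
    using q by (simp add: lq_norm_finite[OF False] ennpow_mono)
  then show ?thesis by (simp add: ennpow_inverse q)
qed

lemma lq_norm_sum:
  assumes "0 < q" "q \<noteq> \<infinity>" "finite F" "\<And>i. i \<notin> F \<Longrightarrow> a i = 0"
  shows "lq_norm q a = ennpow (\<Sum>i\<in>F. ennpow (a i) (enn2real q)) (1 / enn2real q)"
proof -
  have "(\<integral>\<^sup>+i. ennpow (a i) (enn2real q) \<partial>count_space UNIV) = (\<Sum>i\<in>F. ennpow (a i) (enn2real q))"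
    using assms by (intro nn_integral_count_space') auto
  with assms show ?thesis by (simp add: lq_norm_def)
qed

lemma lq_norm_single:
  assumes "0 < q" "\<And>i. i \<noteq> i0 \<Longrightarrow> a i = 0" shows "lq_norm q a = a i0"
proof (cases "q = \<infinity>")
  case True
  have "a i \<le> a i0" for i using assms(2)[of i] by (cases "i = i0") auto
  then show ?thesis using True by (auto simp: lq_norm_def intro!: antisym SUP_least SUP_upper)
next
  case False
  then show ?thesis
    using assms lq_norm_sum[of q "{i0}" a] enn2real_pos[OF assms(1)] by (simp add: ennpow_inverse)
qed

text \<open>Every term is at most s, the smaller-exponent norm, so a^r' = a^(r' - r) a^r <= s^(r' -
  r) a^r, which is then summed.\<close>

lemma lq_norm_antimono:
  assumes q: "0 < q" "q \<le> q'" shows "lq_norm q' a \<le> lq_norm q a"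
proof (cases "q' = \<infinity> \<or> lq_norm q a = \<infinity>")
  case True
  then show ?thesis using le_lq_norm[OF q(1), of a] by (auto simp: lq_norm_def[of q'] intro!: SUP_least)
next
  case False
  then have fin: "q' \<noteq> \<infinity>" "q \<noteq> \<infinity>" "lq_norm q a \<noteq> \<infinity>" using q by (auto simp: top_unique)
  define r r' where "r = enn2real q" and "r' = enn2real q'"
  have r: "0 < r" "r \<le> r'"
    using q fin by (auto simp: r_def r'_def enn2real_positive_iff less_top enn2real_mono)
  define s where "s = enn2real (lq_norm q a)"
  have s: "lq_norm q a = ennreal s" "0 \<le> s" using fin by (auto simp: s_def less_top)
  have sum: "(\<integral>\<^sup>+i. ennpow (a i) r \<partial>count_space UNIV) = ennreal (s powr r)"
    using arg_cong[OF s(1), of "\<lambda>x. ennpow x r"] fin r s(2)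
    by (simp add: lq_norm_def r_def[symmetric] ennpow_inverse ennpow_ennreal)
  have "ennpow (a i) r' \<le> ennreal (s powr (r' - r)) * ennpow (a i) r" for i
  proof -
    obtain x where x: "a i = ennreal x" "0 \<le> x" "x \<le> s"
      using le_lq_norm[OF q(1), of a i] s by (cases "a i") (auto simp: top_unique)
    have "x powr r' = x powr (r' - r) * x powr r" by (simp flip: powr_add)
    also have "\<dots> \<le> s powr (r' - r) * x powr r"
      using x r by (intro mult_right_mono powr_mono2) auto
    finally show ?thesis using x by (simp add: ennpow_ennreal ennreal_mult[symmetric] ennreal_leI)
  qed
  then have "(\<integral>\<^sup>+i. ennpow (a i) r' \<partial>count_space UNIV) \<le> (\<integral>\<^sup>+i. ennreal (s powr (r' - r)) * ennpow (a i) r \<partial>count_space UNIV)"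
    by (intro nn_integral_mono)
  also have "\<dots> = ennreal (s powr r')"
    by (simp add: nn_integral_cmult sum ennreal_mult[symmetric] flip: powr_add)
  also have "\<dots> = ennpow (ennreal s) r'" using s by (simp add: ennpow_ennreal)
  finally have "ennpow (\<integral>\<^sup>+i. ennpow (a i) r' \<partial>count_space UNIV) (1 / r') \<le> ennpow (ennpow (ennreal s) r') (1 / r')"
    using r by (intro ennpow_mono) auto
  then show ?thesis
    using r fin s by (simp add: lq_norm_def r'_def[symmetric] ennpow_inverse)
qed

text \<open>Counting measure on multi-indices is the product of the counting measures on the
  coordinates, so the sum of products factorises.\<close>

lemma nn_integral_count_space_prod:
  fixes g :: "nat \<Rightarrow> ennreal"
  shows "(\<integral>\<^sup>+k. (\<Prod>i\<in>(UNIV :: 'n::finite set). g (k i)) \<partial>count_space UNIV) = (\<Sum>j. g j) ^ CARD('n)"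
proof -
  interpret product_sigma_finite "\<lambda>_::'n. count_space (UNIV :: nat set)"
    by (simp add: product_sigma_finite_def sigma_finite_measure_count_space)
  have "count_space (UNIV :: ('n \<Rightarrow> nat) set) = PiM UNIV (\<lambda>_. count_space UNIV)"
    using count_space_PiM_finite[of "UNIV :: 'n set" "\<lambda>_. UNIV :: nat set"] by simp
  then show ?thesis
    using product_nn_integral_prod[of UNIV "\<lambda>_. g"] by (simp add: nn_integral_count_space_nat)
qed

text \<open>For finite q the sum factorises into one geometric series per coordinate, with ratio z =
  2^(-\<delta> q) < 1.\<close>

lemma lq_norm_geometric_finite:
  assumes "0 < q" "0 < \<delta>"
  shows "lq_norm q (\<lambda>k::'n::finite \<Rightarrow> nat. ennreal (2 powr (- \<delta> * real (\<Sum>i\<in>UNIV. k i)))) < \<infinity>"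
proof (cases "q = \<infinity>")
  case True
  have "ennreal (2 powr (- \<delta> * real (\<Sum>i\<in>UNIV. k i))) \<le> ennreal 1" for k :: "'n \<Rightarrow> nat"
  proof -
    have "2 powr (- \<delta> * real (\<Sum>i\<in>UNIV. k i)) \<le> 2 powr 0"
      using assms by (intro powr_mono) (auto intro!: mult_nonneg_nonneg sum_nonneg)
    then show ?thesis by (intro ennreal_leI) simp
  qed
  then have "lq_norm q (\<lambda>k::'n \<Rightarrow> nat. ennreal (2 powr (- \<delta> * real (\<Sum>i\<in>UNIV. k i)))) \<le> ennreal 1"
    unfolding lq_norm_def using True by (simp add: SUP_least)
  then show ?thesis by (rule order_le_less_trans) simp
next
  case False
  then have q: "0 < enn2real q" using assms enn2real_pos by blast
  define z where "z = 2 powr (- \<delta> * enn2real q)"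
  have z: "0 < z" "z < 1" using assms q by (auto simp: z_def powr_less_one)
  have "ennpow (ennreal (2 powr (- \<delta> * real (\<Sum>i\<in>UNIV. k i)))) (enn2real q) = (\<Prod>i\<in>UNIV. ennreal (z ^ k i))"
    for k :: "'n \<Rightarrow> nat"
  proof -
    have "(2 powr (- \<delta> * real (\<Sum>i\<in>UNIV. k i))) powr enn2real q = z powr real (\<Sum>i\<in>UNIV. k i)"
      by (simp add: z_def powr_powr mult_ac)
    also have "\<dots> = (\<Prod>i\<in>UNIV. z ^ k i)"
      using z by (subst powr_realpow) (auto simp: power_sum)
    finally show ?thesis using z by (simp add: ennpow_ennreal prod_ennreal)
  qed
  then have "(\<integral>\<^sup>+k. ennpow (ennreal (2 powr (- \<delta> * real (\<Sum>i\<in>(UNIV::'n set). k i)))) (enn2real q) \<partial>count_space UNIV) =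
      (\<Sum>j. ennreal (z ^ j)) ^ CARD('n)"
    using nn_integral_count_space_prod[where 'n = 'n, of "\<lambda>j. ennreal (z ^ j)"] by simp
  also have "(\<Sum>j. ennreal (z ^ j)) = ennreal (\<Sum>j. z ^ j)"
    using z by (intro suminf_ennreal2) auto
  finally show ?thesis
    using False by (simp add: lq_norm_def ennpow_less_top_iff ennreal_power suminf_nonneg z less_imp_le)
qed

section \<open>Lebesgue quasi-norms of dilations and of multiplier kernels\<close>

lemma nn_integral_dilation:
  assumes d: "\<And>b. b \<in> Basis \<Longrightarrow> 0 < d b" and [measurable]: "F \<in> borel_measurable borel"
  shows "(\<integral>\<^sup>+x. F (dilation d x) \<partial>lborel) = ennreal (inverse (\<Prod>b\<in>Basis. d b)) * (\<integral>\<^sup>+x. F x \<partial>lborel)"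
proof -
  define P where "P = (\<Prod>b\<in>Basis. d b)"
  have P: "0 < P" unfolding P_def using d by (intro prod_pos)
  have "(\<Prod>b\<in>Basis. \<bar>d b\<bar>) = P" using d by (simp add: P_def abs_of_pos)
  then have eq: "lborel = density (distr lborel borel (\<lambda>x. 0 + dilation d x)) (\<lambda>_. ennreal P)"
    using lborel_dilation[of d 0] d by (metis less_irrefl)
  have "(\<integral>\<^sup>+x. F x \<partial>lborel) = ennreal P * (\<integral>\<^sup>+x. F (dilation d x) \<partial>lborel)"
    by (subst eq) (simp add: nn_integral_density nn_integral_distr nn_integral_cmult)
  then show ?thesis
    using P by (simp add: P_def[symmetric] mult.assoc[symmetric] ennreal_mult[symmetric])
qed

lemma AE_dilation:
  fixes Q :: "'a::euclidean_space \<Rightarrow> bool"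
  assumes d: "\<And>b. b \<in> Basis \<Longrightarrow> 0 < d b" and "AE x in lborel. Q x"
  shows "AE x in lborel. Q (dilation d x)"
proof -
  obtain N where N: "{x. \<not> Q x} \<subseteq> N" "N \<in> null_sets lborel"
    using assms(2) by (auto simp: eventually_ae_filter)
  have "dilation d -` N \<in> sets borel"
    using N(2) measurable_sets[OF borel_measurable_dilation, of N d] by auto
  moreover have "(\<integral>\<^sup>+x. indicator N (dilation d x) \<partial>lborel) = 0"
    using N(2) by (subst nn_integral_dilation[OF d]) (auto simp: null_sets_def)
  then have "(\<integral>\<^sup>+x. indicator (dilation d -` N) x \<partial>lborel) = 0"
    by (simp add: indicator_vimage o_def)
  ultimately have "dilation d -` N \<in> null_sets lborel"
    by (simp add: null_sets_def)
  then show ?thesis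
    by (rule AE_I') (use N(1) in auto)
qed

text \<open>For p = infinity the stated factor is 1, as it should be: \<open>enn2real\<close> gives
  0, and division by 0 gives the exponent 0. One formula thus covers all p.\<close>

lemma Lp_norm_dilation:
  fixes g :: "'a::euclidean_space \<Rightarrow> complex"
  assumes d: "\<And>b. b \<in> Basis \<Longrightarrow> 0 < d b" and p: "0 < p" and [measurable]: "g \<in> borel_measurable borel"
  shows "Lp_norm p (\<lambda>x. g (dilation d x)) = ennreal ((\<Prod>b\<in>Basis. d b) powr (- 1 / enn2real p)) * Lp_norm p g"
proof -
  define P where "P = (\<Prod>b\<in>Basis. d b)"
  have P: "0 < P" unfolding P_def using d by (intro prod_pos)
  have nz: "d b \<noteq> 0" if "b \<in> Basis" for b using d[OF that] by simp
  show ?thesis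
    unfolding P_def[symmetric]
  proof (cases "p = \<infinity>")
    case True
    have "(AE x in lborel. ennreal (norm (g (dilation d x))) \<le> c) \<longleftrightarrow> (AE x in lborel. ennreal (norm (g x)) \<le> c)" for c
    proof
      assume "AE x in lborel. ennreal (norm (g (dilation d x))) \<le> c"
      from AE_dilation[where d = "\<lambda>b. 1 / d b", OF _ this] d
      show "AE x in lborel. ennreal (norm (g x)) \<le> c" by (simp add: dilation_inverse(2)[OF nz])
    next
      assume "AE x in lborel. ennreal (norm (g x)) \<le> c"
      from AE_dilation[where d = d, OF d this]
      show "AE x in lborel. ennreal (norm (g (dilation d x))) \<le> c" .
    qed
    then show "Lp_norm p (\<lambda>x. g (dilation d x)) = ennreal (P powr (- 1 / enn2real p)) * Lp_norm p g"
      using P by (simp add: Lp_norm_def True)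
  next
    case False
    then have r: "0 < enn2real p" using p enn2real_pos by blast
    have "(\<integral>\<^sup>+x. ennreal (norm (g (dilation d x)) powr enn2real p) \<partial>lborel) =
        ennreal (inverse P) * (\<integral>\<^sup>+x. ennreal (norm (g x) powr enn2real p) \<partial>lborel)"
      unfolding P_def by (rule nn_integral_dilation[where F = "\<lambda>x. ennreal (norm (g x) powr enn2real p)", OF d]) auto
    then show "Lp_norm p (\<lambda>x. g (dilation d x)) = ennreal (P powr (- 1 / enn2real p)) * Lp_norm p g"
      unfolding Lp_norm_finite[OF False]
      using r P by (simp add: ennpow_cmult powr_minus inverse_powr less_imp_le)
  qed
qed

lemma Lp_norm_zero: "Lp_norm p (\<lambda>x. 0) = 0"
proof (cases "p = \<infinity>")
  case True
  have "Inf {c::ennreal. AE x in lborel. ennreal (norm (0::complex)) \<le> c} \<le> 0" by (intro Inf_lower) simp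
  then show ?thesis using True by (simp add: Lp_norm_def)
qed (simp add: Lp_norm_def)

lemma Lp_norm_cmult:
  fixes g :: "'a::euclidean_space \<Rightarrow> complex"
  assumes a: "0 < a" and p: "0 < p" and [measurable]: "g \<in> borel_measurable borel"
  shows "Lp_norm p (\<lambda>x. of_real a * g x) = ennreal a * Lp_norm p g"
proof (cases "p = \<infinity>")
  case True
  have le: "Lp_norm p (\<lambda>x. of_real a * g x) \<le> ennreal a * Lp_norm p g" if a: "0 < a" for a and g :: "'a \<Rightarrow> complex"
  proof -
    have "ennreal (inverse a) * Lp_norm p (\<lambda>x. of_real a * g x) \<le> Lp_norm p g"
      unfolding Lp_norm_infinity[of g, folded True]
    proof (rule Inf_greatest)
      fix c assume "c \<in> {c. AE x in lborel. ennreal (norm (g x)) \<le> c}"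
      then have "AE x in lborel. ennreal (norm (of_real a * g x)) \<le> ennreal a * c"
        unfolding mem_Collect_eq
      proof eventually_elim
        case (elim x)
        then show ?case using a by (simp add: norm_mult ennreal_mult mult_left_mono)
      qed
      then have "Lp_norm p (\<lambda>x. of_real a * g x) \<le> ennreal a * c"
        unfolding Lp_norm_infinity[folded True] by (simp add: Inf_lower)
      then have "ennreal (inverse a) * Lp_norm p (\<lambda>x. of_real a * g x) \<le> ennreal (inverse a) * (ennreal a * c)"
        by (rule mult_left_mono) simp
      then show "ennreal (inverse a) * Lp_norm p (\<lambda>x. of_real a * g x) \<le> c"
        using a by (simp add: mult.assoc[symmetric] ennreal_mult[symmetric])
    qed
    then have "ennreal a * (ennreal (inverse a) * Lp_norm p (\<lambda>x. of_real a * g x)) \<le> ennreal a * Lp_norm p g"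
      by (rule mult_left_mono) simp
    then show ?thesis using a by (simp add: mult.assoc[symmetric] ennreal_mult[symmetric])
  qed
  show ?thesis
  proof (rule antisym[OF le[OF a]])
    have "ennreal a * Lp_norm p (\<lambda>x. of_real (inverse a) * (of_real a * g x)) \<le>
        ennreal a * (ennreal (inverse a) * Lp_norm p (\<lambda>x. of_real a * g x))"
      using a by (intro mult_left_mono le) auto
    then show "ennreal a * Lp_norm p g \<le> Lp_norm p (\<lambda>x. of_real a * g x)"
      using a by (simp add: mult.assoc[symmetric] ennreal_mult[symmetric])
  qed
next
  case False
  then have r: "0 < enn2real p" using p enn2real_pos by blast
  have "(\<integral>\<^sup>+x. ennreal (norm (of_real a * g x) powr enn2real p) \<partial>lborel) =
      ennreal (a powr enn2real p) * (\<integral>\<^sup>+x. ennreal (norm (g x) powr enn2real p) \<partial>lborel)"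
    using a by (simp add: norm_mult powr_mult ennreal_mult nn_integral_cmult)
  then show ?thesis
    using a r by (simp add: Lp_norm_finite[OF False] ennpow_cmult powr_powr)
qed

text \<open>A vanishing norm makes the kernel vanish almost everywhere, and inversion then gives
  m(\<xi>) = 0. For p = infinity attainment of the infimum 0 is not presupposed, so the exceptional
  sets of the bounds 1 / (n + 1) are collected.\<close>

lemma Lp_norm_mult_kernel_pos:
  fixes m :: "'a::euclidean_space \<Rightarrow> real"
  assumes m: "cutoff m" "m \<xi> \<noteq> 0" and p: "0 < p"
  shows "0 < Lp_norm p (mult_kernel m)"
proof (rule ccontr)
  assume "\<not> 0 < Lp_norm p (mult_kernel m)"
  then have zero: "Lp_norm p (mult_kernel m) = 0" by (simp add: zero_less_iff_neq_zero)
  have [measurable]: "mult_kernel m \<in> borel_measurable borel" by (rule borel_measurable_mult_kernel[OF m(1)])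
  have "AE x in lborel. mult_kernel m x = 0"
  proof (cases "p = \<infinity>")
    case True
    have "AE x in lborel. norm (mult_kernel m x) \<le> inverse (real (Suc n))" for n
    proof -
      have "Inf {c. AE x in lborel. ennreal (norm (mult_kernel m x)) \<le> c} < ennreal (inverse (real (Suc n)))"
        using zero True by (simp add: Lp_norm_def)
      then obtain c where c: "AE x in lborel. ennreal (norm (mult_kernel m x)) \<le> c" "c < ennreal (inverse (real (Suc n)))"
        by (auto simp: Inf_less_iff)
      from c(1) show ?thesis
      proof eventually_elim
        case (elim x)
        then have "ennreal (norm (mult_kernel m x)) \<le> ennreal (inverse (real (Suc n)))" using c(2) by order
        then show ?case by (subst (asm) ennreal_le_iff) auto
      qed
    qed
    then have "AE x in lborel. \<forall>n. norm (mult_kernel m x) \<le> inverse (real (Suc n))"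
      by (simp add: AE_all_countable)
    then show ?thesis
    proof eventually_elim
      case (elim x)
      show ?case
      proof (rule ccontr)
        assume "mult_kernel m x \<noteq> 0"
        then obtain n where "inverse (real (Suc n)) < norm (mult_kernel m x)"
          using reals_Archimedean[of "norm (mult_kernel m x)"] by auto
        with elim show False by (meson not_le)
      qed
    qed
  next
    case False
    have "(\<integral>\<^sup>+x. ennreal (norm (mult_kernel m x) powr enn2real p) \<partial>lborel) = 0"
      using zero False by (simp add: Lp_norm_def ennpow_eq_0_iff)
    then show ?thesis by (simp add: nn_integral_0_iff_AE)
  qed
  then have "AE u in lborel. cis (- (u \<bullet> \<xi>)) * mult_kernel m u = 0" by eventually_elim simp
  then have "(\<integral>u. cis (- (u \<bullet> \<xi>)) * mult_kernel m u \<partial>lborel) = (\<integral>u. 0 \<partial>(lborel :: 'a measure))"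
    by (intro integral_cong_AE) (auto simp: cis_conv_exp)
  then show False using mult_kernel_inversion[OF m(1), of \<xi>] m(2) by simp
qed

text \<open>Schwartz decay has every order: for finite p the power N is chosen with N p >= 2 d, so
  that the p-th power of the kernel is integrable however small p is.\<close>

lemma Lp_norm_mult_kernel_finite:
  fixes m :: "'a::euclidean_space \<Rightarrow> real"
  assumes m: "cutoff m" and p: "0 < p"
  shows "Lp_norm p (mult_kernel m) < \<infinity>"
proof -
  define S where "S N = schwartz_seminorm N [] (\<lambda>u. mult_kernel m (- u))" for N
  have S: "(1 + norm u) ^ N * norm (mult_kernel m u) \<le> S N" for N u
    using schwartz_bound[OF mult_kernel_uminus_schwartz[OF m], of "[]" "- u" N] by (simp add: S_def)
  show ?thesis
  proof (cases "p = \<infinity>")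
    case True
    have "Lp_norm p (mult_kernel m) \<le> ennreal (S 0)"
      unfolding Lp_norm_def using True S[of _ 0] by (auto intro!: Inf_lower AE_I2 ennreal_leI)
    then show ?thesis by (rule order_le_less_trans) simp
  next
    case False
    then have r: "0 < enn2real p" using p enn2real_pos by blast
    define r where "r = enn2real p"
    obtain N :: nat where N: "2 * real DIM('a) / r \<le> real N" using real_arch_simple by blast
    then have N: "2 * real DIM('a) \<le> real N * r" using \<open>0 < enn2real p\<close> by (simp add: r_def field_simps)
    have "norm (mult_kernel m u) powr r \<le> S N powr r * (1 / (1 + norm u) ^ (2 * DIM('a)))" for u
    proof -
      have pos: "0 < 1 + norm u" by (simp add: add_pos_nonneg)
      have "((1 + norm u) ^ N * norm (mult_kernel m u)) powr r \<le> S N powr r"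
        using S[where u = u] \<open>0 < enn2real p\<close> by (intro powr_mono2) (auto simp: r_def)
      moreover have "((1 + norm u) ^ N * norm (mult_kernel m u)) powr r =
          (1 + norm u) powr (real N * r) * norm (mult_kernel m u) powr r"
        using pos by (simp add: powr_mult powr_powr flip: powr_realpow)
      moreover have "(1 + norm u) powr (real (2 * DIM('a))) \<le> (1 + norm u) powr (real N * r)"
        using N by (intro powr_mono) auto
      then have "(1 + norm u) ^ (2 * DIM('a)) * norm (mult_kernel m u) powr r \<le>
          (1 + norm u) powr (real N * r) * norm (mult_kernel m u) powr r"
        unfolding powr_realpow[OF pos] by (intro mult_right_mono) auto
      ultimately have "(1 + norm u) ^ (2 * DIM('a)) * norm (mult_kernel m u) powr r \<le> S N powr r" by linarith
      then show ?thesis using pos by (simp add: field_simps)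
    qed
    then have "(\<integral>\<^sup>+u. ennreal (norm (mult_kernel m u) powr r) \<partial>lborel) \<le>
        (\<integral>\<^sup>+u. ennreal (S N powr r * (1 / (1 + norm u) ^ (2 * DIM('a)))) \<partial>(lborel :: 'a measure))"
      by (intro nn_integral_mono ennreal_leI)
    also have "\<dots> < \<infinity>"
      using integrable_mult_right[OF integrable_inverse_norm_power[where 'a = 'a, OF order_refl], of "S N powr r"]
      by (auto simp: integrable_iff_bounded)
    finally show ?thesis
      using False by (simp add: Lp_norm_finite ennpow_less_top_iff r_def)
  qed
qed

section \<open>Tempered distributions commute with convolution integrals\<close>

lemma iter_partial_add:
  assumes "smooth f" "smooth g" "set bs \<subseteq> Basis"
  shows "iter_partial bs (\<lambda>x. f x + g x) = (\<lambda>x. iter_partial bs f x + iter_partial bs g x)"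
  using assms(3)
proof (induction bs)
  case (Cons b bs)
  then show ?case
    using assms(1,2)
    by (auto intro!: ext partial_derivI has_vector_derivative_add smooth_has_vector_derivative_0 smooth_iter_partial)
qed simp

lemma iter_partial_cmult:
  fixes f :: "'a::euclidean_space \<Rightarrow> complex"
  assumes "smooth f" "set bs \<subseteq> Basis"
  shows "iter_partial bs (\<lambda>x. c * f x) = (\<lambda>x. c * iter_partial bs f x)"
  using assms(2)
proof (induction bs)
  case (Cons b bs)
  then show ?case
    using assms(1)
    by (auto intro!: ext partial_derivI has_vector_derivative_mult_right smooth_has_vector_derivative_0 smooth_iter_partial)
qed simp

lemma iter_partial_translate: "iter_partial bs (\<lambda>y. f (y - z)) = (\<lambda>y. iter_partial bs f (y - z))"
proof (induction bs)
  case (Cons b bs)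
  show ?case by (simp add: Cons partial_deriv_def[abs_def] algebra_simps)
qed simp

lemma smooth_translate: "smooth f \<Longrightarrow> smooth (\<lambda>y. f (y - z))"
proof -
  assume f: "smooth f"
  show ?thesis
    unfolding smooth_def iter_partial_translate
  proof (intro allI impI conjI ballI)
    fix bs :: "'a list" and b x :: 'a assume bs: "set bs \<subseteq> Basis"
    show "continuous_on UNIV (\<lambda>y. iter_partial bs f (y - z))"
      by (rule continuous_on_compose2[OF smooth_imp_continuous_on[OF smooth_iter_partial[OF f bs]]])
         (auto intro!: continuous_intros)
    assume "b \<in> Basis"
    then have "(\<lambda>t. iter_partial bs f ((x - z) + t *\<^sub>R b)) differentiable at 0"
      using f bs unfolding smooth_def by blast
    then show "(\<lambda>t. iter_partial bs f (x + t *\<^sub>R b - z)) differentiable at 0"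
      by (simp add: algebra_simps)
  qed
qed

lemma schwartz_seminorm_translate:
  assumes f: "f \<in> schwartz" and bs: "set bs \<subseteq> Basis"
  shows "(1 + norm y) ^ N * norm (iter_partial bs (\<lambda>y. f (y - z)) y) \<le> (1 + norm z) ^ N * schwartz_seminorm N bs f"
proof -
  have "(1 + norm y) ^ N * norm (iter_partial bs f (y - z)) \<le>
      (1 + norm (y - z)) ^ N * (1 + norm z) ^ N * norm (iter_partial bs f (y - z))"
    by (intro mult_right_mono weight_le) simp
  also have "\<dots> = (1 + norm z) ^ N * ((1 + norm (y - z)) ^ N * norm (iter_partial bs f (y - z)))" by simp
  also have "\<dots> \<le> (1 + norm z) ^ N * schwartz_seminorm N bs f"
    by (intro mult_left_mono schwartz_bound[OF f bs]) simp
  finally show ?thesis by (simp add: iter_partial_translate)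
qed

lemma schwartz_translate: "f \<in> schwartz \<Longrightarrow> (\<lambda>y. f (y - z)) \<in> schwartz"
  by (rule schwartzI[OF smooth_translate[OF schwartz_imp_smooth]]) (use schwartz_seminorm_translate in blast)+

lemma schwartz_add:
  assumes f: "f \<in> schwartz" and g: "g \<in> schwartz" shows "(\<lambda>x. f x + g x) \<in> schwartz"
proof (rule schwartzI[OF smooth_add[OF schwartz_imp_smooth[OF f] schwartz_imp_smooth[OF g]]])
  fix N and bs :: "'a list" assume bs: "set bs \<subseteq> Basis"
  have "(1 + norm x) ^ N * norm (iter_partial bs f x + iter_partial bs g x) \<le>
      schwartz_seminorm N bs f + schwartz_seminorm N bs g" for x
  proof -
    have "(1 + norm x) ^ N * norm (iter_partial bs f x + iter_partial bs g x) \<le>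
        (1 + norm x) ^ N * (norm (iter_partial bs f x) + norm (iter_partial bs g x))"
      by (intro mult_left_mono norm_triangle_ineq) simp
    then show ?thesis
      using schwartz_bound[OF f bs, of x N] schwartz_bound[OF g bs, of x N] by (simp add: distrib_left)
  qed
  then show "\<exists>B. \<forall>x. (1 + norm x) ^ N * norm (iter_partial bs (\<lambda>x. f x + g x) x) \<le> B"
    unfolding iter_partial_add[OF schwartz_imp_smooth[OF f] schwartz_imp_smooth[OF g] bs] by blast
qed

lemma schwartz_cmult:
  assumes f: "f \<in> schwartz" shows "(\<lambda>x. c * f x) \<in> schwartz"
proof (rule schwartzI[OF smooth_mult[OF smooth_const schwartz_imp_smooth[OF f]]])
  fix N and bs :: "'a list" assume bs: "set bs \<subseteq> Basis"
  have "(1 + norm x) ^ N * norm (c * iter_partial bs f x) \<le> norm c * schwartz_seminorm N bs f" for x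
    using mult_left_mono[OF schwartz_bound[OF f bs, of x N], of "norm c"] by (simp add: norm_mult mult_ac)
  then show "\<exists>B. \<forall>x. (1 + norm x) ^ N * norm (iter_partial bs (\<lambda>x. c * f x) x) \<le> B"
    unfolding iter_partial_cmult[OF schwartz_imp_smooth[OF f] bs] by blast
qed

lemma schwartz_diff:
  "f \<in> schwartz \<Longrightarrow> g \<in> schwartz \<Longrightarrow> (\<lambda>x. f x - g x) \<in> schwartz"
  using schwartz_add[of f "\<lambda>x. (-1) * g x"] schwartz_cmult[of g "-1"] by simp

lemma iter_partial_diff:
  fixes f g :: "'a::euclidean_space \<Rightarrow> complex"
  assumes "smooth f" "smooth g" "set bs \<subseteq> Basis"
  shows "iter_partial bs (\<lambda>x. f x - g x) = (\<lambda>x. iter_partial bs f x - iter_partial bs g x)"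
  using iter_partial_add[OF assms(1) smooth_mult[OF smooth_const[of "-1"] assms(2)] assms(3)]
    iter_partial_cmult[OF assms(2,3), of "-1"] by simp

text \<open>One induction carries all three claims, as each step needs the shorter sum to be a
  Schwartz function.\<close>

lemma
  assumes "finite G" and g: "\<And>i. i \<in> G \<Longrightarrow> g i \<in> schwartz"
  shows schwartz_sum: "(\<lambda>y. \<Sum>i\<in>G. c i * g i y) \<in> schwartz"
    and tempered_sum: "tempered T \<Longrightarrow> T (\<lambda>y. \<Sum>i\<in>G. c i * g i y) = (\<Sum>i\<in>G. c i * T (g i))"
    and iter_partial_sum: "set bs \<subseteq> Basis \<Longrightarrow>
      iter_partial bs (\<lambda>y. \<Sum>i\<in>G. c i * g i y) = (\<lambda>y. \<Sum>i\<in>G. c i * iter_partial bs (g i) y)"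
proof -
  have "(\<lambda>y. \<Sum>i\<in>G. c i * g i y) \<in> schwartz \<and>
      (tempered T \<longrightarrow> T (\<lambda>y. \<Sum>i\<in>G. c i * g i y) = (\<Sum>i\<in>G. c i * T (g i))) \<and>
      (set bs \<subseteq> Basis \<longrightarrow> iter_partial bs (\<lambda>y. \<Sum>i\<in>G. c i * g i y) = (\<lambda>y. \<Sum>i\<in>G. c i * iter_partial bs (g i) y))"
    using assms
  proof (induction G)
    case empty
    have "iter_partial bs (\<lambda>y. 0) = (\<lambda>y. 0 :: complex)" if "set bs \<subseteq> Basis"
      using iter_partial_cmult[OF smooth_const that, of 0 0] by simp
    then show ?case using schwartz_zero tempered_zero[of T] by simp
  next
    case (insert i G)
    let ?s = "\<lambda>y. \<Sum>i\<in>G. c i * g i y"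
    have s: "?s \<in> schwartz" and gi: "g i \<in> schwartz" and cg: "(\<lambda>y. c i * g i y) \<in> schwartz"
      using insert by (auto intro: schwartz_cmult)
    have "T (\<lambda>y. c i * g i y + ?s y) = c i * T (g i) + T ?s" if "tempered T"
    proof -
      have "\<forall>\<phi>\<in>schwartz. \<forall>\<theta>\<in>schwartz. T (\<lambda>x. \<phi> x + \<theta> x) = T \<phi> + T \<theta>"
        "\<forall>\<phi>\<in>schwartz. \<forall>c. T (\<lambda>x. c * \<phi> x) = c * T \<phi>"
        using that by (simp_all add: tempered_def)
      from this(1)[rule_format, OF cg s] this(2)[rule_format, OF gi] show ?thesis by simp
    qed
    moreover have "iter_partial bs (\<lambda>y. c i * g i y + ?s y) = (\<lambda>y. c i * iter_partial bs (g i) y + iter_partial bs ?s y)"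
      if "set bs \<subseteq> Basis"
      using iter_partial_add[OF schwartz_imp_smooth[OF cg] schwartz_imp_smooth[OF s] that]
        iter_partial_cmult[OF schwartz_imp_smooth[OF gi] that] by simp
    ultimately show ?case using insert schwartz_add[OF cg s] by auto
  qed
  then show "(\<lambda>y. \<Sum>i\<in>G. c i * g i y) \<in> schwartz"
    and "tempered T \<Longrightarrow> T (\<lambda>y. \<Sum>i\<in>G. c i * g i y) = (\<Sum>i\<in>G. c i * T (g i))"
    and "set bs \<subseteq> Basis \<Longrightarrow> iter_partial bs (\<lambda>y. \<Sum>i\<in>G. c i * g i y) = (\<lambda>y. \<Sum>i\<in>G. c i * iter_partial bs (g i) y)"
    by blast+
qed

lemma tempered_diff:
  assumes T: "tempered T" and f: "f \<in> schwartz" and g: "g \<in> schwartz"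
  shows "T (\<lambda>x. f x - g x) = T f - T g"
proof -
  have "\<forall>\<phi>\<in>schwartz. \<forall>\<theta>\<in>schwartz. T (\<lambda>x. \<phi> x + \<theta> x) = T \<phi> + T \<theta>"
    "\<forall>\<phi>\<in>schwartz. \<forall>c. T (\<lambda>x. c * \<phi> x) = c * T \<phi>"
    using T by (simp_all add: tempered_def)
  from this(1)[rule_format, OF f schwartz_cmult[OF g, of "-1"]] this(2)[rule_format, OF g, of "-1"] show ?thesis by simp
qed

section \<open>Mean value estimates for translates of Schwartz functions\<close>

text \<open>Mean value inequality along the segment; comparing the weight at y with the weight on
  the segment costs (1 + |s|)^N.\<close>

lemma schwartz_difference_axis:
  assumes w: "w \<in> schwartz" and b: "b \<in> Basis"
  shows "(1 + norm y) ^ N * norm (w (y + s *\<^sub>R b) - w y) \<le> \<bar>s\<bar> * (schwartz_seminorm N [b] w * (1 + \<bar>s\<bar>) ^ N)"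
proof -
  let ?B = "schwartz_seminorm N [b] w * (1 + \<bar>s\<bar>) ^ N / (1 + norm y) ^ N"
  have pos: "0 < (1 + norm y) ^ N" by (intro zero_less_power) (simp add: add_pos_nonneg)
  have "norm (w (y + s *\<^sub>R b) - w (y + 0 *\<^sub>R b)) \<le> ?B * \<bar>s - 0\<bar>"
  proof (rule has_vector_derivative_bound[where S = "{-\<bar>s\<bar>..\<bar>s\<bar>}"])
    fix t assume t: "t \<in> {-\<bar>s\<bar>..\<bar>s\<bar>}"
    show "((\<lambda>t. w (y + t *\<^sub>R b)) has_vector_derivative partial_deriv b w (y + t *\<^sub>R b)) (at t)"
      by (rule smooth_has_vector_derivative[OF schwartz_imp_smooth[OF w] b])
    have "(1 + norm y) ^ N * norm (partial_deriv b w (y + t *\<^sub>R b)) \<le>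
        (1 + norm (y - (- t) *\<^sub>R b)) ^ N * (1 + norm ((- t) *\<^sub>R b)) ^ N * norm (partial_deriv b w (y + t *\<^sub>R b))"
      by (intro mult_right_mono weight_le) simp
    also have "\<dots> = (1 + \<bar>t\<bar>) ^ N * ((1 + norm (y + t *\<^sub>R b)) ^ N * norm (iter_partial [b] w (y + t *\<^sub>R b)))"
      using b by simp
    also have "\<dots> \<le> (1 + \<bar>s\<bar>) ^ N * schwartz_seminorm N [b] w"
      using t b by (intro mult_mono power_mono schwartz_bound[OF w]) auto
    finally show "norm (partial_deriv b w (y + t *\<^sub>R b)) \<le> ?B"
      using pos by (simp add: field_simps)
  qed auto
  then show ?thesis using pos by (simp add: field_simps)
qed

text \<open>With derivatives along axes only, y is joined to y + v by a path parallel to the axes.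
  The exponent 2 N collects two comparisons of weights: N for moving to the corner already reached,
  N for the next step.\<close>

lemma schwartz_difference:
  fixes w :: "'a::euclidean_space \<Rightarrow> complex"
  assumes w: "w \<in> schwartz"
  shows "(1 + norm y) ^ N * norm (w (y + v) - w y) \<le>
    norm v * ((\<Sum>b\<in>Basis. schwartz_seminorm N [b] w) * (1 + real DIM('a) * norm v) ^ (2 * N))"
proof -
  let ?V = "1 + real DIM('a) * norm v"
  have V: "1 \<le> ?V" by simp
  have "(1 + norm y) ^ N * norm (w (y + (\<Sum>b\<in>B. (v \<bullet> b) *\<^sub>R b)) - w y) \<le>
      (\<Sum>b\<in>B. norm v * (schwartz_seminorm N [b] w * ?V ^ (2 * N)))"
    if "finite B" "B \<subseteq> Basis" for B
    using that
  proof (induction B)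
    case (insert b B)
    let ?u = "\<Sum>b\<in>B. (v \<bullet> b) *\<^sub>R b"
    have b: "b \<in> Basis" using insert by simp
    have vb: "\<bar>v \<bullet> b\<bar> \<le> norm v" by (rule Basis_le_norm[OF b])
    have "norm ?u \<le> (\<Sum>b\<in>B. norm v)"
    proof (rule sum_norm_le)
      fix b' assume "b' \<in> B"
      then have "b' \<in> Basis" using insert by blast
      then show "norm ((v \<bullet> b') *\<^sub>R b') \<le> norm v" using Basis_le_norm[of b' v] by simp
    qed
    also have "\<dots> \<le> real DIM('a) * norm v"
      using insert by (auto intro!: mult_right_mono card_mono)
    finally have u: "1 + norm ?u \<le> ?V" by simp
    have vb': "1 + \<bar>v \<bullet> b\<bar> \<le> ?V"
      using vb mult_right_mono[of 1 "real DIM('a)" "norm v"] by (simp add: Suc_leI)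
    have "(1 + norm y) ^ N * norm (w (y + ?u + (v \<bullet> b) *\<^sub>R b) - w (y + ?u)) \<le>
        (1 + norm (y - (- ?u))) ^ N * (1 + norm (- ?u)) ^ N * norm (w (y + ?u + (v \<bullet> b) *\<^sub>R b) - w (y + ?u))"
      by (intro mult_right_mono weight_le) simp
    also have "\<dots> = (1 + norm ?u) ^ N * ((1 + norm (y + ?u)) ^ N * norm (w (y + ?u + (v \<bullet> b) *\<^sub>R b) - w (y + ?u)))"
      by simp
    also have "\<dots> \<le> ?V ^ N * (norm v * (schwartz_seminorm N [b] w * ?V ^ N))"
    proof (rule mult_mono)
      have "0 \<le> schwartz_seminorm N [b] w" using b by (intro schwartz_seminorm_nonneg[OF w]) simp
      then have "\<bar>v \<bullet> b\<bar> * (schwartz_seminorm N [b] w * (1 + \<bar>v \<bullet> b\<bar>) ^ N) \<le>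
          norm v * (schwartz_seminorm N [b] w * ?V ^ N)"
        by (intro mult_mono mult_left_mono power_mono vb vb') auto
      then show "(1 + norm (y + ?u)) ^ N * norm (w (y + ?u + (v \<bullet> b) *\<^sub>R b) - w (y + ?u)) \<le>
          norm v * (schwartz_seminorm N [b] w * ?V ^ N)"
        by (rule order_trans[OF schwartz_difference_axis[OF w b]])
    qed (use V in \<open>auto intro!: power_mono u\<close>)
    also have "\<dots> = norm v * (schwartz_seminorm N [b] w * ?V ^ (2 * N))"
      by (simp add: mult_2 power_add)
    finally have step: "(1 + norm y) ^ N * norm (w (y + ?u + (v \<bullet> b) *\<^sub>R b) - w (y + ?u)) \<le>
        norm v * (schwartz_seminorm N [b] w * ?V ^ (2 * N))" .
    have "(1 + norm y) ^ N * norm (w (y + ?u + (v \<bullet> b) *\<^sub>R b) - w y) \<le>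
        (1 + norm y) ^ N * (norm (w (y + ?u + (v \<bullet> b) *\<^sub>R b) - w (y + ?u)) + norm (w (y + ?u) - w y))"
      by (intro mult_left_mono) (auto intro: order_trans[OF _ norm_triangle_ineq])
    also have "\<dots> \<le> norm v * (schwartz_seminorm N [b] w * ?V ^ (2 * N)) +
        (\<Sum>b\<in>B. norm v * (schwartz_seminorm N [b] w * ?V ^ (2 * N)))"
      unfolding distrib_left using insert by (intro add_mono step) auto
    finally show ?case using insert by (simp add: add_ac)
  qed simp
  from this[of Basis] show ?thesis
    by (simp add: euclidean_representation sum_distrib_left sum_distrib_right)
qed

lemma schwartz_translate_difference:
  fixes w :: "'a::euclidean_space \<Rightarrow> complex"
  assumes w: "w \<in> schwartz"
  shows "(1 + norm y) ^ N * norm (w (y - a) - w (y - c)) \<le> (\<Sum>b\<in>Basis. schwartz_seminorm N [b] w) *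
    (norm (a - c) * (1 + real DIM('a) * norm (a - c)) ^ (2 * N) * (1 + norm c) ^ N)"
proof -
  have "(1 + norm y) ^ N * norm (w (y - a) - w (y - c)) \<le>
      (1 + norm (y - c)) ^ N * (1 + norm c) ^ N * norm (w (y - a) - w (y - c))"
    by (intro mult_right_mono weight_le) simp
  also have "\<dots> = (1 + norm c) ^ N * ((1 + norm (y - c)) ^ N * norm (w ((y - c) + (c - a)) - w (y - c)))"
    by simp
  also have "\<dots> \<le> (1 + norm c) ^ N * (norm (c - a) *
      ((\<Sum>b\<in>Basis. schwartz_seminorm N [b] w) * (1 + real DIM('a) * norm (c - a)) ^ (2 * N)))"
    by (intro mult_left_mono schwartz_difference[OF w]) simp
  finally show ?thesis by (simp add: norm_minus_commute mult_ac)
qed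

lemma iter_partial_schwartz: "f \<in> schwartz \<Longrightarrow> set bs \<subseteq> Basis \<Longrightarrow> iter_partial bs f \<in> schwartz"
  using iter_partial_closed[of f schwartz bs] by (auto simp: schwartz_partial_deriv)

context
  fixes T :: "('a::euclidean_space \<Rightarrow> complex) \<Rightarrow> complex" and k :: "'a \<Rightarrow> complex"
  assumes T: "tempered T" and k: "k \<in> schwartz"
begin

text \<open>By \<open>weight_le\<close> a translation by z multiplies each seminorm by at most (1 +
  |z|)^N.\<close>

lemma tempered_translate_growth:
  "\<exists>A N. 0 \<le> A \<and> (\<forall>z. norm (T (\<lambda>y. k (y - z))) \<le> A * (1 + norm z) ^ N)"
proof -
  obtain C N and L :: "'a list set" where C: "0 \<le> C" "finite L" "\<forall>bs\<in>L. set bs \<subseteq> Basis"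
    "\<forall>\<phi>\<in>schwartz. \<forall>B. (\<forall>bs\<in>L. \<forall>y. (1 + norm y) ^ N * norm (iter_partial bs \<phi> y) \<le> B bs) \<longrightarrow>
      norm (T \<phi>) \<le> C * (\<Sum>bs\<in>L. B bs)"
    using tempered_bound[OF T] by (elim exE conjE) (rule that)
  have "norm (T (\<lambda>y. k (y - z))) \<le> C * (\<Sum>bs\<in>L. (1 + norm z) ^ N * schwartz_seminorm N bs k)" for z
    by (rule C(4)[rule_format, OF schwartz_translate[OF k] schwartz_seminorm_translate[OF k C(3)[rule_format]]])
  moreover have "0 \<le> C * (\<Sum>bs\<in>L. schwartz_seminorm N bs k)"
    by (intro mult_nonneg_nonneg sum_nonneg schwartz_seminorm_nonneg[OF k] C(1) C(3)[rule_format])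
  ultimately show ?thesis
    by (intro exI[of _ "C * (\<Sum>bs\<in>L. schwartz_seminorm N bs k)"] exI[of _ N])
       (auto simp: sum_distrib_left sum_distrib_right mult_ac)
qed

lemma continuous_on_tempered_translate: "continuous_on UNIV (\<lambda>z. T (\<lambda>y. k (y - z)))"
proof -
  obtain C N and L :: "'a list set" where C: "0 \<le> C" "finite L" "\<forall>bs\<in>L. set bs \<subseteq> Basis"
    "\<forall>\<phi>\<in>schwartz. \<forall>B. (\<forall>bs\<in>L. \<forall>y. (1 + norm y) ^ N * norm (iter_partial bs \<phi> y) \<le> B bs) \<longrightarrow>
      norm (T \<phi>) \<le> C * (\<Sum>bs\<in>L. B bs)"
    using tempered_bound[OF T] by (elim exE conjE) (rule that)
  define \<omega> where "\<omega> a c = norm (a - c) * (1 + real DIM('a) * norm (a - c)) ^ (2 * N) * (1 + norm c) ^ N" for a c :: 'a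
  have le: "norm (T (\<lambda>y. k (y - a)) - T (\<lambda>y. k (y - c))) \<le>
      C * (\<Sum>bs\<in>L. (\<Sum>b\<in>Basis. schwartz_seminorm N [b] (iter_partial bs k)) * \<omega> a c)" for a c
    unfolding tempered_diff[OF T schwartz_translate[OF k] schwartz_translate[OF k], symmetric]
  proof (rule C(4)[rule_format, OF schwartz_diff[OF schwartz_translate[OF k] schwartz_translate[OF k]]])
    fix bs and y :: 'a assume bs: "bs \<in> L"
    show "(1 + norm y) ^ N * norm (iter_partial bs (\<lambda>y. k (y - a) - k (y - c)) y) \<le>
        (\<Sum>b\<in>Basis. schwartz_seminorm N [b] (iter_partial bs k)) * \<omega> a c"
      unfolding \<omega>_def iter_partial_translate
        iter_partial_diff[OF smooth_translate[OF schwartz_imp_smooth[OF k]] smooth_translate[OF schwartz_imp_smooth[OF k]] C(3)[rule_format, OF bs]]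
      by (rule schwartz_translate_difference[OF iter_partial_schwartz[OF k C(3)[rule_format, OF bs]]])
  qed
  have lim: "((\<lambda>a. C * (\<Sum>bs\<in>L. (\<Sum>b\<in>Basis. schwartz_seminorm N [b] (iter_partial bs k)) * \<omega> a c)) \<longlongrightarrow> 0) (at c)" for c
  proof -
    have "((\<lambda>a. \<omega> a c) \<longlongrightarrow> \<omega> c c) (at c)" unfolding \<omega>_def by (intro tendsto_intros)
    then have "((\<lambda>a. \<omega> a c) \<longlongrightarrow> 0) (at c)" by (simp add: \<omega>_def)
    then show ?thesis by (intro tendsto_mult_right_zero tendsto_null_sum)
  qed
  have "((\<lambda>a. T (\<lambda>y. k (y - a)) - T (\<lambda>y. k (y - c))) \<longlongrightarrow> 0) (at c)" for c
    by (rule Lim_null_comparison[OF always_eventually[OF allI[OF le]] lim])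
  then show ?thesis
    by (auto simp: continuous_on_def LIM_zero_iff intro: tendsto_within_subset)
qed

text \<open>T has to pass under the integral. The convolution is replaced by finite combinations of
  translates of k, for which linearity suffices. Their distance to the convolution tends to 0 in
  every seminorm that T sees, while the values of T on them are integrals of \<Theta>(r i z)
  \<theta>(z), which converge by domination.\<close>

lemma tempered_convolve_eq_integral:
  assumes \<theta>: "\<theta> \<in> schwartz"
  shows "T (convolve k \<theta>) = (\<integral>z. T (\<lambda>y. k (y - z)) * \<theta> z \<partial>lborel)"
proof -
  define \<Theta> where "\<Theta> z = T (\<lambda>y. k (y - z))" for z
  obtain C N and L :: "'a list set" where C: "0 \<le> C" "finite L" "\<forall>bs\<in>L. set bs \<subseteq> Basis"
    "\<forall>\<phi>\<in>schwartz. \<forall>B. (\<forall>bs\<in>L. \<forall>y. (1 + norm y) ^ N * norm (iter_partial bs \<phi> y) \<le> B bs) \<longrightarrow>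
      norm (T \<phi>) \<le> C * (\<Sum>bs\<in>L. B bs)"
    using tempered_bound[OF T] by (elim exE conjE) (rule that)
  obtain A M where A: "0 \<le> A" "\<And>z. norm (\<Theta> z) \<le> A * (1 + norm z) ^ M"
    using tempered_translate_growth unfolding \<Theta>_def by blast
  have [measurable]: "\<theta> \<in> borel_measurable borel" "k \<in> borel_measurable borel"
    using \<theta> k by (auto dest: borel_measurable_schwartz)
  have cont: "continuous_on UNIV \<Theta>" unfolding \<Theta>_def by (rule continuous_on_tempered_translate)
  then have [measurable]: "\<Theta> \<in> borel_measurable borel" by (rule borel_measurable_continuous_onI)
  \<comment> \<open>Simple functions tending to the identity supply the sample points; |r i z| <= 2
    |z| keeps all integrands below a fixed polynomial weight times |\<theta>|.\<close>
  obtain r :: "nat \<Rightarrow> 'a \<Rightarrow> 'a" where r: "\<And>i. simple_function borel (r i)" "\<And>z. (\<lambda>i. r i z) \<longlonglongrightarrow> z"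
    "\<And>i z. norm (r i z) \<le> 2 * norm z"
    using borel_measurable_implies_sequence_metric[of "\<lambda>z::'a. z" borel 0] by (auto simp: dist_norm)
  have [measurable]: "r i \<in> borel \<rightarrow>\<^sub>M borel" for i by (rule borel_measurable_simple_function[OF r(1)])
  \<comment> \<open>The mass of \<theta> on the cell where r i takes the value g.\<close>
  define c where "c i g = (\<integral>z. indicator (r i -` {g}) z *\<^sub>R \<theta> z \<partial>lborel)" for i g
  have fin: "finite (range (r i))" for i using simple_functionD(1)[OF r(1), of i] by simp
  have vim: "r i -` {g} \<in> sets borel" for i g using simple_functionD(2)[OF r(1), of i "{g}"] by simp
  have int_c: "integrable lborel (\<lambda>z. indicator (r i -` {g}) z *\<^sub>R \<theta> z)" for i g
    using vim by (intro integrable_mult_indicator integrable_schwartz \<theta>) simp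
  have simple: "(\<Sum>g\<in>range (r i). c i g * h g) = (\<integral>z. h (r i z) * \<theta> z \<partial>lborel)"
    and simple_int: "integrable lborel (\<lambda>z. h (r i z) * \<theta> z)" for h i
  proof -
    have eq: "h (r i z) * \<theta> z = (\<Sum>g\<in>range (r i). (indicator (r i -` {g}) z *\<^sub>R \<theta> z) * h g)" for z
    proof -
      have "(\<Sum>g\<in>range (r i). (indicator (r i -` {g}) z *\<^sub>R \<theta> z) * h g) =
          (\<Sum>g\<in>range (r i). if g = r i z then \<theta> z * h g else 0)"
        by (intro sum.cong) (auto simp: indicator_def)
      then show ?thesis using fin by (simp add: sum.delta mult.commute)
    qed
    show "(\<Sum>g\<in>range (r i). c i g * h g) = (\<integral>z. h (r i z) * \<theta> z \<partial>lborel)"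
      unfolding eq c_def
      by (subst Bochner_Integration.integral_sum) (intro integrable_mult_left int_c, simp only: integral_mult_left_zero)
    show "integrable lborel (\<lambda>z. h (r i z) * \<theta> z)"
      unfolding eq by (intro Bochner_Integration.integrable_sum integrable_mult_left int_c)
  qed
  define E where "E i y = (\<Sum>g\<in>range (r i). c i g * k (y - g)) - convolve k \<theta> y" for i y
  have sum_schwartz: "(\<lambda>y. \<Sum>g\<in>range (r i). c i g * k (y - g)) \<in> schwartz" for i
    by (rule schwartz_sum[OF fin schwartz_translate[OF k]])
  have conv_schwartz: "convolve k \<theta> \<in> schwartz" by (rule convolve_schwartz[OF \<theta> k])
  have TE: "T (E i) = (\<integral>z. \<Theta> (r i z) * \<theta> z \<partial>lborel) - T (convolve k \<theta>)" for i
    unfolding E_def[abs_def] tempered_diff[OF T sum_schwartz conv_schwartz]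
      tempered_sum[OF fin schwartz_translate[OF k] T]
    using simple[of i \<Theta>] by (simp add: \<Theta>_def)
  \<comment> \<open>The modulus from \<open>schwartz_translate_difference\<close>, which vanishes at
    a = c.\<close>
  define \<omega> where "\<omega> a c = norm (a - c) * (1 + real DIM('a) * norm (a - c)) ^ (2 * N) * (1 + norm c) ^ N" for a c :: 'a
  define e where "e i = (\<integral>z. \<omega> (r i z) z * norm (\<theta> z) \<partial>lborel)" for i
  define D where "D = real DIM('a)"
  have D: "1 \<le> D" by (simp add: D_def Suc_leI)
  have \<omega>_nonneg: "0 \<le> \<omega> a c" for a c by (simp add: \<omega>_def)
  \<comment> \<open>The constant 3 stems from |r i z - z| <= 3 |z|.\<close>
  have \<omega>_le: "\<omega> (r i z) z \<le> (3 * (3 * D) ^ (2 * N)) * (1 + norm z) ^ (1 + 2 * N + N)" for i z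
  proof -
    have d: "norm (r i z - z) \<le> 3 * norm z" using norm_triangle_ineq4[of "r i z" z] r(3)[of i z] by simp
    have "1 + D * norm (r i z - z) \<le> 1 + D * (3 * norm z)" using d D by (intro add_left_mono mult_left_mono) auto
    also have "\<dots> \<le> 3 * D * (1 + norm z)" using D by (simp add: algebra_simps)
    finally have "\<omega> (r i z) z \<le> (3 * (1 + norm z)) * (3 * D * (1 + norm z)) ^ (2 * N) * (1 + norm z) ^ N"
      unfolding \<omega>_def D_def[symmetric] using d D by (intro mult_mono power_mono) auto
    then show ?thesis by (simp only: power_mult_distrib power_add power_one_right mult_ac)
  qed
  have W: "integrable lborel (\<lambda>z. (3 * (3 * D) ^ (2 * N)) * ((1 + norm z) ^ (1 + 2 * N + N) * norm (\<theta> z)))"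
    by (intro integrable_mult_right integrable_schwartz_weight \<theta>)
  have \<omega>_dom: "norm (\<omega> (r i z) z * norm (\<theta> z)) \<le> (3 * (3 * D) ^ (2 * N)) * ((1 + norm z) ^ (1 + 2 * N + N) * norm (\<theta> z))" for i z
    using mult_right_mono[OF \<omega>_le[of i z], of "norm (\<theta> z)"] \<omega>_nonneg[of "r i z" z] by (simp add: mult_ac)
  have [measurable]: "(\<lambda>z. \<omega> (r i z) z) \<in> borel_measurable borel" for i unfolding \<omega>_def by measurable
  have \<omega>_int: "integrable lborel (\<lambda>z. \<omega> (r i z) z * norm (\<theta> z))" for i
    by (rule Bochner_Integration.integrable_bound[OF W])
       (auto intro!: AE_I2 order_trans[OF \<omega>_dom[unfolded real_norm_def]])
  have "e \<longlonglongrightarrow> (\<integral>z. 0 \<partial>(lborel :: 'a measure))"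
    unfolding e_def
  proof (rule integral_dominated_convergence[OF _ _ W])
    show "AE z in lborel. (\<lambda>i. \<omega> (r i z) z * norm (\<theta> z)) \<longlonglongrightarrow> 0"
    proof (rule AE_I2)
      fix z
      have "(\<lambda>i. \<omega> (r i z) z * norm (\<theta> z)) \<longlonglongrightarrow> \<omega> z z * norm (\<theta> z)"
        unfolding \<omega>_def by (intro tendsto_intros r(2))
      then show "(\<lambda>i. \<omega> (r i z) z * norm (\<theta> z)) \<longlonglongrightarrow> 0" by (simp add: \<omega>_def)
    qed
    show "AE z in lborel. norm (\<omega> (r i z) z * norm (\<theta> z)) \<le>
        (3 * (3 * D) ^ (2 * N)) * ((1 + norm z) ^ (1 + 2 * N + N) * norm (\<theta> z))" for i
      by (rule AE_I2[OF \<omega>_dom])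
  qed measurable
  then have e: "e \<longlonglongrightarrow> 0" by simp
  define B where "B bs = (\<Sum>b\<in>Basis. schwartz_seminorm N [b] (iter_partial bs k))" for bs
  have le: "norm (T (E i)) \<le> C * (\<Sum>bs\<in>L. B bs * e i)" for i
  proof (rule C(4)[rule_format])
    show "E i \<in> schwartz" unfolding E_def[abs_def] by (rule schwartz_diff[OF sum_schwartz conv_schwartz])
    fix bs and y :: 'a assume "bs \<in> L"
    then have bs: "set bs \<subseteq> Basis" by (rule C(3)[rule_format])
    define k' where "k' = iter_partial bs k"
    have k': "k' \<in> schwartz" unfolding k'_def by (rule iter_partial_schwartz[OF k bs])
    have "iter_partial bs (E i) y = (\<Sum>g\<in>range (r i). c i g * k' (y - g)) - convolve k' \<theta> y"
      unfolding E_def[abs_def] iter_partial_diff[OF schwartz_imp_smooth[OF sum_schwartz] schwartz_imp_smooth[OF conv_schwartz] bs]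
        iter_partial_sum[OF fin schwartz_translate[OF k] bs] iter_partial_translate
      using iter_partial_convolve[OF \<theta> k bs] by (simp add: k'_def)
    also have "\<dots> = (\<integral>z. (k' (y - r i z) - k' (y - z)) * \<theta> z \<partial>lborel)"
      unfolding simple[of i "\<lambda>g. k' (y - g)"] convolve_def
      by (subst Bochner_Integration.integral_diff[symmetric])
         (auto simp: left_diff_distrib intro!: simple_int[of "\<lambda>g. k' (y - g)"] convolve_dominated(4)[OF \<theta> k'])
    finally have eq: "iter_partial bs (E i) y = (\<integral>z. (k' (y - r i z) - k' (y - z)) * \<theta> z \<partial>lborel)" .
    have "(1 + norm y) ^ N * norm (iter_partial bs (E i) y) \<le>
        (1 + norm y) ^ N * (\<integral>z. norm ((k' (y - r i z) - k' (y - z)) * \<theta> z) \<partial>lborel)"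
      unfolding eq by (intro mult_left_mono integral_norm_bound) simp
    also have "\<dots> = (\<integral>z. (1 + norm y) ^ N * norm ((k' (y - r i z) - k' (y - z)) * \<theta> z) \<partial>lborel)" by simp
    also have "\<dots> \<le> (\<integral>z. B bs * (\<omega> (r i z) z * norm (\<theta> z)) \<partial>lborel)"
    proof (rule integral_mono)
      show "integrable lborel (\<lambda>z. (1 + norm y) ^ N * norm ((k' (y - r i z) - k' (y - z)) * \<theta> z))"
        unfolding left_diff_distrib
        by (intro integrable_mult_right integrable_norm Bochner_Integration.integrable_diff
            simple_int[of "\<lambda>g. k' (y - g)"] convolve_dominated(4)[OF \<theta> k'])
      show "integrable lborel (\<lambda>z. B bs * (\<omega> (r i z) z * norm (\<theta> z)))"
        by (intro integrable_mult_right \<omega>_int)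
      fix z
      show "(1 + norm y) ^ N * norm ((k' (y - r i z) - k' (y - z)) * \<theta> z) \<le> B bs * (\<omega> (r i z) z * norm (\<theta> z))"
        using mult_right_mono[OF schwartz_translate_difference[OF k', of y N "r i z" z], of "norm (\<theta> z)"]
        by (simp add: B_def \<omega>_def k'_def norm_mult mult.assoc)
    qed
    also have "\<dots> = B bs * e i" unfolding e_def by (rule integral_mult_right_zero)
    finally show "(1 + norm y) ^ N * norm (iter_partial bs (E i) y) \<le> B bs * e i" .
  qed
  have lim: "(\<lambda>i. C * (\<Sum>bs\<in>L. B bs * e i)) \<longlonglongrightarrow> 0"
    by (intro tendsto_mult_right_zero tendsto_null_sum e)
  have "(\<lambda>i. T (E i)) \<longlonglongrightarrow> 0"
    by (rule Lim_null_comparison[OF always_eventually[OF allI[OF le]] lim])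
  then have "(\<lambda>i. \<integral>z. \<Theta> (r i z) * \<theta> z \<partial>lborel) \<longlonglongrightarrow> T (convolve k \<theta>)"
    unfolding TE by (simp add: LIM_zero_iff)
  moreover have "(\<lambda>i. \<integral>z. \<Theta> (r i z) * \<theta> z \<partial>lborel) \<longlonglongrightarrow> (\<integral>z. \<Theta> z * \<theta> z \<partial>lborel)"
  proof (rule integral_dominated_convergence[where w = "\<lambda>z. (A * 2 ^ M) * ((1 + norm z) ^ M * norm (\<theta> z))"])
    show "integrable lborel (\<lambda>z. (A * 2 ^ M) * ((1 + norm z) ^ M * norm (\<theta> z)))"
      by (intro integrable_mult_right integrable_schwartz_weight \<theta>)
    show "AE z in lborel. (\<lambda>i. \<Theta> (r i z) * \<theta> z) \<longlonglongrightarrow> \<Theta> z * \<theta> z"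
    proof (rule AE_I2)
      fix z
      have "isCont \<Theta> z" using cont by (simp add: continuous_on_eq_continuous_at)
      then show "(\<lambda>i. \<Theta> (r i z) * \<theta> z) \<longlonglongrightarrow> \<Theta> z * \<theta> z"
        by (intro tendsto_mult tendsto_const isCont_tendsto_compose[OF _ r(2)])
    qed
    show "AE z in lborel. norm (\<Theta> (r i z) * \<theta> z) \<le> (A * 2 ^ M) * ((1 + norm z) ^ M * norm (\<theta> z))" for i
    proof (rule AE_I2)
      fix z
      have "(1 + norm (r i z)) ^ M \<le> (2 * (1 + norm z)) ^ M" using r(3)[of i z] by (intro power_mono) auto
      then have "norm (\<Theta> (r i z)) \<le> A * (2 * (1 + norm z)) ^ M"
        using A(2)[of "r i z"] A(1) by (meson mult_left_mono order_trans)
      from mult_right_mono[OF this norm_ge_zero[of "\<theta> z"]]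
      show "norm (\<Theta> (r i z) * \<theta> z) \<le> (A * 2 ^ M) * ((1 + norm z) ^ M * norm (\<theta> z))"
        by (simp only: norm_mult power_mult_distrib mult_ac)
    qed
  qed measurable
  ultimately show ?thesis unfolding \<Theta>_def by (rule LIMSEQ_unique)
qed

end

lemma
  assumes T: "tempered T" and m: "cutoff m"
  shows continuous_on_fourier_mult: "continuous_on UNIV (fourier_mult m T)"
    and fourier_mult_growth: "\<exists>A N. 0 \<le> A \<and> (\<forall>z. norm (fourier_mult m T z) \<le> A * (1 + norm z) ^ N)"
  using continuous_on_tempered_translate[OF T mult_kernel_uminus_schwartz[OF m]]
    tempered_translate_growth[OF T mult_kernel_uminus_schwartz[OF m]]
  by (simp_all add: fourier_mult_def[abs_def])

text \<open>Since \<nu> m = m, convolving the kernel of m with that of \<nu> returns the kernel of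
  m; moving T under this convolution gives an identity at every point x.\<close>

lemma fourier_mult_reproducing:
  assumes T: "tempered T" and m: "cutoff m" and \<nu>: "cutoff \<nu>" and eq: "\<And>\<xi>. \<nu> \<xi> * m \<xi> = m \<xi>"
  shows "fourier_mult m T x = (\<integral>z. fourier_mult m T z * mult_kernel \<nu> (x - z) \<partial>lborel)"
proof -
  have \<theta>: "(\<lambda>z. mult_kernel \<nu> (x - z)) \<in> schwartz"
    using schwartz_translate[OF mult_kernel_uminus_schwartz[OF \<nu>], of x] by simp
  have "convolve (\<lambda>u. mult_kernel m (- u)) (\<lambda>z. mult_kernel \<nu> (x - z)) = (\<lambda>y. mult_kernel m (x - y))"
    using mult_kernel_convolution[OF m \<nu>] by (simp add: convolve_def fun_eq_iff eq)
  then show ?thesis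
    using tempered_convolve_eq_integral[OF T mult_kernel_uminus_schwartz[OF m] \<theta>]
    by (simp add: fourier_mult_def)
qed

section \<open>Nikolskii's inequality\<close>

text \<open>The polynomial weight only serves to make the supremum finite a priori; the lemma is applied
  once with the growth exponent of F, which yields boundedness, and once more with N = 0, which
  yields the sharp constant.\<close>

lemma reproducing_sup_bound_le_1:
  fixes F \<kappa> :: "'a::euclidean_space \<Rightarrow> complex"
  assumes [measurable]: "F \<in> borel_measurable borel"
    and repr: "\<And>x. F x = (\<integral>z. F z * \<kappa> (x - z) \<partial>lborel)" and int: "\<And>x. integrable lborel (\<lambda>z. F z * \<kappa> (x - z))"
    and A: "\<And>z. norm (F z) \<le> A * (1 + norm z) ^ N"
    and s: "0 < s" "\<And>u. (1 + norm u) ^ N * norm (\<kappa> u) \<le> s"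
    and r: "0 < r" "r \<le> 1" and \<sigma>: "0 < \<sigma>" "(\<integral>\<^sup>+z. ennreal (norm (F z) powr r) \<partial>lborel) \<le> ennreal (\<sigma> powr r)"
  shows "norm (F x0) \<le> s powr (1 / r) * \<sigma>"
proof -
  \<comment> \<open>The weight is centred at x0, so that H x0 = |F x0| and the final bound carries
    no weight. The polynomial growth of F makes the supremum of H finite.\<close>
  define H where "H z = norm (F z) / (1 + norm (z - x0)) ^ N" for z
  have w: "0 < (1 + norm u) ^ N" for u :: 'a by (intro zero_less_power) (simp add: add_pos_nonneg)
  have bdd: "bdd_above (range H)"
  proof (rule bdd_aboveI2)
    fix z
    have "norm (F z) \<le> A * (1 + norm z) ^ N" by (rule A)
    also have "0 \<le> A" using order_trans[OF norm_ge_zero A[of 0]] by simp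
    then have "A * (1 + norm z) ^ N \<le> A * ((1 + norm (z - x0)) ^ N * (1 + norm x0) ^ N)"
      by (intro mult_left_mono weight_le)
    finally show "H z \<le> A * (1 + norm x0) ^ N"
      unfolding H_def using w[of "z - x0"] by (simp add: divide_le_eq mult_ac)
  qed
  define M where "M = (SUP z. H z)"
  have HM: "H z \<le> M" for z unfolding M_def by (rule cSUP_upper[OF _ bdd]) simp
  have FM: "norm (F z) \<le> M * (1 + norm (z - x0)) ^ N" for z
    using HM[of z] w[of "z - x0"] by (simp add: H_def divide_le_eq)
  have M0: "0 \<le> M" using order_trans[OF _ HM[of x0]] by (simp add: H_def)
  \<comment> \<open>Self-improvement: in |F| = |F|^(1-r) |F|^r the first factor is estimated by M
    and the weight, the second is integrated. Because M is finite, M^(1-r) can be cancelled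
    afterwards, which leaves a bound for M^r.\<close>
  have "M \<le> M powr (1 - r) * (s * \<sigma> powr r)"
    unfolding M_def[symmetric]
  proof -
    have "H x \<le> M powr (1 - r) * (s * \<sigma> powr r)" for x
    proof -
      let ?c = "M powr (1 - r) * (s * (1 + norm (x - x0)) ^ N)"
      have c: "0 \<le> ?c" using s by simp
      have pw: "norm (F z * \<kappa> (x - z)) \<le> ?c * norm (F z) powr r" for z
      proof -
        have "norm (F z) = norm (F z) powr (1 - r) * norm (F z) powr r"
          by (simp flip: powr_add)
        also have "\<dots> \<le> (M * (1 + norm (z - x0)) ^ N) powr (1 - r) * norm (F z) powr r"
          using r by (intro mult_right_mono powr_mono2 FM) auto
        also have "\<dots> = M powr (1 - r) * ((1 + norm (z - x0)) ^ N) powr (1 - r) * norm (F z) powr r"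
          using M0 w by (simp add: powr_mult less_imp_le)
        also have "\<dots> \<le> M powr (1 - r) * (1 + norm (z - x0)) ^ N * norm (F z) powr r"
        proof -
          \<comment> \<open>The weight is at least 1 and 1 - r <= 1, so this power does not exceed
            the weight itself.\<close>
          have "((1 + norm (z - x0)) ^ N) powr (1 - r) \<le> ((1 + norm (z - x0)) ^ N) powr 1"
            using r by (intro powr_mono one_le_power) auto
          then show ?thesis using w by (intro mult_right_mono mult_left_mono) (auto simp: less_imp_le)
        qed
        finally have F: "norm (F z) \<le> M powr (1 - r) * (1 + norm (z - x0)) ^ N * norm (F z) powr r" .
        have "(1 + norm (z - x0)) ^ N * norm (\<kappa> (x - z)) \<le>
            (1 + norm (z - x0 - (z - x))) ^ N * (1 + norm (z - x)) ^ N * norm (\<kappa> (x - z))"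
          by (intro mult_right_mono weight_le) simp
        also have "\<dots> = (1 + norm (x - x0)) ^ N * ((1 + norm (x - z)) ^ N * norm (\<kappa> (x - z)))"
          by (simp add: norm_minus_commute)
        also have "\<dots> \<le> (1 + norm (x - x0)) ^ N * s" by (intro mult_left_mono s) simp
        finally have k: "(1 + norm (z - x0)) ^ N * norm (\<kappa> (x - z)) \<le> s * (1 + norm (x - x0)) ^ N"
          by (simp add: mult.commute)
        have "norm (F z * \<kappa> (x - z)) \<le> (M powr (1 - r) * (1 + norm (z - x0)) ^ N * norm (F z) powr r) * norm (\<kappa> (x - z))"
          unfolding norm_mult by (intro mult_right_mono F) simp
        also have "\<dots> = (M powr (1 - r) * norm (F z) powr r) * ((1 + norm (z - x0)) ^ N * norm (\<kappa> (x - z)))" by simp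
        also have "\<dots> \<le> (M powr (1 - r) * norm (F z) powr r) * (s * (1 + norm (x - x0)) ^ N)"
          by (intro mult_left_mono k) simp
        finally show ?thesis by (simp add: mult_ac)
      qed
      have "ennreal (norm (F x)) \<le> (\<integral>\<^sup>+z. ennreal (norm (F z * \<kappa> (x - z))) \<partial>lborel)"
        using integral_norm_bound_ennreal[OF int[of x]] by (simp only: repr[of x, symmetric])
      also have "\<dots> \<le> (\<integral>\<^sup>+z. ennreal ?c * ennreal (norm (F z) powr r) \<partial>lborel)"
        using c by (intro nn_integral_mono) (simp only: ennreal_mult[symmetric] powr_ge_zero ennreal_leI[OF pw])
      also have "\<dots> = ennreal ?c * (\<integral>\<^sup>+z. ennreal (norm (F z) powr r) \<partial>lborel)"
        by (rule nn_integral_cmult) measurable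
      also have "\<dots> \<le> ennreal ?c * ennreal (\<sigma> powr r)" by (intro mult_left_mono \<sigma>) simp
      also have "\<dots> = ennreal (?c * \<sigma> powr r)" using c by (simp add: ennreal_mult)
      finally have "norm (F x) \<le> ?c * \<sigma> powr r" using c by (subst (asm) ennreal_le_iff) auto
      then show ?thesis unfolding H_def using w[of "x - x0"] by (simp add: divide_le_eq mult_ac)
    qed
    then show ?thesis unfolding M_def by (intro cSUP_least) auto
  qed
  then have "M \<le> s powr (1 / r) * \<sigma>"
  proof (cases "M = 0")
    case False
    then have M: "0 < M" using M0 by simp
    assume "M \<le> M powr (1 - r) * (s * \<sigma> powr r)"
    moreover have "M = M powr (1 - r) * M powr r" using M by (simp flip: powr_add)
    ultimately have "M powr r \<le> s * \<sigma> powr r" using M by (metis mult_le_cancel_left_pos powr_gt_zero less_irrefl)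
    then have "(M powr r) powr (1 / r) \<le> (s * \<sigma> powr r) powr (1 / r)" using r by (intro powr_mono2) auto
    then show ?thesis using M s \<sigma> r by (simp add: powr_powr powr_mult)
  qed (use s \<sigma> in simp)
  moreover have "norm (F x0) \<le> M" using FM[of x0] by simp
  ultimately show ?thesis by simp
qed

lemma reproducing_sup_bound_ge_1:
  fixes F \<kappa> :: "'a::euclidean_space \<Rightarrow> complex"
  assumes [measurable]: "F \<in> borel_measurable borel" and \<kappa>: "integrable lborel \<kappa>"
    and repr: "F x = (\<integral>z. F z * \<kappa> (x - z) \<partial>lborel)" and int: "integrable lborel (\<lambda>z. F z * \<kappa> (x - z))"
    and s: "0 < s" "\<And>u. norm (\<kappa> u) \<le> s"
    and r: "1 \<le> r" and \<sigma>: "0 < \<sigma>" "(\<integral>\<^sup>+z. ennreal (norm (F z) powr r) \<partial>lborel) \<le> ennreal (\<sigma> powr r)"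
  shows "norm (F x) \<le> ((\<integral>u. norm (\<kappa> u) \<partial>lborel) + 1) * (s powr (1 / r) * \<sigma>)"
proof -
  \<comment> \<open>The height with l^r = s \<sigma>^r, at which the large values of F contribute at
    most l, the same order as the small ones.\<close>
  define l where "l = s powr (1 / r) * \<sigma>"
  have l: "0 < l" using s \<sigma> by (simp add: l_def)
  have [measurable]: "\<kappa> \<in> borel_measurable borel" using \<kappa> by (auto dest: borel_measurable_integrable)
  have \<kappa>x: "integrable lborel (\<lambda>z. norm (\<kappa> (x - z)))" "(\<integral>z. norm (\<kappa> (x - z)) \<partial>lborel) = (\<integral>u. norm (\<kappa> u) \<partial>lborel)"
    using integrable_affine_iff[of "-1" "\<lambda>u. norm (\<kappa> u)" x] integral_affine[of "-1" "\<lambda>u. norm (\<kappa> u)" x] \<kappa>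
    by (simp_all add: integrable_norm)
  \<comment> \<open>Splitting at height l replaces Hoelder's inequality: t <= l + l^(1-r) t^r.\<close>
  have split: "t \<le> l + l powr (1 - r) * t powr r" if "0 \<le> t" for t
  proof (cases "t \<le> l")
    case True
    then show ?thesis by (simp add: add_increasing2)
  next
    case False
    then have "t = t powr (1 - r) * t powr r" using l by (simp flip: powr_add)
    also have "\<dots> \<le> l powr (1 - r) * t powr r"
      using False l r by (intro mult_right_mono powr_mono2') auto
    finally show ?thesis using l by simp
  qed
  have pw: "norm (F z * \<kappa> (x - z)) \<le> l * norm (\<kappa> (x - z)) + l powr (1 - r) * s * norm (F z) powr r" for z
  proof -
    have "norm (F z * \<kappa> (x - z)) \<le> (l + l powr (1 - r) * norm (F z) powr r) * norm (\<kappa> (x - z))"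
      unfolding norm_mult by (intro mult_right_mono split) auto
    also have "\<dots> = l * norm (\<kappa> (x - z)) + (l powr (1 - r) * norm (F z) powr r) * norm (\<kappa> (x - z))"
      by (simp add: distrib_right)
    also have "\<dots> \<le> l * norm (\<kappa> (x - z)) + (l powr (1 - r) * norm (F z) powr r) * s"
      by (intro add_left_mono mult_left_mono s) simp
    finally show ?thesis by (simp add: mult_ac)
  qed
  have "ennreal (norm (F x)) \<le> (\<integral>\<^sup>+z. ennreal (norm (F z * \<kappa> (x - z))) \<partial>lborel)"
    using integral_norm_bound_ennreal[OF int] by (simp only: repr[symmetric])
  also have "\<dots> \<le> (\<integral>\<^sup>+z. ennreal l * ennreal (norm (\<kappa> (x - z))) + ennreal (l powr (1 - r) * s) * ennreal (norm (F z) powr r) \<partial>lborel)"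
    using l s by (intro nn_integral_mono)
      (simp add: ennreal_mult[symmetric] ennreal_plus[symmetric] ennreal_leI[OF pw] del: ennreal_plus)
  also have "\<dots> = ennreal l * (\<integral>\<^sup>+z. ennreal (norm (\<kappa> (x - z))) \<partial>lborel) +
      ennreal (l powr (1 - r) * s) * (\<integral>\<^sup>+z. ennreal (norm (F z) powr r) \<partial>lborel)"
    by (subst nn_integral_add) (auto simp: nn_integral_cmult)
  also have "\<dots> \<le> ennreal l * ennreal (\<integral>u. norm (\<kappa> u) \<partial>lborel) + ennreal (l powr (1 - r) * s) * ennreal (\<sigma> powr r)"
    using \<kappa>x by (intro add_mono mult_left_mono \<sigma>) (simp_all add: nn_integral_eq_integral)
  also have "\<dots> = ennreal (l * (\<integral>u. norm (\<kappa> u) \<partial>lborel) + l powr (1 - r) * s * \<sigma> powr r)"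
    using l s by (simp add: ennreal_mult)
  finally have "norm (F x) \<le> l * (\<integral>u. norm (\<kappa> u) \<partial>lborel) + l powr (1 - r) * s * \<sigma> powr r"
    using l s by (subst (asm) ennreal_le_iff) (auto intro!: add_nonneg_nonneg)
  also have "l powr (1 - r) * s * \<sigma> powr r = l"
  proof -
    have "l powr r = s * \<sigma> powr r" using s \<sigma> r by (simp add: l_def powr_mult powr_powr)
    then have "l powr (1 - r) * s * \<sigma> powr r = l powr (1 - r) * l powr r" by simp
    also have "\<dots> = l" using l by (simp flip: powr_add)
    finally show ?thesis .
  qed
  finally show ?thesis unfolding l_def[symmetric] by (simp add: algebra_simps)
qed

text \<open>The cutoff enters only through the L1 norm of its kernel and a bound s for its supremum.
  A dilation of the cutoff preserves the first and scales the second, so the dependence on the size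
  of the spectrum is explicit. The summand 1 makes the constant at least 1, which lets the same
  formula cover r < 1.\<close>

lemma fourier_mult_sup_bound:
  fixes T :: "('a::euclidean_space \<Rightarrow> complex) \<Rightarrow> complex"
  assumes T: "tempered T" and m: "cutoff m" and \<nu>: "cutoff \<nu>" and eq: "\<And>\<xi>. \<nu> \<xi> * m \<xi> = m \<xi>"
    and s: "0 < s" "\<And>u. norm (mult_kernel \<nu> u) \<le> s"
    and r: "0 < r" and \<sigma>: "0 < \<sigma>" "(\<integral>\<^sup>+z. ennreal (norm (fourier_mult m T z) powr r) \<partial>lborel) \<le> ennreal (\<sigma> powr r)"
  shows "norm (fourier_mult m T x) \<le> ((\<integral>u. norm (mult_kernel \<nu> u) \<partial>lborel) + 1) * (s powr (1 / r) * \<sigma>)"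
proof -
  let ?F = "fourier_mult m T"
  have meas: "?F \<in> borel_measurable borel"
    by (rule borel_measurable_continuous_onI[OF continuous_on_fourier_mult[OF T m]])
  note repr = fourier_mult_reproducing[OF T m \<nu> eq]
  obtain A N where A: "0 \<le> A" "\<And>z. norm (?F z) \<le> A * (1 + norm z) ^ N"
    using fourier_mult_growth[OF T m] by blast
  have decay: "(1 + norm u) ^ N * norm (mult_kernel \<nu> u) \<le> schwartz_seminorm N [] (\<lambda>u. mult_kernel \<nu> (- u))" for u N
    using schwartz_bound[OF mult_kernel_uminus_schwartz[OF \<nu>], of "[]" "- u" N] by simp
  have int: "integrable lborel (\<lambda>z. ?F z * mult_kernel \<nu> (x - z))" for x
  proof (rule Bochner_Integration.integrable_bound)
    have \<theta>: "(\<lambda>z. mult_kernel \<nu> (x - z)) \<in> schwartz"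
      using schwartz_translate[OF mult_kernel_uminus_schwartz[OF \<nu>], of x] by simp
    show "integrable lborel (\<lambda>z. A * ((1 + norm z) ^ N * norm (mult_kernel \<nu> (x - z))))"
      by (intro integrable_mult_right integrable_schwartz_weight \<theta>)
    have "(\<lambda>z. mult_kernel \<nu> (x - z)) \<in> borel_measurable borel" by (rule borel_measurable_schwartz[OF \<theta>])
    then show "(\<lambda>z. ?F z * mult_kernel \<nu> (x - z)) \<in> borel_measurable lborel"
      using meas by simp
    show "AE z in lborel. norm (?F z * mult_kernel \<nu> (x - z)) \<le> norm (A * ((1 + norm z) ^ N * norm (mult_kernel \<nu> (x - z))))"
      using A(1) mult_right_mono[OF A(2)] by (intro AE_I2) (simp add: norm_mult abs_mult mult.assoc[symmetric])
  qed
  show ?thesis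
  proof (cases "1 \<le> r")
    case True
    then show ?thesis
      by (rule reproducing_sup_bound_ge_1[OF meas integrable_mult_kernel[OF \<nu>] repr int s _ \<sigma>])
  next
    case False
    \<comment> \<open>The constant of the weighted pass is immaterial, as this pass only serves to
      show that F is bounded; the summand 1 makes it positive.\<close>
    define s' where "s' = schwartz_seminorm N [] (\<lambda>u. mult_kernel \<nu> (- u)) + 1"
    have s': "0 < s'" "(1 + norm u) ^ N * norm (mult_kernel \<nu> u) \<le> s'" for u
      using decay[of u N] schwartz_seminorm_nonneg[OF mult_kernel_uminus_schwartz[OF \<nu>], of "[]" N]
      by (simp_all add: s'_def)
    have "norm (?F z) \<le> s' powr (1 / r) * \<sigma>" for z
      using False by (intro reproducing_sup_bound_le_1[OF meas repr int A(2) s' r _ \<sigma>]) simp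
    then have "norm (?F z) \<le> (s' powr (1 / r) * \<sigma>) * (1 + norm z) ^ 0" for z by simp
    \<comment> \<open>With F bounded the weight exponent is 0, so the supremum bound s of the kernel
      itself is the constant.\<close>
    from reproducing_sup_bound_le_1[OF meas repr int this s(1) _ r _ \<sigma>, of x] False s(2)
    have "norm (?F x) \<le> 1 * (s powr (1 / r) * \<sigma>)" by simp
    also have "\<dots> \<le> ((\<integral>u. norm (mult_kernel \<nu> u) \<partial>lborel) + 1) * (s powr (1 / r) * \<sigma>)"
      using s \<sigma> by (intro mult_right_mono) auto
    finally show ?thesis .
  qed
qed

text \<open>Interpolation between L_p and the supremum: |F|^p' <= (sup |F|)^(p' - p) |F|^p for
  finite p'; for p' = infinity the exponent of B reads as 1. The hypothesis is phrased with real
  \<sigma> > 0, which leaves infinite and vanishing norms as separate cases.\<close>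

lemma Lp_norm_le_of_sup_bound:
  fixes F :: "'a::euclidean_space \<Rightarrow> complex"
  assumes [measurable]: "F \<in> borel_measurable borel" and p: "0 < p" "p \<noteq> \<infinity>" "p \<le> p'" and B: "0 < B"
    and sup: "\<And>\<sigma> x. 0 < \<sigma> \<Longrightarrow> (\<integral>\<^sup>+z. ennreal (norm (F z) powr enn2real p) \<partial>lborel) \<le> ennreal (\<sigma> powr enn2real p) \<Longrightarrow>
      norm (F x) \<le> B * \<sigma>"
  shows "Lp_norm p' F \<le> ennreal (B powr (1 - enn2real p / enn2real p')) * Lp_norm p F"
proof -
  define r where "r = enn2real p"
  have r: "0 < r" unfolding r_def by (rule enn2real_pos[OF p(1,2)])
  let ?I = "\<integral>\<^sup>+z. ennreal (norm (F z) powr r) \<partial>lborel"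
  have Lp: "Lp_norm p F = ennpow ?I (1 / r)" by (simp add: Lp_norm_finite[OF p(2)] r_def)
  have I: "?I = ennpow (Lp_norm p F) r" by (simp add: Lp ennpow_inverse r)
  consider "Lp_norm p F = top" | "Lp_norm p F = 0" | \<sigma> where "0 < \<sigma>" "Lp_norm p F = ennreal \<sigma>"
    by (cases "Lp_norm p F") (auto simp: less_le)
  then show ?thesis
  proof cases
    case 1
    have "0 < B powr (1 - enn2real p / enn2real p')" using B by simp
    then show ?thesis unfolding 1 by (simp add: ennreal_mult_top)
  next
    case 2
    \<comment> \<open>A vanishing norm admits every positive \<sigma>, so |F x| lies below every
      positive number.\<close>
    then have "norm (F x) \<le> B * \<sigma>" if "0 < \<sigma>" for x \<sigma>
      using I that by (intro sup) (simp_all add: r_def)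
    then have "norm (F x) \<le> 0 + e" if "0 < e" for x e
      using that B by (metis add_0 divide_pos_pos nonzero_mult_div_cancel_left times_divide_eq_right less_irrefl)
    then have "norm (F x) \<le> 0" for x by (rule field_le_epsilon)
    then have "F = (\<lambda>x. 0)" by auto
    then show ?thesis by (simp add: Lp_norm_zero)
  next
    case (3 \<sigma>)
    have I\<sigma>: "?I = ennreal (\<sigma> powr r)" using 3 by (simp add: I ennpow_ennreal)
    have F: "norm (F x) \<le> B * \<sigma>" for x using 3(1) I\<sigma> by (intro sup) (simp_all add: r_def)
    show ?thesis
    proof (cases "p' = \<infinity>")
      case True
      have "Lp_norm p' F \<le> ennreal (B * \<sigma>)"
        unfolding True Lp_norm_infinity using F by (intro Inf_lower) (auto intro!: ennreal_leI)
      then show ?thesis using True 3 B by (simp add: ennreal_mult)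
    next
      case False
      define r' where "r' = enn2real p'"
      have r': "r \<le> r'" "0 < r'"
        using p False r by (auto simp: r_def r'_def enn2real_mono less_top intro: less_le_trans)
      have "(\<integral>\<^sup>+z. ennreal (norm (F z) powr r') \<partial>lborel) \<le>
          (\<integral>\<^sup>+z. ennreal ((B * \<sigma>) powr (r' - r)) * ennreal (norm (F z) powr r) \<partial>lborel)"
      proof (rule nn_integral_mono)
        fix z
        have "norm (F z) powr r' = norm (F z) powr (r' - r) * norm (F z) powr r" by (simp flip: powr_add)
        also have "\<dots> \<le> (B * \<sigma>) powr (r' - r) * norm (F z) powr r"
          using r' F by (intro mult_right_mono powr_mono2) auto
        finally show "ennreal (norm (F z) powr r') \<le> ennreal ((B * \<sigma>) powr (r' - r)) * ennreal (norm (F z) powr r)"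
          by (simp add: ennreal_mult[symmetric] ennreal_leI)
      qed
      also have "\<dots> = ennreal ((B * \<sigma>) powr (r' - r) * \<sigma> powr r)"
        by (simp add: nn_integral_cmult I\<sigma> ennreal_mult)
      finally have "Lp_norm p' F \<le> ennpow (ennreal ((B * \<sigma>) powr (r' - r) * \<sigma> powr r)) (1 / r')"
        unfolding Lp_norm_finite[OF False] r'_def[symmetric] using r' by (intro ennpow_mono) auto
      also have "\<dots> = ennreal (B powr (1 - r / r') * \<sigma>)"
      proof -
        have "(B * \<sigma>) powr (r' - r) * \<sigma> powr r = B powr (r' - r) * \<sigma> powr r'"
          using B 3(1) by (simp add: powr_mult mult.assoc flip: powr_add)
        moreover have "(B powr (r' - r) * \<sigma> powr r') powr (1 / r') = B powr (1 - r / r') * \<sigma>"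
          using B 3(1) r' by (simp add: powr_mult powr_powr diff_divide_distrib)
        ultimately show ?thesis by (simp add: ennpow_ennreal)
      qed
      finally show ?thesis using 3 by (simp add: ennreal_mult r_def r'_def)
    qed
  qed
qed

section \<open>The two resolutions of unity\<close>

lemma exists_large_coordinate:
  fixes x :: "real ^ 'n"
  assumes "real CARD('n) * R < norm x" shows "\<exists>i. R < \<bar>x $ i\<bar>"
proof (rule ccontr)
  assume "\<nexists>i. R < \<bar>x $ i\<bar>"
  then have "(\<Sum>i\<in>UNIV. \<bar>x $ i\<bar>) \<le> (\<Sum>i\<in>(UNIV :: 'n set). R)" by (intro sum_mono) (auto simp: not_less)
  with norm_le_l1_cart[of x] assms show False by simp
qed

lemma cutoff_prod:
  fixes u :: "'n::finite \<Rightarrow> real \<Rightarrow> real"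
  assumes "\<And>i. smooth (u i)" and "\<And>i s. R < \<bar>s\<bar> \<Longrightarrow> u i s = 0"
  shows "cutoff (\<lambda>x::real^'n. \<Prod>i\<in>UNIV. u i (x $ i))"
proof (rule cutoffI)
  have "smooth (\<lambda>x::real^'n. u i (x $ i))" for i
    using smooth_compose_inner[OF assms(1)[of i], of 0 "axis i (1::real)"] by (simp add: inner_axis')
  then show "smooth (\<lambda>x::real^'n. \<Prod>i\<in>UNIV. u i (x $ i))" by (intro smooth_prod)
  show "(\<Prod>i\<in>UNIV. u i (x $ i)) = 0" if "real CARD('n) * R < norm x" for x :: "real^'n"
    using exists_large_coordinate[OF that] assms(2) by (auto intro!: prod_zero)
qed

lemma borel_measurable_cutoff: "cutoff m \<Longrightarrow> m \<in> borel_measurable borel"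
  using measurable_compose[OF borel_measurable_test_functions borel_measurable_Re, of "\<lambda>\<xi>. of_real (m \<xi>)"] by simp

lemma
  shows abs_dyadic_scale: "\<bar>2 powr (- real j) * s\<bar> = \<bar>s\<bar> / 2 ^ j"
    and abs_dyadic_scale_Suc: "\<bar>2 powr (- real j + 1) * s\<bar> = 2 * \<bar>s\<bar> / 2 ^ j"
  by (simp_all add: abs_mult powr_minus powr_diff powr_realpow divide_inverse)

lemma power2_less: "i < j \<Longrightarrow> 2 * 2 ^ i \<le> (2::real) ^ j" for i j :: nat
  using power_increasing[of "Suc i" j "2::real"] by simp

section \<open>The dyadic functions on the line, their products, and the test bump\<close>

context
  fixes \<phi>0 :: "real \<Rightarrow> real"
  assumes adm: "admissible_1d \<phi>0"
begin

lemma smooth_\<phi>0: "smooth \<phi>0" and \<phi>0_eq_1: "\<bar>s\<bar> \<le> 1 \<Longrightarrow> \<phi>0 s = 1" and \<phi>0_eq_0: "3 / 2 < \<bar>s\<bar> \<Longrightarrow> \<phi>0 s = 0"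
  using adm by (auto simp: admissible_1d_def)

lemma smooth_phi_j: "smooth (phi_j \<phi>0 j)"
proof -
  have "smooth (\<lambda>s. \<phi>0 (c * s))" for c using smooth_scale[OF smooth_\<phi>0, of c] by simp
  then show ?thesis
    unfolding phi_j_def[abs_def] using smooth_\<phi>0 by (cases "j = 0") (auto intro!: smooth_diff)
qed

lemma phi_j_eq_0_outside:
  assumes "3 / 2 * 2 ^ j < \<bar>s\<bar>" shows "phi_j \<phi>0 j s = 0"
proof -
  have "3 / 2 < \<bar>2 powr (- real j) * s\<bar>" "3 / 2 < \<bar>2 powr (- real j + 1) * s\<bar>"
    unfolding abs_dyadic_scale abs_dyadic_scale_Suc using assms by (simp_all add: field_simps)
  then show ?thesis using assms by (auto simp: phi_j_def \<phi>0_eq_0)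
qed

lemma phi_j_eq_0_inside:
  assumes "0 < j" "\<bar>s\<bar> \<le> 2 ^ j / 2" shows "phi_j \<phi>0 j s = 0"
proof -
  have "\<bar>2 powr (- real j) * s\<bar> \<le> 1" "\<bar>2 powr (- real j + 1) * s\<bar> \<le> 1"
    unfolding abs_dyadic_scale abs_dyadic_scale_Suc using assms by (simp_all add: field_simps)
  then show ?thesis using assms by (simp add: phi_j_def \<phi>0_eq_1)
qed

text \<open>The plateau: here the wider dilate of the generator is still 1 while the narrower one is
  already 0.\<close>

lemma phi_j_eq_1:
  assumes "0 < j" "3 / 4 * 2 ^ j < \<bar>s\<bar>" "\<bar>s\<bar> \<le> 2 ^ j" shows "phi_j \<phi>0 j s = 1"
proof -
  have "\<bar>2 powr (- real j) * s\<bar> \<le> 1" "3 / 2 < \<bar>2 powr (- real j + 1) * s\<bar>"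
    unfolding abs_dyadic_scale abs_dyadic_scale_Suc using assms by (simp_all add: field_simps)
  then show ?thesis using assms by (simp add: phi_j_def \<phi>0_eq_1 \<phi>0_eq_0)
qed

lemma cutoff_phi_multi: "cutoff (phi_multi \<phi>0 (k :: 'n::finite \<Rightarrow> nat))"
  unfolding phi_multi_def[abs_def]
proof (rule cutoff_prod[OF smooth_phi_j])
  fix i :: 'n and s :: real
  assume s: "3 / 2 * 2 ^ (\<Sum>i\<in>UNIV. k i) < \<bar>s\<bar>"
  have "(2::real) ^ k i \<le> 2 ^ (\<Sum>i\<in>UNIV. k i)"
    by (intro power_increasing member_le_sum) auto
  with s show "phi_j \<phi>0 (k i) s = 0" by (intro phi_j_eq_0_outside) linarith
qed

text \<open>For j >= 1 the function \<open>phi_j\<close> vanishes up to 2^(j-1) >= 1. Besides the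
  low-frequency tests, this makes the lowest block function usable as a cutoff that is 1 on the unit
  cube.\<close>

lemma phi_multi_unit_cube:
  assumes "\<And>i. \<bar>\<xi> $ i\<bar> \<le> 1"
  shows "phi_multi \<phi>0 k \<xi> = (if k = (\<lambda>_. 0) then 1 else 0)"
proof (cases "k = (\<lambda>_. 0)")
  case True
  then show ?thesis using assms by (simp add: phi_multi_def phi_j_def \<phi>0_eq_1)
next
  case False
  then obtain i where i: "0 < k i" by (auto simp: fun_eq_iff)
  then have "phi_j \<phi>0 (k i) (\<xi> $ i) = 0"
    using assms[of i] power2_less[of 0 "k i"] by (intro phi_j_eq_0_inside) auto
  then show ?thesis using False by (auto simp: phi_multi_def intro!: prod_zero)
qed

text \<open>A product bump supported in the cube [25/32, 31/32]^n, on whose dyadic dilates every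
  element of either resolution of unity is identically 0 or 1.\<close>

definition bump :: "real ^ 'n::finite \<Rightarrow> real" where
  "bump \<xi> = (\<Prod>i\<in>UNIV. \<phi>0 (- 14 + 16 * \<xi> $ i))"

lemma cutoff_bump_scale:
  assumes c: "0 < c" shows "cutoff (\<lambda>\<xi>. bump ((1 / c) *\<^sub>R \<xi> :: real ^ 'n::finite))"
proof -
  have "cutoff (\<lambda>\<xi>::real^'n. \<Prod>i\<in>UNIV. \<phi>0 (- 14 + (16 / c) \<bullet> (\<xi> $ i)))"
  proof (rule cutoff_prod)
    show "smooth (\<lambda>s. \<phi>0 (- 14 + (16 / c) \<bullet> s))"
      by (rule smooth_compose_inner[OF smooth_\<phi>0])
    fix s :: real assume s: "c < \<bar>s\<bar>"
    then have "16 < \<bar>16 / c * s\<bar>" using c by (simp add: abs_mult field_simps)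
    then show "\<phi>0 (- 14 + (16 / c) \<bullet> s) = 0" by (intro \<phi>0_eq_0) (auto simp: abs_if split: if_splits)
  qed
  then show ?thesis by (simp add: bump_def)
qed

text \<open>The argument of the generator is 16 (s - 7/8), so the support lies within 3/32 of 7/8,
  inside the plateau (3/4, 1]. The second inequality restates the first in the form in which it is
  compared with the outer radius 3/2 * 2^j of a lower block.\<close>

lemma bump_support:
  assumes "bump ((1 / c) *\<^sub>R \<xi>) \<noteq> 0" and c: "0 < c"
  shows "3 / 4 * c < \<xi> $ i" "3 / 2 * (c / 2) < \<xi> $ i" "\<xi> $ i \<le> c"
proof -
  have "\<phi>0 (- 14 + 16 * (\<xi> $ i / c)) \<noteq> 0" using assms by (auto simp: bump_def)
  then have "\<bar>- 14 + 16 * (\<xi> $ i / c)\<bar> \<le> 3 / 2" using \<phi>0_eq_0 by (meson not_less)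
  then have "3 / 4 < \<xi> $ i / c" "\<xi> $ i / c \<le> 1" unfolding abs_le_iff by linarith+
  then show "3 / 4 * c < \<xi> $ i" "\<xi> $ i \<le> c" using c by (simp_all add: field_simps)
  then show "3 / 2 * (c / 2) < \<xi> $ i" by simp
qed

lemma bump_center: "bump (\<chi> i. 7 / 8) = 1"
  by (simp add: bump_def \<phi>0_eq_1)

text \<open>All coordinates lie above 3/4 * 2^m and at most at 2^m. The functions of index below m
  end at 3/2 * 2^(m-1) = 3/4 * 2^m at the latest, those of index above m vanish up to 2^m, and the
  one of index m is on its plateau.\<close>

lemma phi_multi_bump:
  assumes m: "0 < m" and b: "bump ((1 / 2 ^ m) *\<^sub>R \<xi>) \<noteq> 0"
  shows "phi_multi \<phi>0 k \<xi> = (if k = (\<lambda>_. m) then 1 else 0)"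
proof -
  note supp = bump_support[OF b zero_less_power[OF zero_less_numeral]]
  have pos: "\<bar>\<xi> $ i\<bar> = \<xi> $ i" for i using supp(1)[of i] by (simp add: order_trans[of 0 "3 / 4 * 2 ^ m"])
  have "phi_j \<phi>0 j (\<xi> $ i) = (if j = m then 1 else 0)" for i j
  proof -
    consider "j < m" | "j = m" | "m < j" by linarith
    then show ?thesis
    proof cases
      case 1
      then show ?thesis using supp(2)[of i] power2_less[OF 1] by (simp add: phi_j_eq_0_outside pos)
    next
      case 2
      then show ?thesis using m supp[of i] by (simp add: phi_j_eq_1 pos)
    next
      case 3
      then show ?thesis using supp(3)[of i] power2_less[OF 3] by (simp add: phi_j_eq_0_inside pos)
    qed
  qed
  then show ?thesis by (auto simp: phi_multi_def fun_eq_iff intro!: prod_zero)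
qed

end

section \<open>The isotropic resolution on the same bumps\<close>

context
  fixes \<psi>0 :: "real ^ 'n::finite \<Rightarrow> real"
  assumes adm: "admissible_iso \<psi>0"
begin

lemma smooth_\<psi>0: "smooth \<psi>0" and \<psi>0_eq_1: "(\<And>i. \<bar>x $ i\<bar> \<le> 1) \<Longrightarrow> \<psi>0 x = 1"
  and \<psi>0_eq_0: "3 / 2 \<le> \<bar>x $ i\<bar> \<Longrightarrow> \<psi>0 x = 0"
  using adm by (auto simp: admissible_iso_def)

lemma psi_j_eq_0_outside:
  assumes "3 / 2 * 2 ^ j \<le> \<bar>x $ i\<bar>" shows "psi_j \<psi>0 j x = 0"
proof -
  have "3 / 2 \<le> \<bar>2 powr (- real j) * x $ i\<bar>" "3 / 2 \<le> \<bar>2 powr (- real j + 1) * x $ i\<bar>"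
    unfolding abs_dyadic_scale abs_dyadic_scale_Suc using assms by (simp_all add: field_simps)
  then show ?thesis
    using assms \<psi>0_eq_0[of x i] \<psi>0_eq_0[of "(2 powr (- real j)) *\<^sub>R x" i] \<psi>0_eq_0[of "(2 powr (- real j + 1)) *\<^sub>R x" i]
    by (auto simp: psi_j_def)
qed

lemma psi_j_eq_0_inside:
  assumes "0 < j" "\<And>i. \<bar>x $ i\<bar> \<le> 2 ^ j / 2" shows "psi_j \<psi>0 j x = 0"
proof -
  have "\<bar>2 powr (- real j) * x $ i\<bar> \<le> 1" "\<bar>2 powr (- real j + 1) * x $ i\<bar> \<le> 1" for i
    unfolding abs_dyadic_scale abs_dyadic_scale_Suc using assms(2)[of i] by (simp_all add: field_simps)
  then show ?thesis
    using assms(1) \<psi>0_eq_1[of "(2 powr (- real j)) *\<^sub>R x"] \<psi>0_eq_1[of "(2 powr (- real j + 1)) *\<^sub>R x"]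
    by (simp add: psi_j_def)
qed

lemma psi_j_eq_1:
  assumes "0 < j" "3 / 4 * 2 ^ j < \<bar>x $ i\<bar>" "\<And>i. \<bar>x $ i\<bar> \<le> 2 ^ j" shows "psi_j \<psi>0 j x = 1"
proof -
  have "\<bar>2 powr (- real j) * x $ i\<bar> \<le> 1" for i
    unfolding abs_dyadic_scale using assms(3)[of i] by (simp add: field_simps)
  moreover have "3 / 2 \<le> \<bar>2 powr (- real j + 1) * x $ i\<bar>"
    unfolding abs_dyadic_scale_Suc using assms(2) by (simp add: field_simps)
  ultimately show ?thesis
    using assms(1) \<psi>0_eq_1[of "(2 powr (- real j)) *\<^sub>R x"] \<psi>0_eq_0[of "(2 powr (- real j + 1)) *\<^sub>R x" i]
    by (simp add: psi_j_def)
qed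

lemma cutoff_psi_j: "cutoff (psi_j \<psi>0 j)"
proof (rule cutoffI)
  show "smooth (psi_j \<psi>0 j)"
    unfolding psi_j_def[abs_def] using smooth_\<psi>0
    by (cases "j = 0") (auto intro!: smooth_diff smooth_scale)
  show "psi_j \<psi>0 j x = 0" if x: "real CARD('n) * (3 / 2 * 2 ^ j) < norm x" for x
  proof -
    obtain i where "3 / 2 * 2 ^ j < \<bar>x $ i\<bar>" using exists_large_coordinate[OF x] by blast
    then show ?thesis by (intro psi_j_eq_0_outside[of j x i] less_imp_le)
  qed
qed

lemma psi_j_unit_cube:
  assumes "\<And>i. \<bar>\<xi> $ i\<bar> \<le> 1" shows "psi_j \<psi>0 j \<xi> = (if j = 0 then 1 else 0)"
proof (cases "j = 0")
  case True
  then show ?thesis using assms by (simp add: psi_j_def \<psi>0_eq_1)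
next
  case False
  then have "\<bar>\<xi> $ i\<bar> \<le> 2 ^ j / 2" for i using assms[of i] power2_less[of 0 j] by simp
  then show ?thesis using False by (simp add: psi_j_eq_0_inside)
qed

lemma psi_j_bump:
  assumes \<phi>0: "admissible_1d \<phi>0" and m: "0 < m" and b: "bump \<phi>0 ((1 / 2 ^ m) *\<^sub>R \<xi>) \<noteq> 0"
  shows "psi_j \<psi>0 j \<xi> = (if j = m then 1 else 0)"
proof -
  note supp = bump_support[OF \<phi>0 b zero_less_power[OF zero_less_numeral]]
  have pos: "\<bar>\<xi> $ i\<bar> = \<xi> $ i" for i using supp(1)[of i] by (simp add: order_trans[of 0 "3 / 4 * 2 ^ m"])
  consider "j < m" | "j = m" | "m < j" by linarith
  then show ?thesis
  proof cases
    case 1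
    \<comment> \<open>All coordinates pass the threshold and one is enough, so any index serves;
      \<open>undefined\<close> merely names one.\<close>
    then show ?thesis using supp(2)[of undefined] power2_less[OF 1]
      by (simp add: psi_j_eq_0_outside[where i = undefined] pos)
  next
    case 2
    then show ?thesis using m supp psi_j_eq_1[of j \<xi> undefined] by (simp add: pos)
  next
    case 3
    have "\<bar>\<xi> $ i\<bar> \<le> 2 ^ j / 2" for i using supp(3)[of i] power2_less[OF 3] by (simp add: pos)
    then show ?thesis using 3 by (simp add: psi_j_eq_0_inside)
  qed
qed

end

section \<open>Nikolskii's inequality for dyadic blocks\<close>

lemma prod_Basis_cart: "(\<Prod>b\<in>Basis. f b) = (\<Prod>i\<in>(UNIV :: 'n::finite set). f (axis i (1::real)))"
proof -
  have B: "Basis = (\<lambda>i. axis i (1::real)) ` (UNIV :: 'n set)"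
    by (auto simp: Basis_vec_def)
  have "inj (\<lambda>i::'n. axis i (1::real))" by (simp add: inj_on_def axis_eq_axis)
  from prod.reindex[OF this] show ?thesis by (simp add: B)
qed

text \<open>The value at axis i 1 is 2^(k i + 1); the sum only serves to read off i from the basis vector.\<close>

definition block_scale :: "('n::finite \<Rightarrow> nat) \<Rightarrow> real ^ 'n \<Rightarrow> real" where
  "block_scale k b = 2 powr (1 + (\<Sum>i\<in>UNIV. real (k i) * b $ i))"

lemma block_scale_axis: "block_scale k (axis i 1) = 2 * 2 ^ k i"
proof -
  have "(\<Sum>j\<in>UNIV. real (k j) * axis i 1 $ j) = (\<Sum>j\<in>UNIV. if j = i then real (k j) else 0)"
    by (intro sum.cong) (auto simp: axis_def)
  then show ?thesis by (simp add: block_scale_def powr_add powr_realpow)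
qed

lemma block_scale_pos: "0 < block_scale k b"
  by (simp add: block_scale_def)

lemma prod_block_scale:
  fixes k :: "'n::finite \<Rightarrow> nat"
  shows "(\<Prod>b\<in>Basis. block_scale k b) = 2 powr real (CARD('n) + (\<Sum>i\<in>UNIV. k i))"
proof -
  have "(\<Prod>b\<in>Basis. block_scale k b) = (\<Prod>i\<in>UNIV. 2 ^ Suc (k i))"
    by (simp add: prod_Basis_cart block_scale_axis)
  also have "\<dots> = 2 ^ (\<Sum>i\<in>UNIV. Suc (k i))"
    by (simp only: power_sum)
  also have "(\<Sum>i\<in>UNIV. Suc (k i)) = CARD('n) + (\<Sum>i\<in>UNIV. k i)"
    by (simp only: Suc_eq_plus1_left sum.distrib) simp
  finally show ?thesis by (simp only: powr_realpow zero_less_numeral)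
qed

text \<open>All blocks use dilates of one cutoff \<nu>. Dilating it to the box of block k keeps the
  L1 norm of its kernel and multiplies the supremum by P = 2^(n + |k|), so Z depends neither on f
  nor on k.\<close>

lemma block_Lp_bound:
  fixes \<phi>0 :: "real \<Rightarrow> real"
  assumes \<phi>0: "admissible_1d \<phi>0" and p: "0 < p" "p \<le> p0"
  shows "\<exists>Z\<ge>0. \<forall>(f :: (real ^ 'n::finite \<Rightarrow> complex) \<Rightarrow> complex) k. tempered f \<longrightarrow>
    Lp_norm p0 (fourier_mult (phi_multi \<phi>0 k) f) \<le>
      ennreal (Z * 2 powr (real (CARD('n) + (\<Sum>i\<in>UNIV. k i)) * (1 / enn2real p - 1 / enn2real p0))) *
      Lp_norm p (fourier_mult (phi_multi \<phi>0 k) f)"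
proof (cases "p = \<infinity>")
  case True
  with p have "p0 = \<infinity>" by (simp add: top_unique)
  with True show ?thesis by (intro exI[of _ 1]) simp
next
  case False
  define r r0 where "r = enn2real p" and "r0 = enn2real p0"
  have r: "0 < r" unfolding r_def by (rule enn2real_pos[OF p(1) False])
  define \<nu> :: "real ^ 'n \<Rightarrow> real" where "\<nu> = phi_multi \<phi>0 (\<lambda>_. 0)"
  have \<nu>: "cutoff \<nu>" unfolding \<nu>_def by (rule cutoff_phi_multi[OF \<phi>0])
  define c where "c = schwartz_seminorm 0 [] (\<lambda>u. mult_kernel \<nu> (- u)) + 1"
  have c: "0 < c" "norm (mult_kernel \<nu> u) \<le> c" for u
    using schwartz_seminorm_nonneg[OF mult_kernel_uminus_schwartz[OF \<nu>], of "[]" 0]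
      schwartz_bound[OF mult_kernel_uminus_schwartz[OF \<nu>], of "[]" "- u" 0] by (simp_all add: c_def)
  define l where "l = (\<integral>u. norm (mult_kernel \<nu> u) \<partial>lborel) + 1"
  have l: "0 < l" by (simp add: l_def add_nonneg_pos)
  define Z where "Z = (l * c powr (1 / r)) powr (1 - r / r0)"
  have "Lp_norm p0 (fourier_mult (phi_multi \<phi>0 k) f) \<le>
      ennreal (Z * 2 powr (real (CARD('n) + (\<Sum>i\<in>UNIV. k i)) * (1 / r - 1 / r0))) *
      Lp_norm p (fourier_mult (phi_multi \<phi>0 k) f)"
    if f: "tempered f" for f :: "(real ^ 'n \<Rightarrow> complex) \<Rightarrow> complex" and k
  proof -
    let ?m = "phi_multi \<phi>0 k" and ?d = "block_scale k" and ?e = "\<lambda>b. 1 / block_scale k b"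
    have m: "cutoff ?m" by (rule cutoff_phi_multi[OF \<phi>0])
    define P where "P = 2 powr real (CARD('n) + (\<Sum>i\<in>UNIV. k i))"
    have P: "0 < P" "(\<Prod>b\<in>Basis. ?d b) = P" by (simp_all add: P_def prod_block_scale)
    \<comment> \<open>Block k reaches out to 3/2 * 2^(k i) in direction i, which exceeds 2^(k i) but
      not 2 * 2^(k i). The extra factor 2 in \<open>block_scale\<close> thus puts the whole block
      where the dilated cutoff is 1.\<close>
    define \<nu>' where "\<nu>' \<xi> = \<nu> (dilation ?e \<xi>)" for \<xi>
    have coord: "dilation ?e \<xi> $ i = 1 / (2 * 2 ^ k i) * \<xi> $ i" for \<xi> i
      using dilation_inner_Basis[of "axis i 1" ?e \<xi>] by (simp add: inner_axis block_scale_axis)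
    have \<nu>': "cutoff \<nu>'"
    proof -
      have "cutoff (\<lambda>\<xi>::real^'n. \<Prod>i\<in>UNIV. \<phi>0 (1 / (2 * 2 ^ k i) * \<xi> $ i))"
      proof (rule cutoff_prod)
        show "smooth (\<lambda>s. \<phi>0 (1 / (2 * 2 ^ k i) * s))" for i
          using smooth_scale[OF smooth_\<phi>0[OF \<phi>0], of "1 / (2 * 2 ^ k i)"] by simp
        fix i :: 'n and s :: real
        assume s: "3 * 2 ^ (\<Sum>i\<in>UNIV. k i) < \<bar>s\<bar>"
        have "(2::real) ^ k i \<le> 2 ^ (\<Sum>i\<in>UNIV. k i)"
          by (intro power_increasing member_le_sum) auto
        with s have "3 * 2 ^ k i < \<bar>s\<bar>" by linarith
        then show "\<phi>0 (1 / (2 * 2 ^ k i) * s) = 0" by (intro \<phi>0_eq_0[OF \<phi>0]) (simp add: abs_mult field_simps)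
      qed
      moreover have "\<nu>' = (\<lambda>\<xi>. \<Prod>i\<in>UNIV. \<phi>0 (1 / (2 * 2 ^ k i) * \<xi> $ i))"
        by (simp add: \<nu>'_def \<nu>_def phi_multi_def phi_j_def coord fun_eq_iff)
      ultimately show ?thesis by simp
    qed
    have absorb: "\<nu>' \<xi> * ?m \<xi> = ?m \<xi>" for \<xi>
    proof (cases "?m \<xi> = 0")
      case False
      have "\<bar>dilation ?e \<xi> $ i\<bar> \<le> 1" for i
      proof -
        have "phi_j \<phi>0 (k i) (\<xi> $ i) \<noteq> 0" using False by (auto simp: phi_multi_def)
        then have "\<bar>\<xi> $ i\<bar> \<le> 3 / 2 * 2 ^ k i" using phi_j_eq_0_outside[OF \<phi>0] by (meson not_less)
        then have "\<bar>\<xi> $ i\<bar> \<le> 2 * 2 ^ k i" using zero_le_power[of "2::real" "k i"] by linarith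
        then show ?thesis unfolding coord by (simp add: abs_mult divide_le_eq)
      qed
      then show ?thesis using phi_multi_unit_cube[OF \<phi>0, of "dilation ?e \<xi>"] by (simp add: \<nu>'_def \<nu>_def)
    qed simp
    have kernel: "mult_kernel \<nu>' u = of_real P * mult_kernel \<nu> (dilation ?d u)" for u
      unfolding \<nu>'_def P(2)[symmetric] using block_scale_pos
      by (intro mult_kernel_dilation[symmetric] borel_measurable_cutoff[OF \<nu>])
    have sup: "norm (mult_kernel \<nu>' u) \<le> P * c" for u
      unfolding kernel norm_mult using P(1) c(2) by (simp add: mult_left_mono)
    have "(\<integral>u. norm (mult_kernel \<nu>' u) \<partial>lborel) + 1 = l"
    proof -
      have "(\<integral>u. norm (mult_kernel \<nu> u) \<partial>lborel) =
          (\<Prod>b\<in>Basis. \<bar>?d b\<bar>) *\<^sub>R (\<integral>u. norm (mult_kernel \<nu> (0 + dilation ?d u)) \<partial>lborel)"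
        using block_scale_pos[of k] borel_measurable_mult_kernel[OF \<nu>] by (intro integral_dilation) (auto simp: less_imp_neq[symmetric])
      moreover have "(\<Prod>b\<in>Basis. \<bar>?d b\<bar>) = P" using block_scale_pos[of k] by (simp add: P(2)[symmetric] abs_of_pos)
      ultimately show ?thesis using P(1) by (simp add: l_def kernel norm_mult)
    qed
    then have "norm (fourier_mult ?m f x) \<le> l * ((P * c) powr (1 / r) * \<sigma>)"
      if "0 < \<sigma>" "(\<integral>\<^sup>+z. ennreal (norm (fourier_mult ?m f z) powr r) \<partial>lborel) \<le> ennreal (\<sigma> powr r)" for \<sigma> x
      using fourier_mult_sup_bound[OF f m \<nu>' absorb mult_pos_pos[OF P(1) c(1)] sup r that] by simp
    then have "Lp_norm p0 (fourier_mult ?m f) \<le>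
        ennreal ((l * (P * c) powr (1 / r)) powr (1 - enn2real p / enn2real p0)) * Lp_norm p (fourier_mult ?m f)"
      using l P(1) c(1) p False
      by (intro Lp_norm_le_of_sup_bound borel_measurable_continuous_onI[OF continuous_on_fourier_mult[OF f m]])
         (auto simp: r_def mult.assoc)
    also have "(l * (P * c) powr (1 / r)) powr (1 - enn2real p / enn2real p0) =
        Z * 2 powr (real (CARD('n) + (\<Sum>i\<in>UNIV. k i)) * (1 / r - 1 / r0))"
    proof -
      \<comment> \<open>The supremum bound carries P^(1/p), and the interpolation exponent 1 - p/p0
        turns it into P^(1/p - 1/p0).\<close>
      have "(l * (P * c) powr (1 / r)) powr (1 - r / r0) = Z * P powr (1 / r * (1 - r / r0))"
        using l P(1) c(1) by (simp add: Z_def powr_mult powr_powr)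
      also have "1 / r * (1 - r / r0) = 1 / r - 1 / r0" using r by (simp add: right_diff_distrib)
      finally show ?thesis by (simp only: P_def powr_powr r_def r0_def)
    qed
    finally show ?thesis .
  qed
  moreover have "0 \<le> Z" by (simp add: Z_def)
  ultimately show ?thesis unfolding r_def r0_def by blast
qed

section \<open>Lacunary test functions\<close>

definition lacunary_symbol :: "(real \<Rightarrow> real) \<Rightarrow> (nat \<Rightarrow> real) \<Rightarrow> nat set \<Rightarrow> real ^ 'n::finite \<Rightarrow> real" where
  "lacunary_symbol \<phi>0 a F \<xi> = (\<Sum>m\<in>F. a m * bump \<phi>0 ((1 / 2 ^ m) *\<^sub>R \<xi>))"

lemma cutoff_lacunary_symbol:
  assumes \<phi>0: "admissible_1d \<phi>0" and F: "finite F"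
  shows "cutoff (lacunary_symbol \<phi>0 a F :: real ^ 'n::finite \<Rightarrow> real)"
  using F
proof (induction F)
  case empty
  have "cutoff (\<lambda>\<xi>::real^'n. 0)" by (rule cutoffI[OF smooth_const]) simp
  then show ?case by (simp add: lacunary_symbol_def)
next
  case (insert m F)
  let ?u = "\<lambda>\<xi>::real^'n. complex_of_real (a m * bump \<phi>0 ((1 / 2 ^ m) *\<^sub>R \<xi>))"
  let ?v = "\<lambda>\<xi>::real^'n. complex_of_real (lacunary_symbol \<phi>0 a F \<xi>)"
  have u: "?u \<in> test_functions"
    using test_functions_mult[OF smooth_const[of "complex_of_real (a m)"] cutoff_bump_scale[OF \<phi>0, of "2 ^ m"]] by simp
  obtain R R' where R: "\<And>x. R < norm x \<Longrightarrow> ?u x = 0" "\<And>x. R' < norm x \<Longrightarrow> ?v x = 0"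
    using u insert.IH unfolding test_functions_def by blast
  have "(\<lambda>\<xi>. ?u \<xi> + ?v \<xi>) \<in> test_functions"
  proof (rule test_functionsI[where R = "max R R'"])
    show "smooth (\<lambda>\<xi>. ?u \<xi> + ?v \<xi>)"
      by (rule smooth_add[OF test_functions_smooth[OF u] test_functions_smooth[OF insert.IH]])
    show "?u x + ?v x = 0" if "max R R' < norm x" for x
      using R(1)[of x] R(2)[of x] that by simp
  qed
  then show ?case using insert by (simp add: lacunary_symbol_def)
qed

text \<open>Stated for any w that is 0 or 1 on each bump, so as to serve both resolutions of unity.
  An m0 outside F expresses that w annihilates the whole sum.\<close>

lemma lacunary_symbol_mult:
  assumes F: "finite F"
    and c: "\<And>m \<xi>. m \<in> F \<Longrightarrow> bump \<phi>0 ((1 / 2 ^ m) *\<^sub>R \<xi>) \<noteq> 0 \<Longrightarrow> w \<xi> = (if m = m0 then 1 else 0)"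
  shows "w \<xi> * lacunary_symbol \<phi>0 a F \<xi> = (if m0 \<in> F then a m0 * bump \<phi>0 ((1 / 2 ^ m0) *\<^sub>R \<xi>) else 0)"
proof -
  have "w \<xi> * lacunary_symbol \<phi>0 a F \<xi> = (\<Sum>m\<in>F. if m = m0 then a m * bump \<phi>0 ((1 / 2 ^ m) *\<^sub>R \<xi>) else 0)"
    unfolding lacunary_symbol_def sum_distrib_left
  proof (rule sum.cong[OF refl])
    fix m assume "m \<in> F"
    then show "w \<xi> * (a m * bump \<phi>0 ((1 / 2 ^ m) *\<^sub>R \<xi>)) = (if m = m0 then a m * bump \<phi>0 ((1 / 2 ^ m) *\<^sub>R \<xi>) else 0)"
      using c[of m \<xi>] by (cases "bump \<phi>0 ((1 / 2 ^ m) *\<^sub>R \<xi>) = 0") auto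
  qed
  then show ?thesis using F by (simp add: sum.delta)
qed

text \<open>The kernel of the dilated bump is P = 2^(x n) times a dilate of the original kernel, and
  the dilation costs P^(-1/p). The exponent x is real because negative values give the low-frequency
  tests.\<close>

lemma Lp_norm_bump_scale:
  fixes \<phi>0 :: "real \<Rightarrow> real"
  assumes \<phi>0: "admissible_1d \<phi>0" and p: "0 < p" and a: "0 < a"
  shows "Lp_norm p (mult_kernel (\<lambda>\<xi>::real^'n::finite. a * bump \<phi>0 ((1 / 2 powr x) *\<^sub>R \<xi>))) =
    ennreal (a * 2 powr (x * real CARD('n) * (1 - 1 / enn2real p))) * Lp_norm p (mult_kernel (bump \<phi>0 :: real ^ 'n \<Rightarrow> real))"
proof -
  let ?\<beta> = "bump \<phi>0 :: real ^ 'n \<Rightarrow> real" and ?d = "\<lambda>_::real^'n. 2 powr x"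
  define P where "P = (2 powr x) ^ CARD('n)"
  have P: "(\<Prod>b\<in>Basis. ?d b) = P" "0 < P" by (simp_all add: P_def)
  have cut: "cutoff ?\<beta>" using cutoff_bump_scale[OF \<phi>0, of 1] by simp
  note [measurable] = borel_measurable_mult_kernel[OF cut]
  have "mult_kernel (\<lambda>\<xi>. a * ?\<beta> ((1 / 2 powr x) *\<^sub>R \<xi>)) u = of_real (a * P) * mult_kernel ?\<beta> (dilation ?d u)" for u
    using mult_kernel_dilation[of ?d ?\<beta> u, OF _ borel_measurable_cutoff[OF cut]]
      mult_kernel_cmult[of a "\<lambda>\<xi>. ?\<beta> ((1 / 2 powr x) *\<^sub>R \<xi>)" u]
    unfolding P(1) by (simp add: dilation_const)
  then have "Lp_norm p (mult_kernel (\<lambda>\<xi>. a * ?\<beta> ((1 / 2 powr x) *\<^sub>R \<xi>))) =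
      Lp_norm p (\<lambda>u. of_real (a * P) * mult_kernel ?\<beta> (dilation ?d u))"
    by (intro arg_cong[where f = "Lp_norm p"] ext)
  also have "\<dots> = ennreal (a * P) * Lp_norm p (\<lambda>u. mult_kernel ?\<beta> (dilation ?d u))"
    using a P p by (intro Lp_norm_cmult) auto
  also have "\<dots> = ennreal (a * P) * (ennreal (P powr (- 1 / enn2real p)) * Lp_norm p (mult_kernel ?\<beta>))"
    using Lp_norm_dilation[where d = ?d and g = "mult_kernel ?\<beta>", OF _ p] unfolding P(1) by simp
  also have "\<dots> = ennreal (a * (P * P powr (- 1 / enn2real p))) * Lp_norm p (mult_kernel ?\<beta>)"
    using a P(2) by (simp add: mult.assoc[symmetric] ennreal_mult[symmetric])
  also have "P * P powr (- 1 / enn2real p) = 2 powr (x * real CARD('n) * (1 - 1 / enn2real p))"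
  proof -
    have "P = 2 powr (x * real CARD('n))"
      by (simp add: P_def powr_powr flip: powr_realpow)
    then show ?thesis by (simp add: powr_powr right_diff_distrib flip: powr_add)
  qed
  finally show ?thesis .
qed

text \<open>Only block zero, with weight 1, meets a spectrum in the unit cube, so neither the
  smoothness nor the summation exponent leaves a trace in the norms.\<close>

lemma
  fixes \<psi>0 :: "real ^ 'n::finite \<Rightarrow> real"
  assumes \<phi>0: "admissible_1d \<phi>0" and g: "cutoff g" and supp: "\<forall>\<xi>. g \<xi> \<noteq> 0 \<longrightarrow> (\<forall>i. \<bar>\<xi> $ i\<bar> \<le> 1)" and q: "0 < q"
  shows besov_norm_low_frequency: "admissible_iso \<psi>0 \<Longrightarrow> besov_norm \<psi>0 s p q (band g dirac) = Lp_norm p (mult_kernel g)"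
    and mixed_norm_low_frequency: "mixed_norm \<phi>0 s p q (band g dirac) = Lp_norm p (mult_kernel g)"
proof -
  have mult: "fourier_mult w (band g dirac) = (if c then mult_kernel g else (\<lambda>x. 0))"
    if w: "cutoff w" and c: "\<And>\<xi>. (\<And>i. \<bar>\<xi> $ i\<bar> \<le> 1) \<Longrightarrow> w \<xi> = (if c then 1 else 0)" for w c
  proof -
    have "w \<xi> * g \<xi> = (if c then g \<xi> else 0)" for \<xi>
      using c[of \<xi>] supp by (cases "g \<xi> = 0") auto
    then have "(\<lambda>\<xi>. w \<xi> * g \<xi>) = (if c then g else (\<lambda>\<xi>. 0))" by auto
    then show ?thesis
      unfolding fourier_mult_band[OF g w] fourier_mult_dirac by (simp add: mult_kernel_zero)
  qed
  show "besov_norm \<psi>0 s p q (band g dirac) = Lp_norm p (mult_kernel g)" if \<psi>0: "admissible_iso \<psi>0"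
  proof -
    have "fourier_mult (psi_j \<psi>0 j) (band g dirac) = (if j = 0 then mult_kernel g else (\<lambda>x. 0))" for j
      by (intro mult cutoff_psi_j[OF \<psi>0] psi_j_unit_cube[OF \<psi>0]) auto
    then show ?thesis
      unfolding besov_norm_def by (subst lq_norm_single[OF q, of 0]) (simp_all add: Lp_norm_zero)
  qed
  have "fourier_mult (phi_multi \<phi>0 k) (band g dirac) = (if k = (\<lambda>_. 0) then mult_kernel g else (\<lambda>x. 0))" for k
    by (intro mult cutoff_phi_multi[OF \<phi>0] phi_multi_unit_cube[OF \<phi>0]) auto
  then show "mixed_norm \<phi>0 s p q (band g dirac) = Lp_norm p (mult_kernel g)"
    unfolding mixed_norm_def by (subst lq_norm_single[OF q, of "\<lambda>_. 0"]) (simp_all add: Lp_norm_zero)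
qed

text \<open>The bump at scale m is seen only by the isotropic block m and by the mixed block
  (m,...,m), whose order is m n; this is where t n on one side meets t on the other. In the mixed
  norm m is read off a constant multi-index k as \<open>k undefined\<close>.\<close>

lemma
  fixes \<psi>0 :: "real ^ 'n::finite \<Rightarrow> real" and a :: "nat \<Rightarrow> real"
  assumes \<phi>0: "admissible_1d \<phi>0" and F: "finite F" "0 \<notin> F" and a: "\<And>m. 0 < a m" and p: "0 < p" and q: "0 < q"
  defines "h \<equiv> band (lacunary_symbol \<phi>0 a F :: real ^ 'n \<Rightarrow> real) dirac"
    and "A \<equiv> Lp_norm p (mult_kernel (bump \<phi>0 :: real ^ 'n \<Rightarrow> real))"
    and "\<kappa> \<equiv> 1 - 1 / enn2real p"
  shows besov_norm_lacunary: "admissible_iso \<psi>0 \<Longrightarrow> besov_norm \<psi>0 (t * real CARD('n)) p q h =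
      lq_norm q (\<lambda>j. if j \<in> F then ennreal (a j * 2 powr (real (j * CARD('n)) * (t + \<kappa>))) * A else 0)"
    and mixed_norm_lacunary: "mixed_norm \<phi>0 t p q h =
      lq_norm q (\<lambda>k::'n \<Rightarrow> nat. if k \<in> (\<lambda>m _. m) ` F then ennreal (a (k undefined) * 2 powr (real (k undefined * CARD('n)) * (t + \<kappa>))) * A else 0)"
proof -
  have g: "cutoff (lacunary_symbol \<phi>0 a F :: real ^ 'n \<Rightarrow> real)" by (rule cutoff_lacunary_symbol[OF \<phi>0 F(1)])
  have pos: "0 < m" if "m \<in> F" for m using that F by (cases m) auto
  have Lp: "Lp_norm p (fourier_mult w h) =
      (if m \<in> F then ennreal (a m * 2 powr (real (m * CARD('n)) * \<kappa>)) * A else 0)"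
    if "cutoff w" and w: "\<And>m' \<xi>. m' \<in> F \<Longrightarrow> bump \<phi>0 ((1 / 2 ^ m') *\<^sub>R \<xi>) \<noteq> 0 \<Longrightarrow> w \<xi> = (if m' = m then 1 else 0)"
    for w :: "real ^ 'n \<Rightarrow> real" and m
  proof -
    have "fourier_mult w h = mult_kernel (\<lambda>\<xi>. w \<xi> * lacunary_symbol \<phi>0 a F \<xi>)"
      unfolding h_def fourier_mult_band[OF g \<open>cutoff w\<close>] fourier_mult_dirac ..
    also have "(\<lambda>\<xi>. w \<xi> * lacunary_symbol \<phi>0 a F \<xi>) = (\<lambda>\<xi>. if m \<in> F then a m * bump \<phi>0 ((1 / 2 ^ m) *\<^sub>R \<xi>) else 0)"
      by (intro ext lacunary_symbol_mult[OF F(1)] w)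
    finally show ?thesis
      using Lp_norm_bump_scale[OF \<phi>0 p a[of m], of "real m", where 'n = 'n]
      by (cases "m \<in> F") (simp_all add: mult_kernel_zero Lp_norm_zero A_def \<kappa>_def powr_realpow)
  qed
  have comb: "ennreal (2 powr x) * (ennreal (a m * 2 powr y) * A) = ennreal (a m * 2 powr (x + y)) * A" for m x y
    using a[of m] by (simp add: ennreal_mult powr_add less_imp_le mult_ac)
  show "besov_norm \<psi>0 (t * real CARD('n)) p q h =
      lq_norm q (\<lambda>j. if j \<in> F then ennreal (a j * 2 powr (real (j * CARD('n)) * (t + \<kappa>))) * A else 0)"
    if \<psi>0: "admissible_iso \<psi>0"
  proof -
    have "Lp_norm p (fourier_mult (psi_j \<psi>0 j) h) =
        (if j \<in> F then ennreal (a j * 2 powr (real (j * CARD('n)) * \<kappa>)) * A else 0)" for j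
      by (rule Lp[OF cutoff_psi_j[OF \<psi>0]]) (use psi_j_bump[OF \<psi>0 \<phi>0 pos] in auto)
    note Lpj = this
    have e: "real j * (t * real CARD('n)) + real (j * CARD('n)) * \<kappa> = real (j * CARD('n)) * (t + \<kappa>)" for j
      by (simp add: algebra_simps)
    show ?thesis
      unfolding besov_norm_def Lpj
      by (intro arg_cong[where f = "lq_norm q"] ext) (simp only: comb e mult_zero_right split: if_split, simp)
  qed
  show "mixed_norm \<phi>0 t p q h =
      lq_norm q (\<lambda>k::'n \<Rightarrow> nat. if k \<in> (\<lambda>m _. m) ` F then ennreal (a (k undefined) * 2 powr (real (k undefined * CARD('n)) * (t + \<kappa>))) * A else 0)"
    unfolding mixed_norm_def
  proof (intro arg_cong[where f = "lq_norm q"] ext)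
    fix k :: "'n \<Rightarrow> nat"
    have Lpk: "Lp_norm p (fourier_mult (phi_multi \<phi>0 k) h) =
        (if m \<in> F then ennreal (a m * 2 powr (real (m * CARD('n)) * \<kappa>)) * A else 0)"
      if "\<And>m'. m' \<in> F \<Longrightarrow> k = (\<lambda>_. m') \<longleftrightarrow> m' = m" for m
    proof (rule Lp[OF cutoff_phi_multi[OF \<phi>0]])
      fix m' and \<xi> :: "real ^ 'n" assume "m' \<in> F" "bump \<phi>0 ((1 / 2 ^ m') *\<^sub>R \<xi>) \<noteq> 0"
      then show "phi_multi \<phi>0 k \<xi> = (if m' = m then 1 else 0)"
        using phi_multi_bump[OF \<phi>0 pos, of m' \<xi> k] that[of m'] by simp
    qed
    show "ennreal (2 powr (real (\<Sum>i\<in>UNIV. k i) * t)) * Lp_norm p (fourier_mult (phi_multi \<phi>0 k) h) =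
        (if k \<in> (\<lambda>m _. m) ` F then ennreal (a (k undefined) * 2 powr (real (k undefined * CARD('n)) * (t + \<kappa>))) * A else 0)"
    proof (cases "k \<in> (\<lambda>m _. m) ` F")
      case True
      then obtain m where m: "m \<in> F" "k = (\<lambda>_. m)" by blast
      have e: "real (\<Sum>i\<in>UNIV. k i) * t + real (m * CARD('n)) * \<kappa> = real (m * CARD('n)) * (t + \<kappa>)"
        by (simp add: m(2) algebra_simps)
      have "Lp_norm p (fourier_mult (phi_multi \<phi>0 k) h) = ennreal (a m * 2 powr (real (m * CARD('n)) * \<kappa>)) * A"
      proof (subst Lpk[of m])
        show "k = (\<lambda>_. m') \<longleftrightarrow> m' = m" for m' using m(2) by (auto simp: fun_eq_iff)
      qed (use m(1) in simp)
      with True show ?thesis by (simp only: comb e if_True) (simp add: m(2))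
    next
      case False
      \<comment> \<open>For k off the diagonal of F every bump is annihilated; \<open>Lpk\<close>
        expresses this through an index outside F.\<close>
      obtain m where m: "m \<notin> F" using ex_new_if_finite[OF infinite_UNIV_nat F(1)] by blast
      then show ?thesis using False Lpk[of m] by auto
    qed
  qed
qed

lemma lq_norm_const:
  assumes q: "0 < q" and F: "finite F" "F \<noteq> {}"
  shows "lq_norm q (\<lambda>i. if i \<in> F then a else 0) = ennreal (real (card F) powr (1 / enn2real q)) * a"
proof (cases "q = \<infinity>")
  case True
  obtain i0 where "i0 \<in> F" using F by blast
  then have "(SUP i. if i \<in> F then a else 0) = a"
    by (intro antisym SUP_least SUP_upper2[of i0 UNIV]) auto
  moreover have "card F \<noteq> 0" using F by simp
  ultimately show ?thesis by (simp add: True lq_norm_infinity[simplified])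
next
  case False
  then have r: "0 < enn2real q" using q enn2real_pos by blast
  have "lq_norm q (\<lambda>i. if i \<in> F then a else 0) = ennpow (ennreal (real (card F)) * ennpow a (enn2real q)) (1 / enn2real q)"
    using lq_norm_sum[OF q False F(1), of "\<lambda>i. if i \<in> F then a else 0"] by (simp add: ennreal_of_nat_eq_real_of_nat)
  then show ?thesis using r by (simp add: ennpow_cmult ennpow_inverse)
qed

section \<open>Necessary conditions and the theorem\<close>

lemma embedding_lacunary:
  fixes \<psi>0 :: "real ^ 'n::finite \<Rightarrow> real"
  assumes \<psi>0: "admissible_iso \<psi>0" and \<phi>0: "admissible_1d \<phi>0"
    and pos: "0 < p" "0 < q" "0 < p0" "0 < q0"
    and C: "\<forall>f\<in>besov \<psi>0 (t * real CARD('n)) p q.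
      mixed_norm \<phi>0 t0 p0 q0 f \<le> ennreal C * besov_norm \<psi>0 (t * real CARD('n)) p q f"
    and F: "finite F" "0 \<notin> F" "F \<noteq> {}"
  defines "\<delta> \<equiv> (t - 1 / enn2real p) - (t0 - 1 / enn2real p0)"
    and "K \<equiv> mult_kernel (bump \<phi>0 :: real ^ 'n \<Rightarrow> real)"
  shows "lq_norm q0 (\<lambda>k::'n \<Rightarrow> nat. if k \<in> (\<lambda>m _. m) ` F then ennreal (2 powr (- \<delta> * real (k undefined * CARD('n)))) * Lp_norm p0 K else 0)
    \<le> ennreal C * (ennreal (real (card F) powr (1 / enn2real q)) * Lp_norm p K)"
proof -
  \<comment> \<open>The reciprocal of the weight 2^(m n t) times the L_p scaling 2^(m n (1 - 1/p))
    of the bump, so that each Besov term is the norm of the undilated kernel. In the mixed norm the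
    exponent -\<delta> m n remains.\<close>
  define a where "a m = 2 powr (- real (m * CARD('n)) * (t + (1 - 1 / enn2real p)))" for m
  define h where "h = band (lacunary_symbol \<phi>0 a F :: real ^ 'n \<Rightarrow> real) dirac"
  have a: "0 < a m" for m by (simp add: a_def)
  have cut: "cutoff (bump \<phi>0 :: real ^ 'n \<Rightarrow> real)" using cutoff_bump_scale[OF \<phi>0, of 1] by simp
  have "besov_norm \<psi>0 (t * real CARD('n)) p q h = lq_norm q (\<lambda>j. if j \<in> F then Lp_norm p K else 0)"
    unfolding h_def besov_norm_lacunary[OF \<phi>0 F(1,2) a pos(1,2) \<psi>0] K_def[symmetric]
    by (intro arg_cong[where f = "lq_norm q"] ext) (simp add: a_def flip: powr_add)
  then have b: "besov_norm \<psi>0 (t * real CARD('n)) p q h = ennreal (real (card F) powr (1 / enn2real q)) * Lp_norm p K"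
    by (simp add: lq_norm_const[OF pos(2) F(1,3)])
  have "tempered h"
    unfolding h_def by (intro tempered_band tempered_dirac cutoff_lacunary_symbol[OF \<phi>0 F(1)])
  moreover have "besov_norm \<psi>0 (t * real CARD('n)) p q h < \<infinity>"
    unfolding b K_def using Lp_norm_mult_kernel_finite[OF cut pos(1)] by (simp add: ennreal_mult_less_top)
  ultimately have "mixed_norm \<phi>0 t0 p0 q0 h \<le> ennreal C * besov_norm \<psi>0 (t * real CARD('n)) p q h"
    by (intro C[rule_format]) (simp add: besov_def)
  moreover have "mixed_norm \<phi>0 t0 p0 q0 h = lq_norm q0 (\<lambda>k::'n \<Rightarrow> nat. if k \<in> (\<lambda>m _. m) ` F
      then ennreal (2 powr (- \<delta> * real (k undefined * CARD('n)))) * Lp_norm p0 K else 0)"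
    unfolding h_def mixed_norm_lacunary[OF \<phi>0 F(1,2) a pos(3,4)] K_def[symmetric]
    by (intro arg_cong[where f = "lq_norm q0"] ext) (simp add: a_def \<delta>_def algebra_simps flip: powr_add)
  ultimately show ?thesis by (simp add: b)
qed

lemma dyadic_growth:
  assumes "\<And>m::nat. 0 < m \<Longrightarrow> 2 powr (x * real m) \<le> B" shows "x \<le> 0"
proof (rule ccontr)
  assume "\<not> x \<le> 0"
  then have y: "1 < 2 powr x" by (auto intro!: gr_one_powr)
  then obtain m where "B < (2 powr x) ^ m" using real_arch_pow by blast
  also have "\<dots> \<le> (2 powr x) ^ Suc m" using y by (intro power_increasing) auto
  also have "\<dots> = 2 powr (x * real (Suc m))" by (simp only: powr_powr[symmetric] powr_realpow powr_gt_zero)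
  finally show False using assms[of "Suc m"] by simp
qed

lemma embedding_necessary:
  fixes \<psi>0 :: "real ^ 'n::finite \<Rightarrow> real"
  assumes \<psi>0: "admissible_iso \<psi>0" and \<phi>0: "admissible_1d \<phi>0"
    and pos: "0 < p" "0 < q" "0 < p0" "0 < q0"
    and C: "\<forall>f\<in>besov \<psi>0 (t * real CARD('n)) p q.
      mixed_norm \<phi>0 t0 p0 q0 f \<le> ennreal C * besov_norm \<psi>0 (t * real CARD('n)) p q f"
  defines "\<delta> \<equiv> (t - 1 / enn2real p) - (t0 - 1 / enn2real p0)"
  shows "p \<le> p0" and "0 < \<delta> \<or> \<delta> = 0 \<and> q \<le> q0"
proof -
  let ?K = "mult_kernel (bump \<phi>0 :: real ^ 'n \<Rightarrow> real)"
  have cut: "cutoff (bump \<phi>0 :: real ^ 'n \<Rightarrow> real)" using cutoff_bump_scale[OF \<phi>0, of 1] by simp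
  have "bump \<phi>0 ((\<chi> i. 7 / 8) :: real ^ 'n) \<noteq> 0" by (simp add: bump_center[OF \<phi>0])
  then have A: "0 < Lp_norm r ?K" "Lp_norm r ?K < \<infinity>" if "0 < r" for r
    using Lp_norm_mult_kernel_pos[OF cut _ that] Lp_norm_mult_kernel_finite[OF cut that] by auto
  obtain \<alpha> where \<alpha>: "Lp_norm p ?K = ennreal \<alpha>" "0 < \<alpha>"
    using A[OF pos(1)] by (cases "Lp_norm p ?K") auto
  obtain \<alpha>0 where \<alpha>0: "Lp_norm p0 ?K = ennreal \<alpha>0" "0 < \<alpha>0"
    using A[OF pos(3)] by (cases "Lp_norm p0 ?K") auto
  define B where "B = max C 0 * \<alpha> / \<alpha>0"
  \<comment> \<open>The constant of an embedding may be negative as a real; \<open>ennreal\<close>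
    sends it to 0.\<close>
  have C0: "ennreal C = ennreal (max C 0)" by (simp add: max_def ennreal_neg)
  note test = embedding_lacunary[OF \<psi>0 \<phi>0 pos C, folded \<delta>_def, unfolded \<alpha> \<alpha>0 C0]
  have "1 / enn2real p0 \<le> 1 / enn2real p"
  proof -
    have "2 powr (real CARD('n) * (1 / enn2real p0 - 1 / enn2real p) * real m) \<le> B" for m
    proof -
      let ?g = "\<lambda>\<xi>::real^'n. 1 * bump \<phi>0 ((1 / 2 powr (- real m)) *\<^sub>R \<xi>)"
      \<comment> \<open>The volume factor of the shrunken spectrum. The two norms scale as y^(1 -
        1/p0) and y^(1 - 1/p), and their quotient is the dyadic power z below, which must stay
        bounded as m grows.\<close>
      define y where "y = 2 powr (- real m * real CARD('n))"
      have g: "cutoff ?g" using cutoff_bump_scale[OF \<phi>0, of "2 powr (- real m)"] by simp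
      have supp: "\<forall>\<xi>. ?g \<xi> \<noteq> 0 \<longrightarrow> (\<forall>i. \<bar>\<xi> $ i\<bar> \<le> 1)"
      proof (intro allI impI)
        fix \<xi> :: "real ^ 'n" and i assume g0: "?g \<xi> \<noteq> 0"
        have "3 / 4 * 2 powr (- real m) < \<xi> $ i" "\<xi> $ i \<le> 2 powr (- real m)"
          using g0 bump_support[OF \<phi>0, of "2 powr (- real m)" \<xi> i] by auto
        moreover have "2 powr (- real m) \<le> 1" using powr_mono[of "- real m" 0 2] by simp
        moreover have "0 \<le> 3 / 4 * 2 powr (- real m)" by simp
        ultimately show "\<bar>\<xi> $ i\<bar> \<le> 1" by linarith
      qed
      have Lp: "Lp_norm p' (mult_kernel ?g) = ennreal (y powr (1 - 1 / enn2real p')) * Lp_norm p' ?K" if "0 < p'" for p'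
        using Lp_norm_bump_scale[OF \<phi>0 that zero_less_one, of "- real m", where 'n = 'n] by (simp add: y_def powr_powr)
      have bn: "besov_norm \<psi>0 (t * real CARD('n)) p q (band ?g dirac) = ennreal (y powr (1 - 1 / enn2real p) * \<alpha>)"
        using besov_norm_low_frequency[OF \<phi>0 g supp pos(2) \<psi>0, of "t * real CARD('n)" p] \<alpha>(2)
        by (simp only: Lp[OF pos(1)] \<alpha>(1) ennreal_mult less_imp_le powr_ge_zero)
      have mn: "mixed_norm \<phi>0 t0 p0 q0 (band ?g dirac) = ennreal (y powr (1 - 1 / enn2real p0) * \<alpha>0)"
        using mixed_norm_low_frequency[OF \<phi>0 g supp pos(4), of t0 p0] \<alpha>0(2)
        by (simp only: Lp[OF pos(3)] \<alpha>0(1) ennreal_mult less_imp_le powr_ge_zero)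
      have "band ?g dirac \<in> besov \<psi>0 (t * real CARD('n)) p q"
        using tempered_band[OF tempered_dirac g] unfolding besov_def mem_Collect_eq bn by simp
      from C[rule_format, OF this]
      have "ennreal (y powr (1 - 1 / enn2real p0) * \<alpha>0) \<le> ennreal (max C 0 * (y powr (1 - 1 / enn2real p) * \<alpha>))"
        unfolding bn mn C0 using \<alpha>(2) by (simp add: ennreal_mult)
      then have le: "y powr (1 - 1 / enn2real p0) * \<alpha>0 \<le> max C 0 * (y powr (1 - 1 / enn2real p) * \<alpha>)"
        using \<alpha>(2) by (subst (asm) ennreal_le_iff) auto
      define z where "z = 2 powr (real CARD('n) * (1 / enn2real p0 - 1 / enn2real p) * real m)"
      have "y powr (1 - 1 / enn2real p0) = z * y powr (1 - 1 / enn2real p)"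
        by (simp add: y_def z_def powr_powr algebra_simps flip: powr_add)
      with le have "(z * \<alpha>0) * y powr (1 - 1 / enn2real p) \<le> (max C 0 * \<alpha>) * y powr (1 - 1 / enn2real p)"
        by (simp add: mult_ac)
      then have "z * \<alpha>0 \<le> max C 0 * \<alpha>" by (simp add: y_def)
      then show ?thesis using \<alpha>0(2) by (simp add: B_def z_def pos_le_divide_eq)
    qed
    from dyadic_growth[OF this] have "real CARD('n) * (1 / enn2real p0 - 1 / enn2real p) \<le> 0" .
    then show ?thesis by (simp add: mult_le_0_iff)
  qed
  then show "p \<le> p0"
  proof (cases "p0 = \<infinity>")
    case False
    have r0: "0 < enn2real p0" by (rule enn2real_pos[OF pos(3) False])
    assume le: "1 / enn2real p0 \<le> 1 / enn2real p"
    \<comment> \<open>As the reciprocal of infinity reads as 0, the order of reciprocals decides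
      only after p = infinity is excluded: p0 is finite, so both reciprocals are positive.\<close>
    then have "0 < 1 / enn2real p" using r0 by (meson less_le_trans zero_less_divide_1_iff)
    then have r: "0 < enn2real p" by simp
    have "enn2real p \<le> enn2real p0" using le r r0 by (simp add: field_simps)
    moreover have "p \<noteq> top" using r by auto
    ultimately show ?thesis using False by (cases p; cases p0) auto
  qed simp
  have \<delta>0: "0 \<le> \<delta>"
  proof -
    \<comment> \<open>A single bump: the Besov side does not depend on m, the mixed side carries
      2^(-\<delta> n m).\<close>
    have "2 powr (- \<delta> * real CARD('n) * real m) \<le> B" if m: "0 < m" for m
    proof -
      let ?u = "\<lambda>k::'n \<Rightarrow> nat. if k \<in> (\<lambda>m _. m) ` {m} then ennreal (2 powr (- \<delta> * real (k undefined * CARD('n)))) * ennreal \<alpha>0 else 0"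
      have "ennreal (2 powr (- \<delta> * real (m * CARD('n))) * \<alpha>0) = ?u (\<lambda>_. m)"
        using \<alpha>0(2) by (simp add: ennreal_mult)
      also have "\<dots> \<le> lq_norm q0 ?u" by (rule le_lq_norm[OF pos(4)])
      also have "\<dots> \<le> ennreal (max C 0) * (ennreal (real (card {m}) powr (1 / enn2real q)) * ennreal \<alpha>)"
        using m by (intro test) auto
      also have "\<dots> = ennreal (max C 0 * \<alpha>)" using \<alpha>(2) by (simp add: ennreal_mult)
      finally have "2 powr (- \<delta> * real (m * CARD('n))) * \<alpha>0 \<le> max C 0 * \<alpha>"
        using \<alpha>(2) by (subst (asm) ennreal_le_iff) auto
      then show ?thesis using \<alpha>0(2) by (simp add: B_def pos_le_divide_eq mult_ac)
    qed
    from dyadic_growth[OF this] have "- \<delta> * real CARD('n) \<le> 0" .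
    then show ?thesis by (simp add: zero_le_mult_iff)
  qed
  show "0 < \<delta> \<or> \<delta> = 0 \<and> q \<le> q0"
  proof (rule ccontr)
    assume "\<not> (0 < \<delta> \<or> \<delta> = 0 \<and> q \<le> q0)"
    with \<delta>0 have \<delta>: "\<delta> = 0" and q: "q0 < q" by auto
    have fin: "q0 \<noteq> \<infinity>" using q by auto
    have r0: "0 < enn2real q0" using enn2real_pos[OF pos(4) fin] .
    define \<epsilon> where "\<epsilon> = 1 / enn2real q0 - 1 / enn2real q"
    have \<epsilon>: "0 < \<epsilon>"
    proof (cases "q = \<infinity>")
      case True
      then show ?thesis using r0 by (simp add: \<epsilon>_def)
    next
      case False
      then have "enn2real q0 < enn2real q" using q fin by (cases q; cases q0) (auto simp: ennreal_less_iff)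
      then show ?thesis using r0 by (simp add: \<epsilon>_def frac_less2)
    qed
    \<comment> \<open>N bumps give N^(1/q0) on the mixed side against N^(1/q) on the Besov side,
      hence N^\<epsilon> <= B, which this N violates. Taking the maximum with 1 keeps the base
      positive, so that the powers invert.\<close>
    obtain N :: nat where N: "max B 1 powr (1 / \<epsilon>) < real N" using reals_Archimedean2 by blast
    have N0: "0 < N" using N by (cases N) (auto simp: not_less)
    \<comment> \<open>Scale 0 is left out: the lowest block functions are not differences of two
      dilates.\<close>
    define F where "F = {1..N}"
    have F: "finite F" "0 \<notin> F" "F \<noteq> {}" "card F = N" using N0 by (auto simp: F_def)
    have card: "card ((\<lambda>m _. m) ` F :: ('n \<Rightarrow> nat) set) = N"
      using F(4) by (subst card_image) (auto simp: inj_on_def fun_eq_iff)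
    have "ennreal (real N powr (1 / enn2real q0) * \<alpha>0) =
        lq_norm q0 (\<lambda>k::'n \<Rightarrow> nat. if k \<in> (\<lambda>m _. m) ` F then ennreal \<alpha>0 else 0)"
      using lq_norm_const[OF pos(4), of "(\<lambda>m _. m) ` F :: ('n \<Rightarrow> nat) set" "ennreal \<alpha>0"] F card \<alpha>0(2)
      by (simp add: ennreal_mult)
    also have "\<dots> \<le> ennreal (max C 0) * (ennreal (real (card F) powr (1 / enn2real q)) * ennreal \<alpha>)"
      using test[OF F(1-3)] by (simp add: \<delta> cong: if_cong)
    also have "\<dots> = ennreal (max C 0 * (real N powr (1 / enn2real q) * \<alpha>))"
      using \<alpha>(2) F(4) by (simp add: ennreal_mult)
    finally have le: "real N powr (1 / enn2real q0) * \<alpha>0 \<le> max C 0 * (real N powr (1 / enn2real q) * \<alpha>)"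
      using \<alpha>(2) by (subst (asm) ennreal_le_iff) auto
    have "real N powr (1 / enn2real q0) = real N powr \<epsilon> * real N powr (1 / enn2real q)"
      by (simp add: \<epsilon>_def flip: powr_add)
    with le have "(real N powr \<epsilon> * \<alpha>0) * real N powr (1 / enn2real q) \<le> (max C 0 * \<alpha>) * real N powr (1 / enn2real q)"
      by (simp add: mult_ac)
    then have "real N powr \<epsilon> \<le> B"
      using N0 \<alpha>0(2) by (simp add: B_def field_simps)
    moreover have "max B 1 < real N powr \<epsilon>"
    proof -
      have "(max B 1 powr (1 / \<epsilon>)) powr \<epsilon> < real N powr \<epsilon>"
        using N \<epsilon> by (intro powr_less_mono2) auto
      then show ?thesis using \<epsilon> by (simp add: powr_powr)
    qed
    ultimately show False by simp
  qed
qed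

section \<open>Sufficiency of the conditions\<close>

lemma embeds_mixed_besovI:
  assumes "\<And>f :: (real ^ 'n::finite \<Rightarrow> complex) \<Rightarrow> complex. f \<in> mixed_besov \<phi>0 t p q \<Longrightarrow> mixed_norm \<phi>0 t0 p0 q0 f \<le> ennreal K * mixed_norm \<phi>0 t p q f"
  shows "embeds (mixed_besov \<phi>0 t p q :: ((real ^ 'n \<Rightarrow> complex) \<Rightarrow> complex) set) (mixed_norm \<phi>0 t p q)
    (mixed_besov \<phi>0 t0 p0 q0) (mixed_norm \<phi>0 t0 p0 q0)"
proof -
  have "mixed_norm \<phi>0 t0 p0 q0 f < \<infinity>" if f: "f \<in> mixed_besov \<phi>0 t p q" for f :: "(real ^ 'n \<Rightarrow> complex) \<Rightarrow> complex"
    using f by (intro order_le_less_trans[OF assms[OF f]]) (simp add: mixed_besov_def ennreal_mult_less_top)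
  then have "(mixed_besov \<phi>0 t p q :: ((real ^ 'n \<Rightarrow> complex) \<Rightarrow> complex) set) \<subseteq> mixed_besov \<phi>0 t0 p0 q0" by (auto simp: mixed_besov_def)
  with assms show ?thesis unfolding embeds_def by blast
qed

theorem mixed_besov_embedding:
  fixes \<phi>0 :: "real \<Rightarrow> real" and p q p0 q0 :: ennreal and t t0 :: real
  defines "\<delta> \<equiv> (t - 1 / enn2real p) - (t0 - 1 / enn2real p0)"
  assumes \<phi>0: "admissible_1d \<phi>0" and p: "0 < p" "p \<le> p0" and q: "0 < q" "0 < q0"
    and cond: "0 < \<delta> \<or> \<delta> = 0 \<and> q \<le> q0"
  shows "embeds (mixed_besov \<phi>0 t p q :: ((real ^ 'n::finite \<Rightarrow> complex) \<Rightarrow> complex) set) (mixed_norm \<phi>0 t p q)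
    (mixed_besov \<phi>0 t0 p0 q0) (mixed_norm \<phi>0 t0 p0 q0)"
proof -
  let ?d = "1 / enn2real p - 1 / enn2real p0" and ?n = "CARD('n)"
  obtain Z where Z: "0 \<le> Z" "\<forall>(f :: (real ^ 'n \<Rightarrow> complex) \<Rightarrow> complex) k. tempered f \<longrightarrow>
      Lp_norm p0 (fourier_mult (phi_multi \<phi>0 k) f) \<le>
        ennreal (Z * 2 powr (real (?n + (\<Sum>i\<in>UNIV. k i)) * ?d)) * Lp_norm p (fourier_mult (phi_multi \<phi>0 k) f)"
    using block_Lp_bound[OF \<phi>0 p, where 'n = 'n] by blast
  define K where "K = Z * 2 powr (real ?n * ?d)"
  have K: "0 \<le> K" using Z(1) by (simp add: K_def)
  define u where "u f k = ennreal (2 powr (real (\<Sum>i\<in>UNIV. k i) * t)) * Lp_norm p (fourier_mult (phi_multi \<phi>0 k) f)"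
    for f :: "(real^'n \<Rightarrow> complex) \<Rightarrow> complex" and k
  define u0 where "u0 f k = ennreal (2 powr (real (\<Sum>i\<in>UNIV. k i) * t0)) * Lp_norm p0 (fourier_mult (phi_multi \<phi>0 k) f)"
    for f :: "(real^'n \<Rightarrow> complex) \<Rightarrow> complex" and k
  have norms: "mixed_norm \<phi>0 t p q f = lq_norm q (u f)" "mixed_norm \<phi>0 t0 p0 q0 f = lq_norm q0 (u0 f)" for f
    by (simp_all add: mixed_norm_def u_def[abs_def] u0_def[abs_def])
  have block: "u0 f k \<le> ennreal K * (ennreal (2 powr (- \<delta> * real (\<Sum>i\<in>UNIV. k i))) * u f k)"
    if f: "tempered f" for f k
  proof -
    let ?k = "real (\<Sum>i\<in>UNIV. k i)"
    let ?L = "Lp_norm p (fourier_mult (phi_multi \<phi>0 k) f)"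
    have "u0 f k \<le> ennreal (2 powr (?k * t0)) * (ennreal (Z * 2 powr (real (?n + (\<Sum>i\<in>UNIV. k i)) * ?d)) * ?L)"
      unfolding u0_def by (rule mult_left_mono[OF Z(2)[rule_format, OF f]]) simp
    also have "\<dots> = ennreal (2 powr (?k * t0) * (Z * 2 powr (real (?n + (\<Sum>i\<in>UNIV. k i)) * ?d))) * ?L"
      using Z(1) by (simp add: ennreal_mult mult.assoc)
    also have "2 powr (?k * t0) * (Z * 2 powr (real (?n + (\<Sum>i\<in>UNIV. k i)) * ?d)) =
        K * (2 powr (- \<delta> * ?k) * 2 powr (?k * t))"
    proof -
      \<comment> \<open>By the definition of \<delta>, t0 plus the Nikolskii loss 1/p - 1/p0 equals
        t - \<delta>. The part of the loss that depends only on the dimension goes into K.\<close>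
      have "?k * t0 + real (?n + (\<Sum>i\<in>UNIV. k i)) * ?d = real ?n * ?d + (- \<delta> * ?k + ?k * t)"
        by (simp add: \<delta>_def algebra_simps)
      then have "2 powr (?k * t0) * 2 powr (real (?n + (\<Sum>i\<in>UNIV. k i)) * ?d) =
          2 powr (real ?n * ?d) * (2 powr (- \<delta> * ?k) * 2 powr (?k * t))"
        by (simp only: powr_add[symmetric])
      then show ?thesis by (simp only: K_def mult_ac)
    qed
    also have "ennreal (K * (2 powr (- \<delta> * ?k) * 2 powr (?k * t))) * ?L =
        ennreal K * (ennreal (2 powr (- \<delta> * ?k)) * u f k)"
      unfolding u_def using K by (simp only: ennreal_mult mult.assoc powr_ge_zero mult_nonneg_nonneg)
    finally show ?thesis .
  qed
  from cond consider "0 < \<delta>" | "\<delta> = 0" "q \<le> q0" by blast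
  then show ?thesis
  proof cases
    case 1
    \<comment> \<open>Each term of the source norm is bounded by the whole norm; the geometric
      weights alone are then summed in the target exponent, so q and q0 need not be related.\<close>
    obtain \<omega> where \<omega>: "lq_norm q0 (\<lambda>k::'n \<Rightarrow> nat. ennreal (2 powr (- \<delta> * real (\<Sum>i\<in>UNIV. k i)))) = ennreal \<omega>" "0 \<le> \<omega>"
      using lq_norm_geometric_finite[where 'n = 'n, OF q(2) 1] by (metis enn2real_nonneg ennreal_enn2real infinity_ennreal_def)
    have "mixed_norm \<phi>0 t0 p0 q0 f \<le> ennreal (K * \<omega>) * mixed_norm \<phi>0 t p q f"
      if f: "f \<in> mixed_besov \<phi>0 t p q" for f :: "(real^'n \<Rightarrow> complex) \<Rightarrow> complex"
    proof -
      have f': "tempered f" using f by (simp add: mixed_besov_def)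
      define \<sigma> where "\<sigma> = enn2real (lq_norm q (u f))"
      have \<sigma>: "lq_norm q (u f) = ennreal \<sigma>" "0 \<le> \<sigma>"
        using f by (simp_all add: \<sigma>_def mixed_besov_def norms)
      have "u0 f k \<le> ennreal (K * \<sigma>) * ennreal (2 powr (- \<delta> * real (\<Sum>i\<in>UNIV. k i)))" for k
      proof -
        have "u0 f k \<le> ennreal K * (ennreal (2 powr (- \<delta> * real (\<Sum>i\<in>UNIV. k i))) * ennreal \<sigma>)"
          using le_lq_norm[OF q(1), of "u f" k] unfolding \<sigma>(1)
          by (intro order_trans[OF block[OF f']] mult_left_mono) auto
        then show ?thesis using K \<sigma>(2) by (simp only: ennreal_mult mult_ac)
      qed
      then have "lq_norm q0 (u0 f) \<le>
          lq_norm q0 (\<lambda>k::'n \<Rightarrow> nat. ennreal (K * \<sigma>) * ennreal (2 powr (- \<delta> * real (\<Sum>i\<in>UNIV. k i))))"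
        by (rule lq_norm_mono[OF _ q(2)])
      also have "\<dots> = ennreal (K * \<sigma>) * ennreal \<omega>"
        using K \<sigma>(2) q(2) by (subst lq_norm_cmult) (simp_all add: \<omega>(1)[simplified])
      also have "\<dots> = ennreal (K * \<omega>) * lq_norm q (u f)"
        unfolding \<sigma>(1) using K \<sigma>(2) \<omega>(2) by (simp add: ennreal_mult[symmetric] mult_ac)
      finally show ?thesis by (simp only: norms)
    qed
    then show ?thesis by (rule embeds_mixed_besovI)
  next
    case 2
    have "mixed_norm \<phi>0 t0 p0 q0 f \<le> ennreal K * mixed_norm \<phi>0 t p q f"
      if f: "f \<in> mixed_besov \<phi>0 t p q" for f :: "(real^'n \<Rightarrow> complex) \<Rightarrow> complex"
    proof -
      have f': "tempered f" using f by (simp add: mixed_besov_def)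
      have "lq_norm q0 (u0 f) \<le> lq_norm q (u0 f)" by (rule lq_norm_antimono[OF q(1) 2(2)])
      also have "\<dots> \<le> lq_norm q (\<lambda>k. ennreal K * u f k)"
        using block[OF f'] 2(1) q(1) by (intro lq_norm_mono) auto
      also have "\<dots> = ennreal K * lq_norm q (u f)" by (rule lq_norm_cmult[OF K q(1)])
      finally show ?thesis by (simp only: norms)
    qed
    then show ?thesis by (rule embeds_mixed_besovI)
  qed
qed

theorem theorem3p11:
  fixes \<psi>0 :: "real^'n \<Rightarrow> real" and \<phi>0 :: "real \<Rightarrow> real"
    and p q p0 q0 :: ennreal and t t0 :: real
  assumes "admissible_iso \<psi>0" and "admissible_1d \<phi>0"
    and "0 < p" and "0 < q" and "0 < p0" and "0 < q0"
    and "embeds (besov \<psi>0 (t * real CARD('n)) p q) (besov_norm \<psi>0 (t * real CARD('n)) p q)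
                (mixed_besov \<phi>0 t0 p0 q0) (mixed_norm \<phi>0 t0 p0 q0)"
  shows "embeds (mixed_besov \<phi>0 t p q) (mixed_norm \<phi>0 t p q)
                (mixed_besov \<phi>0 t0 p0 q0) (mixed_norm \<phi>0 t0 p0 q0)"
proof -
  obtain C where "\<forall>f\<in>besov \<psi>0 (t * real CARD('n)) p q.
      mixed_norm \<phi>0 t0 p0 q0 f \<le> ennreal C * besov_norm \<psi>0 (t * real CARD('n)) p q f"
    using assms(7) unfolding embeds_def by blast
  note necessary = embedding_necessary[OF assms(1-6) this]
  show ?thesis
    by (rule mixed_besov_embedding[OF assms(2,3) necessary(1) assms(4,6) necessary(2)])
qed

end
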